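(* Let $u$ be a function defined on $\Gamma$, let $r>0$, let $n\ge 1$ and $m\ge 2$ be integers, and set $N:=2n-1$. Assume that either $\theta_1=\theta_2=-1/2$ (Chebyshev polynomials of the first kind), in which case set $s:=\ln 3/\ln 2$, or $\theta_1,\theta_2\in\mathbb{N}_0$, in which case set $s:=2\max\{\theta_1,\theta_2\}+2$. Let $\zeta:=(1-\ln 2)/2$. (1) In any finite dimension $d$, if at least one of the following three conditions holds: $$\frac{m}{\ln m}\ \ge\ \frac{1+r}{\zeta}\,\bigl(\#(\mathcal{H}_{N}^{d})\bigr)^{s},$$ $$\frac{m}{\ln m}\ \ge\ \Bigl(1+r+\frac{N d\ln 2}{\ln m}\Bigr)\frac{N^{s}}{\zeta},$$ $$\frac{m}{\ln m}\ \ge\ \Bigl(1+r+\frac{N\ln(dN)}{\ln m}\Bigr)\frac{N^{s}}{\zeta},$$ then $$\Pr\Bigl(\|u-w_n\|\le (1+2\sqrt2)\min_{\Lambda\in\mathcal{M}_n^d}\ \min_{v\in\mathbb{P}_\Lambda}\|u-v\|_{L^\infty(\Gamma)}\Bigr)\ \ge\ 1-2m^{-r}.$$ (2) In any finite or infinite dimension $d$, if at least one of the following three conditions holds: $$\frac{m}{\ln m}\ \ge\ \frac{1+r}{\zeta}\,\bigl(\#(\mathcal{H}_{N}^{N-1})\bigr)^{s},$$ $$\frac{m}{\ln m}\ \ge\ \Bigl(1+r+\frac{N^2\ln 2}{\ln m}\Bigr)\frac{N^{s}}{\zeta},$$ $$\frac{m}{\ln m}\ \ge\ \Bigl(1+r+\frac{2N\ln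 N}{\ln m}\Bigr)\frac{N^{s}}{\zeta},$$ then $$\Pr\Bigl(\|u-\tilde w_n\|\le (1+2\sqrt2)\min_{\Lambda\in\mathcal{A}_n}\ \min_{v\in\mathbb{P}_\Lambda}\|u-v\|_{L^\infty(\Gamma)}\Bigr)\ \ge\ 1-2m^{-r}.$$
   Context: Domain and measure. For $d\in\mathbb{N}$ let $\Gamma=[-1,1]^d$; for $d=\infty$ let $\Gamma=[-1,1]^{\mathbb{N}}$. Given real $\theta_1,\theta_2>-1$, let $d\beta(t)=c(1-t)^{\theta_1}(1+t)^{\theta_2}dt$ be the Jacobi probability measure on $[-1,1]$ ($c$ is the normalizing constant), and let $d\rho=\otimes_{j}d\beta$ be the product probability measure on $\Gamma$ (infinite product if $d=\infty$). $\|\cdot\|$ denotes the norm of $L^2(\Gamma,d\rho)$. The function $u:\Gamma\to\mathbb{R}$ is measurable. Multi-indices. $\mathbb{N}_0=\{0,1,2,\dots\}$. $\mathcal{F}=\mathbb{N}_0^d$ if $d<\infty$; if $d=\infty$, $\mathcal{F}$ is the set of finitely supported sequences of elements of $\mathbb{N}_0$. A set $\Lambda\subset\mathcal{F}$ is downward closed if $\nu\in\Lambda$ and $\mu\le\nu$ (componentwise) imply $\mu\in\Lambda$. It is anchored if it is downward closed and, in addition, $e_j\in\Lambda$ and $j'\le j$ imply $e_{j'}\in\Lambda$, where $e_j$ is the Kronecker sequence with $1$ at position $j$. $\mathcal{M}_n^d$ is the family of all downward closed sets $\Lambda\subset\mathcal{F}$ with $\#(\Lambda)=n$ and $\mathcal{A}_n$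 is the family of all anchored sets $\Lambda\subset\mathcal{F}$ with $\#(\Lambda)=n$. For finite $\Lambda$, $\mathbb{P}_\Lambda=\mathrm{span}\{y\mapsto y^\nu:\nu\in\Lambda\}$. For an integer $q\ge 1$ the hyperbolic cross is $\mathcal{H}_n^q=\{\mu\in\mathbb{N}_0^q:\prod_{j=1}^q(\mu_j+1)\le n\}$; by convention $\#(\mathcal{H}_1^0)=1$. Samples and estimators. $y^1,\dots,y^m$ are i.i.d. random points in $\Gamma$ distributed according to $d\rho$, and $\|v\|_m=\bigl(\frac1m\sum_{i=1}^m v(y^i)^2\bigr)^{1/2}$. The (random) optimized index sets and estimators are $$\Lambda_m^{opt}=\operatorname{argmin}_{\Lambda\in\mathcal{M}_n^d}\min_{v\in\mathbb{P}_\Lambda}\|u-v\|_m,\qquad w_n=\operatorname{argmin}_{v\in\mathbb{P}_{\Lambda_m^{opt}}}\|u-v\|_m,$$ $$\tilde\Lambda_m^{opt}=\operatorname{argmin}_{\Lambda\in\mathcal{A}_n}\min_{v\in\mathbb{P}_\Lambda}\|u-v\|_m,\qquad \tilde w_n=\operatorname{argmin}_{v\in\mathbb{P}_{\tilde\Lambda_m^{opt}}}\|u-v\|_m,$$ with ties broken in some fixed (measurable) way. *)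

theory Defs
  imports "HOL-Probability.Probability"
begin

section \<open>Domain and measure\<close>

text \<open>Coordinates are numbered from 0, so they are \<open>0, \<dots>, d - 1\<close> for finite \<open>d\<close> and
  all of \<open>\<nat>\<close> for \<open>d = \<infinity>\<close>.\<close>

definition coords :: "enat \<Rightarrow> nat set" where
  "coords d = {j. enat j < d}"

definition jacobi_weight :: "real \<Rightarrow> real \<Rightarrow> real \<Rightarrow> real" where
  "jacobi_weight \<theta>1 \<theta>2 t = (1 - t) powr \<theta>1 * (1 + t) powr \<theta>2"

definition jacobi_measure :: "real \<Rightarrow> real \<Rightarrow> real measure" where
  "jacobi_measure \<theta>1 \<theta>2 =
     density (restrict_space lborel {-1..1})
       (\<lambda>t. ennreal (jacobi_weight \<theta>1 \<theta>2 t / (LBINT t:{-1..1}. jacobi_weight \<theta>1 \<theta>2 t)))"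

definition jacobi_product :: "enat \<Rightarrow> real \<Rightarrow> real \<Rightarrow> (nat \<Rightarrow> real) measure" where
  "jacobi_product d \<theta>1 \<theta>2 = (\<Pi>\<^sub>M j\<in>coords d. jacobi_measure \<theta>1 \<theta>2)"

lemma space_jacobi_product:
  "space (jacobi_product d \<theta>1 \<theta>2) = (\<Pi>\<^sub>E j\<in>coords d. {-1..1})"
  by (simp add: jacobi_product_def jacobi_measure_def space_PiM space_restrict_space)


section \<open>Norms\<close>

text \<open>Both norms are extended: they are \<open>\<infinity>\<close> for a measurable function outside the space in
  question.\<close>

definition L2_norm :: "'a measure \<Rightarrow> ('a \<Rightarrow> real) \<Rightarrow> ennreal" where
  "L2_norm M f =
     (if integrable M (\<lambda>x. (f x)\<^sup>2) then ennreal (sqrt (\<integral>x. (f x)\<^sup>2 \<partial>M)) else \<infinity>)"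

definition Linf_norm :: "'a measure \<Rightarrow> ('a \<Rightarrow> real) \<Rightarrow> ennreal" where
  "Linf_norm M f = esssup M (\<lambda>x. ennreal \<bar>f x\<bar>)"

definition sample_norm :: "nat \<Rightarrow> (nat \<Rightarrow> 'a) \<Rightarrow> ('a \<Rightarrow> real) \<Rightarrow> real" where
  "sample_norm m ys f = sqrt (1 / real m * (\<Sum>i<m. (f (ys i))\<^sup>2))"


section \<open>Index sets and polynomial spaces\<close>

text \<open>For finite \<open>d\<close> the elements of \<open>\<nat>\<^sub>0\<^sup>d\<close> are represented by their extensions by zero.\<close>

definition multi_indices :: "enat \<Rightarrow> (nat \<Rightarrow> nat) set" where
  "multi_indices d = {\<nu>. {j. \<nu> j \<noteq> 0} \<subseteq> coords d \<and> finite {j. \<nu> j \<noteq> 0}}"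

definition unit_index :: "nat \<Rightarrow> nat \<Rightarrow> nat" where
  "unit_index j = (\<lambda>i. if i = j then 1 else 0)"

definition downward_closed :: "(nat \<Rightarrow> nat) set \<Rightarrow> bool" where
  "downward_closed \<Lambda> \<longleftrightarrow> (\<forall>\<nu>\<in>\<Lambda>. \<forall>\<mu>\<le>\<nu>. \<mu> \<in> \<Lambda>)"

definition anchored :: "(nat \<Rightarrow> nat) set \<Rightarrow> bool" where
  "anchored \<Lambda> \<longleftrightarrow>
     downward_closed \<Lambda> \<and> (\<forall>j. unit_index j \<in> \<Lambda> \<longrightarrow> (\<forall>j'\<le>j. unit_index j' \<in> \<Lambda>))"

definition downward_closed_sets :: "enat \<Rightarrow> nat \<Rightarrow> (nat \<Rightarrow> nat) set set" where
  "downward_closed_sets d n =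
     {\<Lambda>. \<Lambda> \<subseteq> multi_indices d \<and> downward_closed \<Lambda> \<and> finite \<Lambda> \<and> card \<Lambda> = n}"

definition anchored_sets :: "enat \<Rightarrow> nat \<Rightarrow> (nat \<Rightarrow> nat) set set" where
  "anchored_sets d n =
     {\<Lambda>. \<Lambda> \<subseteq> multi_indices d \<and> anchored \<Lambda> \<and> finite \<Lambda> \<and> card \<Lambda> = n}"

text \<open>For \<open>q = 0\<close> this contains the zero index only (if \<open>n \<ge> 1\<close>), so its cardinality is 1.\<close>

definition hyperbolic_cross :: "nat \<Rightarrow> nat \<Rightarrow> (nat \<Rightarrow> nat) set" where
  "hyperbolic_cross n q = {\<mu> \<in> multi_indices (enat q). (\<Prod>j<q. \<mu> j + 1) \<le> n}"

definition monomial :: "(nat \<Rightarrow> nat) \<Rightarrow> (nat \<Rightarrow> real) \<Rightarrow> real" where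
  "monomial \<nu> y = (\<Prod>j | \<nu> j \<noteq> 0. y j ^ \<nu> j)"

text \<open>The linear span of the monomials, for finite \<open>\<Lambda>\<close>.\<close>

definition poly_space :: "(nat \<Rightarrow> nat) set \<Rightarrow> ((nat \<Rightarrow> real) \<Rightarrow> real) set" where
  "poly_space \<Lambda> = range (\<lambda>c y. \<Sum>\<nu>\<in>\<Lambda>. c \<nu> * monomial \<nu> y)"


section \<open>Best approximation and optimized least squares\<close>

definition best_Linf_error ::
    "(nat \<Rightarrow> real) measure \<Rightarrow> ((nat \<Rightarrow> real) \<Rightarrow> real) \<Rightarrow> (nat \<Rightarrow> nat) set set \<Rightarrow> ennreal" where
  "best_Linf_error \<rho> u \<L> =
     (INF \<Lambda>\<in>\<L>. INF v\<in>poly_space \<Lambda>. Linf_norm \<rho> (\<lambda>y. u y - v y))"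

definition best_sample_error ::
    "nat \<Rightarrow> (nat \<Rightarrow> nat \<Rightarrow> real) \<Rightarrow> ((nat \<Rightarrow> real) \<Rightarrow> real) \<Rightarrow> (nat \<Rightarrow> nat) set \<Rightarrow> real" where
  "best_sample_error m ys u \<Lambda> = (INF v\<in>poly_space \<Lambda>. sample_norm m ys (\<lambda>y. u y - v y))"

text \<open>The selected index set \<open>L ys\<close> and estimator \<open>w ys\<close> are functions of the sample
  \<open>ys = (ys 0, \<dots>, ys (m - 1))\<close>. The two measurability conditions are the measurability of the
  tie-breaking rule.\<close>

definition optimized_least_squares ::
    "(nat \<Rightarrow> real) measure \<Rightarrow> nat \<Rightarrow> ((nat \<Rightarrow> real) \<Rightarrow> real) \<Rightarrow> (nat \<Rightarrow> nat) set set \<Rightarrow>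
     ((nat \<Rightarrow> nat \<Rightarrow> real) \<Rightarrow> (nat \<Rightarrow> nat) set) \<Rightarrow>
     ((nat \<Rightarrow> nat \<Rightarrow> real) \<Rightarrow> (nat \<Rightarrow> real) \<Rightarrow> real) \<Rightarrow> bool" where
  "optimized_least_squares \<rho> m u \<L> L w \<longleftrightarrow>
     (\<forall>ys \<in> space (\<Pi>\<^sub>M i\<in>{..<m}. \<rho>).
        is_arg_min (best_sample_error m ys u) (\<lambda>\<Lambda>. \<Lambda> \<in> \<L>) (L ys) \<and>
        is_arg_min (\<lambda>v. sample_norm m ys (\<lambda>y. u y - v y)) (\<lambda>v. v \<in> poly_space (L ys)) (w ys)) \<and>
     L \<in> measurable (\<Pi>\<^sub>M i\<in>{..<m}. \<rho>) (count_space \<L>) \<and>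
     (\<lambda>(ys, y). w ys y) \<in> borel_measurable ((\<Pi>\<^sub>M i\<in>{..<m}. \<rho>) \<Otimes>\<^sub>M \<rho>)"

end

theory Submission
  imports Defs "HOL-Computational_Algebra.Polynomial"
begin

text \<open>
  The union of two competing index sets is downward closed with at most \<open>N = 2 n - 1\<close> elements. If
  \<open>\<parallel>v\<parallel>\<^sup>2 \<le> 2 \<parallel>v\<parallel>\<^sub>m\<^sup>2\<close> holds on the polynomial spaces of all these unions, then the triangle inequality
  bounds the error by \<open>1 + 2 \<surd>2\<close> times the \<open>L\<^sup>\<infinity>\<close> error of any competitor.

  The norm inequality on one space is the lower tail of a matrix Chernoff bound for sums of rank-one
  matrices \<open>x x\<^sup>T\<close> with \<open>\<bar>x\<bar>\<^sup>2 \<le> K\<close>. Its trace inequality is of Golden--Thompson type, but only for a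
  rank-one perturbation; there it follows from the log-convexity of the moments \<open>x\<^sup>T C\<^sup>k x\<close> of a
  positive semidefinite matrix, so neither eigenvalues nor matrix exponentials are needed. The
  constant \<open>(1 - ln 2) / 2\<close> is the Chernoff exponent for the threshold \<open>1/2\<close>.

  The bound \<open>K \<le> card \<Lambda> powr s\<close> reduces, slicing \<open>\<Lambda>\<close> along one coordinate after the other, to the
  one-dimensional case \<open>p(t)\<^sup>2 \<le> n powr s * \<integral> p\<^sup>2\<close> for \<open>deg p < n\<close>. For integer Jacobi parameters this
  is obtained from the value of the Legendre polynomials at an endpoint by splitting \<open>[-1, 1]\<close> at
  \<open>t\<close> and integrating by parts. Finally one either works on the space of the hyperbolic cross,
  which contains all the unions, or takes a union bound over all downward closed sets.
\<close>

section \<open>Moments and traces of positive semidefinite matrices\<close>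

text \<open>The lower tail of a sum of matrices x x^T becomes the upper tail of the sum of K Id - x
  x^T. These are positive semidefinite, so all coefficients of the series of tr exp (t A) are
  nonnegative: the trace is estimated coefficient by coefficient, and the series is summed only at
  the end, in \<open>ennreal\<close>. The obstacle is that the summands do not commute. It suffices
  to bound tr C^k after adding one random summand to a fixed A, by an expression that is affine in
  the moments x^T A^j x, because the expectation of such a moment is tr A^j. Integrating one sample
  after the other, the trace moments are at most the number of basis functions times the moments of
  a scalar random walk with steps 0 and K. The trace thus puts the dimension N into the failure
  probability. The 1 in 1 + r pays for it, since the condition on m forces N \<le> m. The number of
  spaces in the union bound enters through its logarithm, which explains the terms with ln 2 and
  with ln (d N); for the hyperbolic cross there is one space, but N is replaced by its
  dimension.\<close>

definition dotp :: "'i set \<Rightarrow> ('i \<Rightarrow> real) \<Rightarrow> ('i \<Rightarrow> real) \<Rightarrow> real" where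
  "dotp I u v = (\<Sum>i\<in>I. u i * v i)"

definition mvmult :: "'i set \<Rightarrow> ('i \<Rightarrow> 'i \<Rightarrow> real) \<Rightarrow> ('i \<Rightarrow> real) \<Rightarrow> 'i \<Rightarrow> real" where
  "mvmult I A v = (\<lambda>i. \<Sum>j\<in>I. A i j * v j)"

text \<open>Powers act on vectors by iteration, so matrices are never multiplied with each other:
  A^k appears only through vectors A^k v and forms u^T A^k v.\<close>

definition mvpow :: "'i set \<Rightarrow> ('i \<Rightarrow> 'i \<Rightarrow> real) \<Rightarrow> nat \<Rightarrow> ('i \<Rightarrow> real) \<Rightarrow> 'i \<Rightarrow> real" where
  "mvpow I A k v = (mvmult I A ^^ k) v"

definition trpow :: "'i set \<Rightarrow> ('i \<Rightarrow> 'i \<Rightarrow> real) \<Rightarrow> nat \<Rightarrow> real" where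
  "trpow I A k = (\<Sum>e\<in>I. mvpow I A k (\<lambda>i. of_bool (i = e)) e)"

definition sym_psd :: "'i set \<Rightarrow> ('i \<Rightarrow> 'i \<Rightarrow> real) \<Rightarrow> bool" where
  "sym_psd I A \<longleftrightarrow> (\<forall>i\<in>I. \<forall>j\<in>I. A i j = A j i) \<and> (\<forall>v. 0 \<le> dotp I v (mvmult I A v))"

definition reflector :: "real \<Rightarrow> ('i \<Rightarrow> real) \<Rightarrow> 'i \<Rightarrow> 'i \<Rightarrow> real" where
  "reflector K x = (\<lambda>i j. K * of_bool (i = j) - x i * x j)"

lemma dotp_commute: "dotp I u v = dotp I v u"
  by (simp add: dotp_def mult.commute)

lemma dotp_add_left: "dotp I (\<lambda>i. u i + v i) w = dotp I u w + dotp I v w"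
  by (simp add: dotp_def algebra_simps sum.distrib)

lemma dotp_scale_left: "dotp I (\<lambda>i. c * u i) w = c * dotp I u w"
  by (simp add: dotp_def sum_distrib_left algebra_simps)

lemma dotp_cong: "(\<And>i. i \<in> I \<Longrightarrow> u i = u' i) \<Longrightarrow> (\<And>i. i \<in> I \<Longrightarrow> v i = v' i) \<Longrightarrow> dotp I u v = dotp I u' v'"
  by (simp add: dotp_def)

lemma dotp_self_nonneg: "0 \<le> dotp I v v"
  by (simp add: dotp_def sum_nonneg)

lemma mvpow_0 [simp]: "mvpow I A 0 v = v"
  by (simp add: mvpow_def)

lemma mvpow_Suc: "mvpow I A (Suc k) v = mvmult I A (mvpow I A k v)"
  by (simp add: mvpow_def)

lemma mvpow_add: "mvpow I A (a + b) v = mvpow I A a (mvpow I A b v)"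
  by (simp add: mvpow_def funpow_add)

lemma mvmult_symmetric:
  assumes "\<And>i j. i \<in> I \<Longrightarrow> j \<in> I \<Longrightarrow> A i j = A j i"
  shows "dotp I (mvmult I A u) v = dotp I u (mvmult I A v)"
proof -
  have "dotp I (mvmult I A u) v = (\<Sum>i\<in>I. \<Sum>j\<in>I. A i j * u j * v i)"
    by (simp add: dotp_def mvmult_def sum_distrib_right)
  also have "\<dots> = (\<Sum>j\<in>I. \<Sum>i\<in>I. A i j * u j * v i)"
    by (rule sum.swap)
  also have "\<dots> = dotp I u (mvmult I A v)"
    unfolding dotp_def mvmult_def sum_distrib_left
    by (intro sum.cong refl) (simp add: assms algebra_simps)
  finally show ?thesis .
qed

lemma mvpow_symmetric:
  assumes "\<And>i j. i \<in> I \<Longrightarrow> j \<in> I \<Longrightarrow> A i j = A j i"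
  shows "dotp I (mvpow I A k u) v = dotp I u (mvpow I A k v)"
proof (induction k arbitrary: u v)
  case (Suc k)
  have "dotp I (mvpow I A (Suc k) u) v = dotp I (mvpow I A k u) (mvmult I A v)"
    by (simp add: mvpow_Suc mvmult_symmetric[of I A, OF assms])
  also have "\<dots> = dotp I u (mvpow I A k (mvmult I A v))"
    by (rule Suc)
  also have "mvpow I A k (mvmult I A v) = mvpow I A (Suc k) v"
    by (simp add: mvpow_def funpow_swap1)
  finally show ?case .
qed simp

lemma sym_psd_symD: "sym_psd I A \<Longrightarrow> i \<in> I \<Longrightarrow> j \<in> I \<Longrightarrow> A i j = A j i"
  by (auto simp: sym_psd_def)

lemma dotp_mvpow_add:
  assumes "sym_psd I A"
  shows "dotp I (mvpow I A a u) (mvpow I A b v) = dotp I u (mvpow I A (a + b) v)"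
  by (simp add: mvpow_symmetric[OF sym_psd_symD[OF assms]] mvpow_add)

lemma mvmult_add: "mvmult I A (\<lambda>i. u i + v i) = (\<lambda>i. mvmult I A u i + mvmult I A v i)"
  by (simp add: mvmult_def algebra_simps sum.distrib)

lemma mvmult_scale: "mvmult I A (\<lambda>i. c * u i) = (\<lambda>i. c * mvmult I A u i)"
  by (simp add: mvmult_def algebra_simps sum_distrib_left)

section \<open>Quadratic forms, the Cauchy-Schwarz inequality and moments\<close>

lemma quadratic_nonneg_discriminant:
  fixes a b c :: real
  assumes "\<And>t. 0 \<le> a + 2 * t * b + t\<^sup>2 * c" and "0 \<le> c"
  shows "b\<^sup>2 \<le> a * c"
proof (cases "c = 0")
  case True
  have "b = 0"
  proof (rule ccontr)
    assume "b \<noteq> 0"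
    \<comment> \<open>For c = 0 the expression is affine in t, and this t gives it the value -1.
      Otherwise the minimizer - b / c decides.\<close>
    have "0 \<le> a + 2 * (- (a + 1) / (2 * b)) * b"
      using assms(1)[of "- (a + 1) / (2 * b)"] True by simp
    also have "\<dots> = -1"
      using \<open>b \<noteq> 0\<close> by (simp add: field_simps)
    finally show False by simp
  qed
  then show ?thesis using True by simp
next
  case False
  then have c: "c > 0" using assms(2) by simp
  have "0 \<le> a + 2 * (- b / c) * b + (- b / c)\<^sup>2 * c"
    by (rule assms(1))
  also have "\<dots> = a - b\<^sup>2 / c"
    using c by (simp add: power2_eq_square field_simps)
  finally show ?thesis using c by (simp add: field_simps)
qed

lemma dotp_mvmult_quadratic:
  assumes "sym_psd I A"
  shows "dotp I (\<lambda>i. u i + t * v i) (mvmult I A (\<lambda>i. u i + t * v i)) =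
    dotp I u (mvmult I A u) + 2 * t * dotp I u (mvmult I A v) + t\<^sup>2 * dotp I v (mvmult I A v)"
proof -
  have "dotp I v (mvmult I A u) = dotp I u (mvmult I A v)"
    using mvmult_symmetric[of I A v u] sym_psd_symD[OF assms] by (simp add: dotp_commute)
  then show ?thesis
    unfolding mvmult_add mvmult_scale dotp_add_left dotp_scale_left
    by (simp add: dotp_commute[of I _ "\<lambda>i. mvmult I A u i + t * mvmult I A v i"]
      dotp_add_left dotp_scale_left dotp_commute[of I "mvmult I A _"] power2_eq_square algebra_simps)
qed

lemma psd_cauchy_schwarz:
  assumes "sym_psd I A"
  shows "(dotp I u (mvmult I A v))\<^sup>2 \<le> dotp I u (mvmult I A u) * dotp I v (mvmult I A v)"
proof (rule quadratic_nonneg_discriminant)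
  fix t
  show "0 \<le> dotp I u (mvmult I A u) + 2 * t * dotp I u (mvmult I A v) + t\<^sup>2 * dotp I v (mvmult I A v)"
    unfolding dotp_mvmult_quadratic[OF assms, symmetric] using assms by (simp add: sym_psd_def)
qed (use assms in \<open>simp add: sym_psd_def\<close>)

lemma dotp_cauchy_schwarz: "(dotp I u v)\<^sup>2 \<le> dotp I u u * dotp I v v"
  unfolding dotp_def using Cauchy_Schwarz_ineq_sum[of u v I] by (simp add: power2_eq_square)

text \<open>Half of the factors moves to the left: even k gives the squared norm of A^b x, odd k the
  form of A at A^b x.\<close>

lemma moment_nonneg:
  assumes "sym_psd I A"
  shows "0 \<le> dotp I x (mvpow I A k x)"
proof -
  obtain b where "k = b + b \<or> k = Suc (b + b)"
    by (metis add_Suc_right evenE mult_2 oddE Suc_eq_plus1)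
  then show ?thesis
  proof
    assume "k = b + b"
    then show ?thesis
      using dotp_mvpow_add[OF assms, of b x b x] dotp_self_nonneg[of I "mvpow I A b x"] by simp
  next
    assume k: "k = Suc (b + b)"
    have "0 \<le> dotp I (mvpow I A b x) (mvmult I A (mvpow I A b x))"
      using assms by (simp add: sym_psd_def)
    then show ?thesis
      using dotp_mvpow_add[OF assms, of b x "Suc b" x] k by (simp add: mvpow_Suc)
  qed
qed

text \<open>Cauchy-Schwarz for the vectors A^b x and A^(b+1) x, with the Euclidean product for even
  k and with the form of A for odd k.\<close>

lemma moment_log_convex:
  assumes "sym_psd I A"
  shows "(dotp I x (mvpow I A (Suc k) x))\<^sup>2
    \<le> dotp I x (mvpow I A k x) * dotp I x (mvpow I A (Suc (Suc k)) x)"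
proof -
  obtain b where "k = b + b \<or> k = Suc (b + b)"
    by (metis add_Suc_right evenE mult_2 oddE Suc_eq_plus1)
  then show ?thesis
  proof
    assume k: "k = b + b"
    show ?thesis
      using dotp_cauchy_schwarz[of I "mvpow I A b x" "mvpow I A (Suc b) x"] k
      by (simp add: dotp_mvpow_add[OF assms])
  next
    assume k: "k = Suc (b + b)"
    show ?thesis
      using psd_cauchy_schwarz[OF assms, of "mvpow I A b x" "mvpow I A (Suc b) x"] k
      by (simp add: dotp_mvpow_add[OF assms] flip: mvpow_Suc)
  qed
qed

text \<open>The ratios M (k+1) / M k are nondecreasing. The form without division covers vanishing
  moments; in the induction a factor M (i+j) is cancelled, which is positive unless the left side is
  0.\<close>

lemma log_convex_shift:
  fixes M :: "nat \<Rightarrow> real"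
  assumes nn: "\<And>k. 0 \<le> M k" and lc: "\<And>k. (M (Suc k))\<^sup>2 \<le> M k * M (Suc (Suc k))"
  shows "M (Suc i) * M (i + j) \<le> M i * M (Suc (i + j))"
proof (induction j)
  case (Suc j)
  show ?case
  proof (cases "M (Suc (i + j)) = 0")
    case True
    then show ?thesis using nn by simp
  next
    case False
    then have "0 < M (i + j) * M (Suc (Suc (i + j)))"
      using lc[of "i + j"] by (smt (verit) zero_less_power2)
    then have pos: "0 < M (i + j)"
      using nn[of "i + j"] by (metis less_eq_real_def mult_zero_left)
    have "M (Suc i) * M (Suc (i + j)) * M (i + j) \<le> (M i * M (Suc (i + j))) * M (Suc (i + j))"
      using mult_right_mono[OF Suc nn[of "Suc (i + j)"]] by (simp add: mult_ac)
    also have "\<dots> \<le> M i * (M (i + j) * M (Suc (Suc (i + j))))"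
      using mult_left_mono[OF lc[of "i + j"] nn[of i]] by (simp add: power2_eq_square mult_ac)
    finally have "(M (Suc i) * M (Suc (i + j))) * M (i + j) \<le> (M i * M (Suc (Suc (i + j)))) * M (i + j)"
      by (simp add: mult_ac)
    then show ?thesis using pos by simp
  qed
qed simp

text \<open>By \<open>log_convex_shift\<close> the product grows when the two indices move apart by
  one step each; this is repeated until the smaller one is 0.\<close>

lemma log_convex_mult:
  fixes M :: "nat \<Rightarrow> real"
  assumes nn: "\<And>k. 0 \<le> M k" and lc: "\<And>k. (M (Suc k))\<^sup>2 \<le> M k * M (Suc (Suc k))"
  shows "M i * M j \<le> M 0 * M (i + j)"
proof -
  have *: "M i * M j \<le> M 0 * M (i + j)" if "i \<le> j" for i j
    using that
  proof (induction i arbitrary: j)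
    case (Suc i)
    have "M (Suc i) * M j \<le> M i * M (Suc j)"
      using log_convex_shift[of M i "j - i", OF nn lc] Suc.prems by simp
    also have "\<dots> \<le> M 0 * M (Suc i + j)"
      using Suc.IH[of "Suc j"] Suc.prems by simp
    finally show ?case .
  qed simp
  show ?thesis
    using *[of i j] *[of j i] by (cases "i \<le> j") (auto simp: mult.commute add.commute)
qed

lemma moment_mult:
  assumes "sym_psd I A"
  shows "dotp I x (mvpow I A i x) * dotp I x (mvpow I A j x) \<le> dotp I x x * dotp I x (mvpow I A (i + j) x)"
  using log_convex_mult[of "\<lambda>k. dotp I x (mvpow I A k x)" i j,
      OF moment_nonneg[OF assms] moment_log_convex[OF assms]] by simp

text \<open>Jensen's inequality for the spectral measure of A at x, obtained from log-convexity
  instead of a diagonalization.\<close>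

lemma moment_power:
  assumes "sym_psd I A" and "dotp I x x = 1"
  shows "(dotp I x (mvmult I A x)) ^ k \<le> dotp I x (mvpow I A k x)"
proof (induction k)
  case (Suc k)
  have "(dotp I x (mvmult I A x)) ^ Suc k \<le> dotp I x (mvmult I A x) * dotp I x (mvpow I A k x)"
    using Suc moment_nonneg[OF assms(1), of x 1] by (simp add: mvpow_Suc mult_left_mono)
  also have "\<dots> \<le> dotp I x (mvpow I A (Suc k) x)"
    using moment_mult[OF assms(1), of x 1 k] assms(2) by (simp add: mvpow_Suc)
  finally show ?case .
qed (simp add: assms)

lemma dotp_unit: "finite I \<Longrightarrow> e \<in> I \<Longrightarrow> dotp I (\<lambda>i. of_bool (i = e)) v = v e"
  by (simp add: dotp_def of_bool_def if_distrib[of "\<lambda>a. a * _"] sum.delta cong: if_cong)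

lemma trpow_altdef:
  "finite I \<Longrightarrow> trpow I A k =
    (\<Sum>e\<in>I. dotp I (\<lambda>i. of_bool (i = e)) (mvpow I A k (\<lambda>i. of_bool (i = e))))"
  by (simp add: trpow_def dotp_unit)

lemma trpow_nonneg: "finite I \<Longrightarrow> sym_psd I A \<Longrightarrow> 0 \<le> trpow I A k"
  by (simp add: trpow_altdef moment_nonneg sum_nonneg)

text \<open>Linearity in v is read off from symmetry: coordinate i of A^k v is the dot product of v
  with A^k applied to the unit vector at i.\<close>

lemma mvpow_expand:
  assumes "finite I" and "sym_psd I A" and "i \<in> I"
  shows "mvpow I A k v i = (\<Sum>e\<in>I. v e * mvpow I A k (\<lambda>i. of_bool (i = e)) i)"
proof -
  have *: "mvpow I A k w i = dotp I (mvpow I A k (\<lambda>j. of_bool (j = i))) w" for w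
    using mvpow_symmetric[of I A k "\<lambda>j. of_bool (j = i)" w] sym_psd_symD[OF assms(2)] assms(1,3)
    by (simp add: dotp_unit)
  have "mvpow I A k (\<lambda>i. of_bool (i = e)) i = mvpow I A k (\<lambda>j. of_bool (j = i)) e" if "e \<in> I" for e
    using *[of "\<lambda>i. of_bool (i = e)"] dotp_unit[OF assms(1) that] by (simp add: dotp_commute)
  then show ?thesis
    by (subst *) (simp add: dotp_def mult.commute)
qed

text \<open>The entries of the matrix of the form satisfy \<open>B\<^sub>i\<^sub>j\<^sup>2 \<le> B\<^sub>i\<^sub>i B\<^sub>j\<^sub>j\<close>.\<close>

lemma moment_le_trpow:
  assumes "finite I" and "sym_psd I A" and "dotp I x x = 1"
  shows "dotp I x (mvpow I A k x) \<le> trpow I A k"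
proof -
  define B where "B = (\<lambda>i j. mvpow I A k (\<lambda>l. of_bool (l = j)) i)"
  have mult_B: "mvmult I B v i = mvpow I A k v i" if "i \<in> I" for v i
    using mvpow_expand[OF assms(1,2) that, of k v] by (simp add: mvmult_def B_def mult.commute)
  have dotp_B: "dotp I u (mvmult I B v) = dotp I u (mvpow I A k v)" for u v
    by (intro dotp_cong) (simp_all add: mult_B)
  have entry: "B i j = dotp I (\<lambda>l. of_bool (l = i)) (mvmult I B (\<lambda>l. of_bool (l = j)))"
    if "i \<in> I" for i j
    using that assms(1) by (simp only: dotp_B) (simp add: dotp_unit B_def)
  have psd: "sym_psd I B"
    unfolding sym_psd_def
  proof (intro conjI ballI allI)
    fix i j assume "i \<in> I" "j \<in> I"
    then show "B i j = B j i"
      using mvpow_symmetric[of I A k "\<lambda>l. of_bool (l = i)" "\<lambda>l. of_bool (l = j)"]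
        sym_psd_symD[OF assms(2)] assms(1) dotp_commute[of I "mvpow I A k (\<lambda>l. of_bool (l = i))"]
      by (simp add: B_def dotp_unit)
  qed (simp add: dotp_B moment_nonneg assms)
  have diag: "0 \<le> B i i" if "i \<in> I" for i
    using psd entry[OF that] unfolding sym_psd_def by metis
  have abs: "\<bar>B i j\<bar> \<le> sqrt (B i i) * sqrt (B j j)" if "i \<in> I" "j \<in> I" for i j
  proof -
    have "(B i j)\<^sup>2 \<le> B i i * B j j"
      unfolding entry[OF that(1), of j] entry[OF that(1), of i] entry[OF that(2), of j]
      by (rule psd_cauchy_schwarz[OF psd])
    then show ?thesis
      by (metis real_le_rsqrt real_sqrt_mult real_sqrt_abs real_sqrt_le_iff)
  qed
  have "dotp I x (mvpow I A k x) = (\<Sum>i\<in>I. \<Sum>j\<in>I. x i * (B i j * x j))"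
    by (simp add: dotp_B[symmetric]) (simp add: dotp_def mvmult_def sum_distrib_left)
  also have "\<dots> \<le> (\<Sum>i\<in>I. \<Sum>j\<in>I. (\<bar>x i\<bar> * sqrt (B i i)) * (\<bar>x j\<bar> * sqrt (B j j)))"
  proof (intro sum_mono)
    fix i j assume ij: "i \<in> I" "j \<in> I"
    have "x i * (B i j * x j) \<le> \<bar>x i\<bar> * \<bar>x j\<bar> * \<bar>B i j\<bar>"
      by (metis abs_ge_self abs_mult mult.assoc mult.commute)
    also have "\<dots> \<le> \<bar>x i\<bar> * \<bar>x j\<bar> * (sqrt (B i i) * sqrt (B j j))"
      by (intro mult_left_mono abs ij) simp
    finally show "x i * (B i j * x j) \<le> (\<bar>x i\<bar> * sqrt (B i i)) * (\<bar>x j\<bar> * sqrt (B j j))"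
      by (simp add: mult_ac)
  qed
  \<comment> \<open>The double sum factors into the square of a single sum; Cauchy-Schwarz then
    leaves the squared length of x, which is 1, times the sum of the diagonal entries.\<close>
  also have "\<dots> = (dotp I (\<lambda>i. \<bar>x i\<bar>) (\<lambda>i. sqrt (B i i)))\<^sup>2"
    by (simp add: dotp_def power2_eq_square sum_product)
  also have "\<dots> \<le> dotp I (\<lambda>i. \<bar>x i\<bar>) (\<lambda>i. \<bar>x i\<bar>) * dotp I (\<lambda>i. sqrt (B i i)) (\<lambda>i. sqrt (B i i))"
    by (rule dotp_cauchy_schwarz)
  also have "\<dots> = trpow I A k"
  proof -
    have "dotp I (\<lambda>i. \<bar>x i\<bar>) (\<lambda>i. \<bar>x i\<bar>) = dotp I x x" by (simp add: dotp_def)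
    moreover have "dotp I (\<lambda>i. sqrt (B i i)) (\<lambda>i. sqrt (B i i)) = trpow I A k"
      using diag by (simp add: dotp_def trpow_def B_def)
    ultimately show ?thesis using assms(3) by simp
  qed
  finally show ?thesis .
qed

section \<open>Perturbation by multiples of K Id - x x^T\<close>

lemma reflector_mult:
  "finite I \<Longrightarrow> i \<in> I \<Longrightarrow> mvmult I (reflector K x) v i = K * v i - x i * dotp I x v"
  by (simp add: mvmult_def reflector_def dotp_def left_diff_distrib sum_subtractf
      sum_distrib_left mult.assoc of_bool_def if_distrib[of "\<lambda>a. _ * a"] if_distrib[of "\<lambda>a. a * _"] sum.delta' cong: if_cong)

lemma mvmult_add_matrix:
  "mvmult I (\<lambda>i j. A i j + t * B i j) v = (\<lambda>i. mvmult I A v i + t * mvmult I B v i)"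
  by (simp add: mvmult_def algebra_simps sum.distrib sum_distrib_left)

lemma sym_psd_reflector:
  assumes "finite I" and "dotp I x x \<le> K"
  shows "sym_psd I (reflector K x)"
  unfolding sym_psd_def
proof (intro conjI allI ballI)
  fix v
  have "dotp I v (mvmult I (reflector K x) v) = dotp I v (\<lambda>i. K * v i - x i * dotp I x v)"
    by (intro dotp_cong) (simp_all add: reflector_mult assms)
  also have "\<dots> = K * dotp I v v - (dotp I x v)\<^sup>2"
    by (simp add: dotp_def algebra_simps sum_subtractf sum_distrib_left power2_eq_square sum_product)
  also have "\<dots> \<ge> K * dotp I v v - dotp I x x * dotp I v v"
    using dotp_cauchy_schwarz[of I x v] by simp
  finally show "0 \<le> dotp I v (mvmult I (reflector K x) v)"
    using mult_right_mono[OF assms(2) dotp_self_nonneg[of I v]] by linarith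
qed (auto simp: reflector_def)

lemma sym_psd_add:
  assumes "sym_psd I A" and "sym_psd I B" and "0 \<le> t"
  shows "sym_psd I (\<lambda>i j. A i j + t * B i j)"
  using assms unfolding sym_psd_def mvmult_add_matrix
  by (auto simp: dotp_commute[of I _ "\<lambda>i. mvmult I A _ i + t * mvmult I B _ i"]
      dotp_add_left dotp_scale_left dotp_commute[of I "mvmult I _ _"])

text \<open>Product rule for factors that do not commute: the derivative is the sum of C^a R
  C^(k-1-a) v over a < k, with R = K Id - x x^T. The multiple of Id gives k equal terms, and x x^T
  splits each of the others into the vector C^a x and a scalar. At k = 0 the truncated k - 1 is
  harmless because of the factor k.\<close>

lemma mvpow_has_derivative:
  fixes A x K v
  defines "C \<equiv> \<lambda>t i j. A i j + t * reflector K x i j"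
  assumes "finite I" and "i \<in> I"
  shows "((\<lambda>t. mvpow I (C t) k v i) has_real_derivative
    real k * (K * mvpow I (C t) (k - 1) v i)
      - (\<Sum>a<k. mvpow I (C t) a x i * dotp I x (mvpow I (C t) (k - 1 - a) v))) (at t)"
  using assms(3)
proof (induction k arbitrary: i)
  case (Suc k)
  let ?E = "\<lambda>j. real k * (K * mvpow I (C t) (k - 1) v j)
      - (\<Sum>a<k. mvpow I (C t) a x j * dotp I x (mvpow I (C t) (k - 1 - a) v))"
  have "((\<lambda>t. mvpow I (C t) (Suc k) v i) has_real_derivative
      (\<Sum>j\<in>I. reflector K x i j * mvpow I (C t) k v j + C t i j * ?E j)) (at t)"
    unfolding mvpow_Suc mvmult_def
  proof (rule DERIV_sum)
    fix j assume "j \<in> I"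
    show "((\<lambda>t. C t i j * mvpow I (C t) k v j) has_real_derivative
       reflector K x i j * mvpow I (C t) k v j + C t i j * ?E j) (at t)"
      by (rule derivative_eq_intros Suc.IH[OF \<open>j \<in> I\<close>] refl | simp add: C_def)+
  qed
  moreover have "(\<Sum>j\<in>I. reflector K x i j * mvpow I (C t) k v j + C t i j * ?E j) =
      real (Suc k) * (K * mvpow I (C t) (Suc k - 1) v i)
      - (\<Sum>a<Suc k. mvpow I (C t) a x i * dotp I x (mvpow I (C t) (Suc k - 1 - a) v))"
  proof -
    have "(\<Sum>j\<in>I. C t i j * ?E j) = real k * (K * (\<Sum>j\<in>I. C t i j * mvpow I (C t) (k - 1) v j))
       - (\<Sum>j\<in>I. \<Sum>a<k. C t i j * mvpow I (C t) a x j * dotp I x (mvpow I (C t) (k - 1 - a) v))"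
      by (simp add: right_diff_distrib sum_subtractf sum_distrib_left mult_ac)
    also have "(\<Sum>j\<in>I. \<Sum>a<k. C t i j * mvpow I (C t) a x j * dotp I x (mvpow I (C t) (k - 1 - a) v))
       = (\<Sum>a<k. (\<Sum>j\<in>I. C t i j * mvpow I (C t) a x j) * dotp I x (mvpow I (C t) (k - 1 - a) v))"
      by (subst sum.swap) (simp add: sum_distrib_right)
    also have "\<dots> = (\<Sum>a<k. mvpow I (C t) (Suc a) x i * dotp I x (mvpow I (C t) (k - Suc a) v))"
      by (simp add: mvpow_Suc mvmult_def)
    also have "real k * (K * (\<Sum>j\<in>I. C t i j * mvpow I (C t) (k - 1) v j)) = real k * (K * mvpow I (C t) k v i)"
      by (cases k) (simp_all add: mvpow_Suc mvmult_def)
    finally have 1: "(\<Sum>j\<in>I. C t i j * ?E j) = real k * (K * mvpow I (C t) k v i)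
      - (\<Sum>a<k. mvpow I (C t) (Suc a) x i * dotp I x (mvpow I (C t) (k - Suc a) v))" .
    have "(\<Sum>j\<in>I. reflector K x i j * mvpow I (C t) k v j) =
        K * mvpow I (C t) k v i - x i * dotp I x (mvpow I (C t) k v)"
      using reflector_mult[OF assms(2) Suc.prems, of K x "mvpow I (C t) k v"] by (simp add: mvmult_def)
    then show ?thesis
      unfolding sum.distrib 1 by (simp add: sum.lessThan_Suc_shift algebra_simps del: sum.lessThan_Suc)
  qed
  ultimately show ?case by simp
qed simp

lemma deriv_mono_nonneg:
  fixes f g f' g' :: "real \<Rightarrow> real"
  assumes "f 0 \<le> g 0" and "0 \<le> t"
    and "\<And>s. 0 \<le> s \<Longrightarrow> (f has_real_derivative f' s) (at s)"
    and "\<And>s. 0 \<le> s \<Longrightarrow> (g has_real_derivative g' s) (at s)"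
    and "\<And>s. 0 \<le> s \<Longrightarrow> f' s \<le> g' s"
  shows "f t \<le> g t"
proof -
  have "g 0 - f 0 \<le> g t - f t"
  proof (rule DERIV_nonneg_imp_nondecreasing[OF assms(2)])
    fix s :: real assume "0 \<le> s"
    then show "\<exists>y. ((\<lambda>s. g s - f s) has_real_derivative y) (at s) \<and> 0 \<le> y"
      using assms(3)[of s] assms(4)[of s] assms(5)[of s]
      by (intro exI[of _ "g' s - f' s"]) (auto intro: derivative_intros)
  qed
  then show ?thesis using assms(1) by simp
qed

text \<open>Powers are not monotone on positive semidefinite matrices, so it matters that the moment
  is taken at the same x that defines the perturbation. Its derivative is then a sum of terms K M
  (k-1) - M a * M (k-1-a) in the moments M of x, and \<open>moment_mult\<close> makes each of them
  nonnegative.\<close>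

lemma moment_mono:
  assumes "finite I" and "sym_psd I A" and "dotp I x x \<le> K" and "0 \<le> t"
  shows "dotp I x (mvpow I A k x) \<le> dotp I x (mvpow I (\<lambda>i j. A i j + t * reflector K x i j) k x)"
proof -
  define C where "C = (\<lambda>t i j. A i j + t * reflector K x i j)"
  define M where "M = (\<lambda>t k. dotp I x (mvpow I (C t) k x))"
  have psd: "sym_psd I (C s)" if "0 \<le> s" for s
    unfolding C_def using that assms by (intro sym_psd_add sym_psd_reflector)
  let ?E = "\<lambda>s. \<Sum>i\<in>I. x i * (real k * (K * mvpow I (C s) (k - 1) x i)
      - (\<Sum>a<k. mvpow I (C s) a x i * dotp I x (mvpow I (C s) (k - 1 - a) x)))"
  have "M 0 k \<le> M t k"
  proof (rule deriv_mono_nonneg[where f = "\<lambda>_. M 0 k" and g = "\<lambda>s. M s k" and f' = "\<lambda>_. 0" and g' = ?E])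
    fix s :: real assume s: "0 \<le> s"
    show "((\<lambda>s. M s k) has_real_derivative ?E s) (at s)"
      unfolding M_def dotp_def C_def
      by (intro DERIV_sum DERIV_cmult mvpow_has_derivative[unfolded dotp_def] assms)
    have "?E s
      = real k * (K * M s (k - 1)) - (\<Sum>i\<in>I. \<Sum>a<k. x i * mvpow I (C s) a x i * M s (k - 1 - a))"
      by (simp add: M_def dotp_def[of I x "mvpow I (C s) (k - Suc 0) x"] right_diff_distrib sum_subtractf sum_distrib_left mult_ac)
    also have "(\<Sum>i\<in>I. \<Sum>a<k. x i * mvpow I (C s) a x i * M s (k - 1 - a)) = (\<Sum>a<k. M s a * M s (k - 1 - a))"
      by (subst sum.swap) (simp add: M_def dotp_def[of I x "mvpow I (C s) _ x"] sum_distrib_right)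
    finally have eq: "?E s = real k * (K * M s (k - 1)) - (\<Sum>a<k. M s a * M s (k - 1 - a))" .
    have "(\<Sum>a<k. M s a * M s (k - 1 - a)) \<le> (\<Sum>a<k. K * M s (k - 1))"
    proof (intro sum_mono)
      fix a assume "a \<in> {..<k}"
      then have "M s a * M s (k - 1 - a) \<le> dotp I x x * M s (k - 1)"
        using moment_mult[OF psd[OF s], of x a "k - 1 - a"] by (simp add: M_def)
      also have "\<dots> \<le> K * M s (k - 1)"
        unfolding M_def by (intro mult_right_mono assms moment_nonneg psd s)
      finally show "M s a * M s (k - 1 - a) \<le> K * M s (k - 1)" .
    qed
    with eq show "0 \<le> ?E s" by simp
  qed (use assms in auto)
  then show ?thesis by (simp add: M_def C_def)
qed

text \<open>Under the trace the position of the rank-one factor does not matter: symmetry turns each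
  of the k terms of \<open>mvpow_has_derivative\<close> into the same moment of x.\<close>

lemma trpow_has_derivative:
  fixes A x K
  defines "C \<equiv> \<lambda>t i j. A i j + t * reflector K x i j"
  assumes "finite I" and "sym_psd I (C t)"
  shows "((\<lambda>t. trpow I (C t) k) has_real_derivative
    real k * (K * trpow I (C t) (k - 1) - dotp I x (mvpow I (C t) (k - 1) x))) (at t)"
proof -
  let ?e = "\<lambda>e i. of_bool (i = e) :: real"
  have "((\<lambda>t. trpow I (C t) k) has_real_derivative
    (\<Sum>e\<in>I. real k * (K * mvpow I (C t) (k - 1) (?e e) e)
      - (\<Sum>a<k. mvpow I (C t) a x e * dotp I x (mvpow I (C t) (k - 1 - a) (?e e))))) (at t)"
    unfolding trpow_def C_def by (intro DERIV_sum mvpow_has_derivative assms)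
  moreover have "(\<Sum>e\<in>I. \<Sum>a<k. mvpow I (C t) a x e * dotp I x (mvpow I (C t) (k - 1 - a) (?e e)))
    = real k * dotp I x (mvpow I (C t) (k - 1) x)"
  proof -
    have "dotp I x (mvpow I (C t) b (?e e)) = mvpow I (C t) b x e" if "e \<in> I" for b e
      using mvpow_symmetric[of I "C t" b x "?e e"] sym_psd_symD[OF assms(3)] dotp_unit[OF assms(2) that]
      by (simp add: dotp_commute)
    then have "(\<Sum>e\<in>I. \<Sum>a<k. mvpow I (C t) a x e * dotp I x (mvpow I (C t) (k - 1 - a) (?e e)))
      = (\<Sum>a<k. dotp I (mvpow I (C t) a x) (mvpow I (C t) (k - 1 - a) x))"
      by (subst sum.swap) (simp add: dotp_def)
    also have "\<dots> = (\<Sum>a<k. dotp I x (mvpow I (C t) (k - 1) x))"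
      by (intro sum.cong refl) (simp add: dotp_mvpow_add[OF assms(3)])
    finally show ?thesis by simp
  qed
  ultimately show ?thesis
    by (simp add: sum_subtractf trpow_def right_diff_distrib sum_distrib_left)
qed

text \<open>The Golden--Thompson inequality for a perturbation by \<open>K Id - x x\<^sup>T\<close>, in the form of an
  inequality between the coefficients of the exponential series. Both sides solve the same
  differential equation in \<open>t\<close>, up to the monotonicity of the moments.\<close>

lemma trpow_perturb_le:
  assumes "finite I" and "sym_psd I A" and "dotp I x x \<le> K" and "0 \<le> t"
  shows "trpow I (\<lambda>i j. A i j + t * reflector K x i j) k \<le>
    trpow I A k + (\<Sum>j\<in>{1..k}. real (k choose j) * t ^ j *
      (K ^ j * trpow I A (k - j) - K ^ (j - 1) * dotp I x (mvpow I A (k - j) x)))"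
  using assms(4)
proof (induction k arbitrary: t)
  case 0
  then show ?case by (simp add: trpow_def)
next
  case (Suc k)
  define C where "C = (\<lambda>t i j. A i j + t * reflector K x i j)"
  define c where "c = (\<lambda>k j. K ^ j * trpow I A (k - j) - K ^ (j - 1) * dotp I x (mvpow I A (k - j) x))"
  have K: "0 \<le> K" using assms(3) dotp_self_nonneg[of I x] by linarith
  have psd: "sym_psd I (C s)" if "0 \<le> s" for s
    unfolding C_def using that assms by (intro sym_psd_add sym_psd_reflector)
  have "trpow I (C t) (Suc k) \<le> trpow I A (Suc k) + (\<Sum>j\<in>{1..Suc k}. real (Suc k choose j) * t ^ j * c (Suc k) j)"
  proof (rule deriv_mono_nonneg[where f = "\<lambda>t. trpow I (C t) (Suc k)"
        and g = "\<lambda>t. trpow I A (Suc k) + (\<Sum>j\<in>{1..Suc k}. real (Suc k choose j) * t ^ j * c (Suc k) j)"])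
    fix s :: real assume s: "0 \<le> s"
    show "((\<lambda>t. trpow I (C t) (Suc k)) has_real_derivative
      real (Suc k) * (K * trpow I (C s) k - dotp I x (mvpow I (C s) k x))) (at s)"
      using trpow_has_derivative[of I A s K x "Suc k"] assms(1) psd[OF s] by (simp add: C_def)
    show "((\<lambda>t. trpow I A (Suc k) + (\<Sum>j\<in>{1..Suc k}. real (Suc k choose j) * t ^ j * c (Suc k) j))
      has_real_derivative (\<Sum>j\<in>{1..Suc k}. real (Suc k choose j) * (real j * s ^ (j - 1)) * c (Suc k) j)) (at s)"
      by (rule derivative_eq_intros refl | simp add: mult_ac)+
    \<comment> \<open>The trace is bounded above by the induction hypothesis. The moment carries a
      minus sign, so its lower bound by the value at s = 0 is what \<open>moment_mono\<close>
      supplies.\<close>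
    have "K * trpow I (C s) k - dotp I x (mvpow I (C s) k x)
      \<le> K * (trpow I A k + (\<Sum>j\<in>{1..k}. real (k choose j) * s ^ j * c k j)) - dotp I x (mvpow I A k x)"
      using mult_left_mono[OF Suc.IH[OF s] K] moment_mono[OF assms(1-3) s, of k]
      unfolding C_def c_def by linarith
    also have "\<dots> = (\<Sum>i\<in>{0..k}. real (k choose i) * s ^ i * c (Suc k) (Suc i))"
    proof -
      have "K * (real (k choose j) * s ^ j * c k j) = real (k choose j) * s ^ j * c (Suc k) (Suc j)"
        if "j \<in> {1..k}" for j
      proof -
        have "K * c k j = c (Suc k) (Suc j)"
          using that unfolding c_def by (cases j) (auto simp: algebra_simps)
        then show ?thesis by (metis mult.assoc mult.left_commute)
      qed
      then have "K * (\<Sum>j\<in>{1..k}. real (k choose j) * s ^ j * c k j) =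
        (\<Sum>j\<in>{1..k}. real (k choose j) * s ^ j * c (Suc k) (Suc j))"
        unfolding sum_distrib_left by (intro sum.cong refl)
      then show ?thesis
        by (simp add: sum.atLeast_Suc_atMost distrib_left) (simp add: c_def)
    qed
    finally have "real (Suc k) * (K * trpow I (C s) k - dotp I x (mvpow I (C s) k x))
      \<le> real (Suc k) * (\<Sum>i\<in>{0..k}. real (k choose i) * s ^ i * c (Suc k) (Suc i))"
      by (rule mult_left_mono) simp
    also have "\<dots> = (\<Sum>i\<in>{0..k}. real (Suc k choose Suc i) * (real (Suc i) * s ^ i) * c (Suc k) (Suc i))"
      unfolding sum_distrib_left
    proof (intro sum.cong refl)
      fix i
      \<comment> \<open>This absorption identity makes the sum the derivative of the polynomial
        claimed for k + 1.\<close>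
      have "real (Suc k) * real (k choose i) = real (Suc k choose Suc i) * real (Suc i)"
        using Suc_times_binomial_eq[of k i] by (metis of_nat_mult)
      then show "real (Suc k) * (real (k choose i) * s ^ i * c (Suc k) (Suc i)) =
        real (Suc k choose Suc i) * (real (Suc i) * s ^ i) * c (Suc k) (Suc i)"
        by (simp add: mult_ac del: binomial_Suc_Suc of_nat_Suc)
    qed
    also have "\<dots> = (\<Sum>j\<in>{1..Suc k}. real (Suc k choose j) * (real j * s ^ (j - 1)) * c (Suc k) j)"
      by (subst sum.atLeast_Suc_atMost_Suc_shift[of _ 0 k, unfolded One_nat_def[symmetric]]) simp
    finally show "real (Suc k) * (K * trpow I (C s) k - dotp I x (mvpow I (C s) k x)) \<le>
       (\<Sum>j\<in>{1..Suc k}. real (Suc k choose j) * (real j * s ^ (j - 1)) * c (Suc k) j)" .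
  next
    have "(\<Sum>j\<in>{1..Suc k}. real (Suc k choose j) * 0 ^ j * c (Suc k) j) = 0"
      by (intro sum.neutral) auto
    then show "trpow I (C 0) (Suc k) \<le>
        trpow I A (Suc k) + (\<Sum>j\<in>{1..Suc k}. real (Suc k choose j) * 0 ^ j * c (Suc k) j)"
      by (simp only: C_def) simp
  qed (rule Suc.prems)
  then show ?case by (simp add: C_def c_def)
qed

section \<open>A matrix Chernoff bound\<close>

lemma mvpow_measurable:
  assumes "\<And>i j. i \<in> I \<Longrightarrow> j \<in> I \<Longrightarrow> (\<lambda>y. A y i j) \<in> borel_measurable M" and "i \<in> I"
  shows "(\<lambda>y. mvpow I (A y) k v i) \<in> borel_measurable M"
  using assms(2)
proof (induction k arbitrary: i)
  case (Suc k)
  show ?case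
    unfolding mvpow_Suc mvmult_def
    by (intro borel_measurable_sum borel_measurable_times Suc.IH assms(1) Suc.prems)
qed simp

lemma trpow_measurable:
  assumes "\<And>i j. i \<in> I \<Longrightarrow> j \<in> I \<Longrightarrow> (\<lambda>y. A y i j) \<in> borel_measurable M"
  shows "(\<lambda>y. trpow I (A y) k) \<in> borel_measurable M"
  unfolding trpow_def by (intro borel_measurable_sum mvpow_measurable assms)

text \<open>It is m (K Id - G) for the empirical Gram matrix G of the sample: G has an eigenvalue
  below 1/2 exactly if this matrix has one above m K - m / 2.\<close>

definition gram_defect :: "real \<Rightarrow> ('i \<Rightarrow> 'y \<Rightarrow> real) \<Rightarrow> nat \<Rightarrow> (nat \<Rightarrow> 'y) \<Rightarrow> 'i \<Rightarrow> 'i \<Rightarrow> real" where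
  "gram_defect K X m ys = (\<lambda>i j. \<Sum>l<m. reflector K (\<lambda>i. X i (ys l)) i j)"

lemma dotp_gram_defect:
  assumes "finite I"
  shows "dotp I v (mvmult I (gram_defect K X m ys) v) =
    m * (K * dotp I v v) - (\<Sum>l<m. (dotp I (\<lambda>i. X i (ys l)) v)\<^sup>2)"
proof -
  have "dotp I v (mvmult I (gram_defect K X m ys) v) =
    (\<Sum>l<m. dotp I v (mvmult I (reflector K (\<lambda>i. X i (ys l))) v))"
  proof -
    have "dotp I v (mvmult I (gram_defect K X m ys) v) =
      (\<Sum>i\<in>I. \<Sum>j\<in>I. \<Sum>l<m. v i * (reflector K (\<lambda>i. X i (ys l)) i j * v j))"
      by (simp add: dotp_def mvmult_def gram_defect_def sum_distrib_left sum_distrib_right)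
    also have "\<dots> = (\<Sum>i\<in>I. \<Sum>l<m. \<Sum>j\<in>I. v i * (reflector K (\<lambda>i. X i (ys l)) i j * v j))"
      by (intro sum.cong refl sum.swap)
    also have "\<dots> = (\<Sum>l<m. \<Sum>i\<in>I. \<Sum>j\<in>I. v i * (reflector K (\<lambda>i. X i (ys l)) i j * v j))"
      by (rule sum.swap)
    finally show ?thesis
      by (simp add: dotp_def mvmult_def sum_distrib_left)
  qed
  also have "\<dots> = (\<Sum>l<m. K * dotp I v v - (dotp I (\<lambda>i. X i (ys l)) v)\<^sup>2)"
  proof (intro sum.cong refl)
    fix l
    have "dotp I v (mvmult I (reflector K (\<lambda>i. X i (ys l))) v) =
      dotp I v (\<lambda>i. K * v i - X i (ys l) * dotp I (\<lambda>i. X i (ys l)) v)"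
      by (intro dotp_cong) (simp_all add: reflector_mult assms)
    also have "\<dots> = K * dotp I v v - (dotp I (\<lambda>i. X i (ys l)) v)\<^sup>2"
      by (simp add: dotp_def algebra_simps sum_subtractf sum_distrib_left power2_eq_square sum_product)
    finally show "dotp I v (mvmult I (reflector K (\<lambda>i. X i (ys l))) v) =
      K * dotp I v v - (dotp I (\<lambda>i. X i (ys l)) v)\<^sup>2" .
  qed
  finally show ?thesis by (simp add: sum_subtractf)
qed

lemma gram_defect_Suc:
  "gram_defect K X (Suc m) ys =
    (\<lambda>i j. gram_defect K X m ys i j + 1 * reflector K (\<lambda>i. X i (ys m)) i j)"
  by (simp add: gram_defect_def)

lemma sym_psd_gram_defect:
  assumes "finite I" and "\<And>l. l < m \<Longrightarrow> dotp I (\<lambda>i. X i (ys l)) (\<lambda>i. X i (ys l)) \<le> K"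
  shows "sym_psd I (gram_defect K X m ys)"
  using assms(2)
proof (induction m)
  case 0
  then show ?case by (simp add: gram_defect_def sym_psd_def mvmult_def dotp_def)
next
  case (Suc m)
  have "sym_psd I (gram_defect K X m ys)"
    by (rule Suc.IH) (simp add: Suc.prems)
  then show ?case
    unfolding gram_defect_Suc
    by (rule sym_psd_add) (simp_all add: sym_psd_reflector assms(1) Suc.prems)
qed

text \<open>The coefficient is \<open>1\<close> for \<open>j = 0\<close> and \<open>K\<^sup>j - K\<^sup>j\<^sup>-\<^sup>1\<close> for \<open>j \<ge> 1\<close>, an upper bound of the expectation
  of \<open>(K Id - x x\<^sup>T)\<^sup>j\<close> when \<open>x x\<^sup>T\<close> has expectation \<open>Id\<close>.\<close>

definition chernoff_coeff :: "real \<Rightarrow> nat \<Rightarrow> real" where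
  "chernoff_coeff K j = K ^ j * (1 - 1 / K) + of_bool (j = 0) / K"

text \<open>The k-th moment of a sum of m independent scalar variables that equal K with probability
  1 - 1/K and 0 with probability 1/K; the coefficients \<open>chernoff_coeff K j\<close> are the
  moments of one such variable.\<close>

fun chernoff_moment :: "real \<Rightarrow> nat \<Rightarrow> nat \<Rightarrow> real" where
  "chernoff_moment K 0 k = of_bool (k = 0)"
| "chernoff_moment K (Suc m) k =
    (\<Sum>j\<le>k. real (k choose j) * chernoff_coeff K j * chernoff_moment K m (k - j))"

lemma chernoff_coeff_nonneg: "1 \<le> K \<Longrightarrow> 0 \<le> chernoff_coeff K j"
  by (simp add: chernoff_coeff_def)

lemma chernoff_moment_nonneg: "1 \<le> K \<Longrightarrow> 0 \<le> chernoff_moment K m k"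
  by (induction m arbitrary: k) (auto intro!: sum_nonneg mult_nonneg_nonneg chernoff_coeff_nonneg)

lemma chernoff_coeff_sums:
  "(\<lambda>j. t ^ j / fact j * chernoff_coeff K j) sums (exp (t * K) * (1 - 1 / K) + 1 / K)"
proof -
  have "(\<lambda>j. (t * K) ^ j / fact j) sums exp (t * K)"
    using exp_converges[of "t * K"] by (simp add: field_simps)
  then have "(\<lambda>j. (t * K) ^ j / fact j * (1 - 1 / K)) sums (exp (t * K) * (1 - 1 / K))"
    by (rule sums_mult2)
  moreover have "(\<lambda>j::nat. if j = 0 then 1 / K else 0) sums (1 / K)"
    using sums_single[of 0 "\<lambda>_. 1 / K"] by simp
  ultimately have "(\<lambda>j. (t * K) ^ j / fact j * (1 - 1 / K) + (if j = 0 then 1 / K else 0))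
    sums (exp (t * K) * (1 - 1 / K) + 1 / K)"
    by (rule sums_add)
  moreover have "(t * K) ^ j / fact j * (1 - 1 / K) + (if j = 0 then 1 / K else 0)
    = t ^ j / fact j * chernoff_coeff K j" for j
    by (cases "j = 0") (simp_all add: chernoff_coeff_def power_mult_distrib)
  ultimately show ?thesis by simp
qed

text \<open>The binomial convolution in the recursion is the Cauchy product of exponential
  generating functions, so each step multiplies by the series of
  \<open>chernoff_coeff_sums\<close>.\<close>

lemma chernoff_moment_sums:
  assumes "1 \<le> K" and "0 \<le> t"
  shows "(\<lambda>k. t ^ k / fact k * chernoff_moment K m k) sums (exp (t * K) * (1 - 1 / K) + 1 / K) ^ m"
proof (induction m)
  case 0
  have "(\<lambda>k. t ^ k / fact k * chernoff_moment K 0 k) = (\<lambda>k. if k = 0 then 1 else 0)"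
    by auto
  then show ?case
    using sums_single[of 0 "\<lambda>_. 1 :: real"] by (simp only: power_0)
next
  case (Suc m)
  define a where "a = (\<lambda>j. t ^ j / fact j * chernoff_coeff K j)"
  define b where "b = (\<lambda>k. t ^ k / fact k * chernoff_moment K m k)"
  have a: "0 \<le> a j" and b: "0 \<le> b j" for j
    using assms by (simp_all add: a_def b_def chernoff_coeff_nonneg chernoff_moment_nonneg)
  have "(\<lambda>k. \<Sum>i\<le>k. a i * b (k - i)) sums ((\<Sum>k. a k) * (\<Sum>k. b k))"
  proof (rule Cauchy_product_sums)
    have "summable a" "summable b"
      using chernoff_coeff_sums[of t K] Suc by (simp_all add: sums_iff a_def b_def)
    then show "summable (\<lambda>k. norm (a k))" "summable (\<lambda>k. norm (b k))"
      using a b by simp_all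
  qed
  also have "(\<Sum>k. a k) * (\<Sum>k. b k) = (exp (t * K) * (1 - 1 / K) + 1 / K) ^ Suc m"
    using chernoff_coeff_sums[of t K] Suc by (simp add: sums_iff a_def b_def)
  also have "(\<lambda>k. \<Sum>i\<le>k. a i * b (k - i)) = (\<lambda>k. t ^ k / fact k * chernoff_moment K (Suc m) k)"
  proof
    fix k
    have "a i * b (k - i) =
      t ^ k / fact k * (real (k choose i) * chernoff_coeff K i * chernoff_moment K m (k - i))"
      if "i \<le> k" for i
    proof -
      have "t ^ i * t ^ (k - i) = t ^ k" using that by (simp flip: power_add)
      moreover have "1 / (fact i * fact (k - i)) = real (k choose i) / fact k"
        using binomial_fact[OF that, where ?'a = real] by simp
      moreover have "a i * b (k - i) = (t ^ i * t ^ (k - i)) * (1 / (fact i * fact (k - i))) *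
          (chernoff_coeff K i * chernoff_moment K m (k - i))"
        by (simp add: a_def b_def)
      ultimately show ?thesis
        by (simp add: mult_ac)
    qed
    then show "(\<Sum>i\<le>k. a i * b (k - i)) = t ^ k / fact k * chernoff_moment K (Suc m) k"
      by (simp add: sum_distrib_left)
  qed
  finally show ?case .
qed

text \<open>The random vector x = (X i y) has second moment matrix Id, and K bounds its squared
  length on the whole space.\<close>

locale isotropic = prob_space \<rho> for \<rho> :: "'y measure" +
  fixes I :: "'i set" and X :: "'i \<Rightarrow> 'y \<Rightarrow> real" and K :: real
  assumes finite_I: "finite I" and I_ne: "I \<noteq> {}"
    and X_measurable [measurable]: "\<And>i. i \<in> I \<Longrightarrow> X i \<in> borel_measurable \<rho>"
    and X_bound: "\<And>y. y \<in> space \<rho> \<Longrightarrow> (\<Sum>i\<in>I. (X i y)\<^sup>2) \<le> K"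
    and X_orthonormal: "\<And>i j. i \<in> I \<Longrightarrow> j \<in> I \<Longrightarrow> (\<integral>y. X i y * X j y \<partial>\<rho>) = of_bool (i = j)"
begin

lemma dotp_X: "y \<in> space \<rho> \<Longrightarrow> dotp I (\<lambda>i. X i y) (\<lambda>i. X i y) \<le> K"
  using X_bound by (simp add: dotp_def power2_eq_square)

lemma X_mult_integrable:
  assumes "i \<in> I" "j \<in> I"
  shows "integrable \<rho> (\<lambda>y. X i y * X j y)"
proof (rule integrable_const_bound)
  have 1: "(X i y)\<^sup>2 \<le> K" if "i \<in> I" "y \<in> space \<rho>" for i y
    using member_le_sum[of i I "\<lambda>i. (X i y)\<^sup>2"] X_bound[OF that(2)] finite_I that(1) by fastforce
  show "AE y in \<rho>. norm (X i y * X j y) \<le> K"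
  proof (rule AE_I2)
    fix y assume "y \<in> space \<rho>"
    then have "(X i y)\<^sup>2 \<le> K" "(X j y)\<^sup>2 \<le> K" using 1 assms by auto
    moreover have "2 * \<bar>X i y * X j y\<bar> \<le> (X i y)\<^sup>2 + (X j y)\<^sup>2"
      using sum_squares_bound[of "\<bar>X i y\<bar>" "\<bar>X j y\<bar>"] by (simp add: abs_mult)
    ultimately show "norm (X i y * X j y) \<le> K" by simp
  qed
qed (use assms in measurable)

text \<open>The expectation of the squared length of x is the dimension, which is at least 1 and at
  most K.\<close>

lemma one_le_K: "1 \<le> K"
proof -
  have "real (card I) = (\<Sum>i\<in>I. \<integral>y. X i y * X i y \<partial>\<rho>)"
    using X_orthonormal by simp
  also have "\<dots> = (\<integral>y. (\<Sum>i\<in>I. X i y * X i y) \<partial>\<rho>)"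
    by (simp add: X_mult_integrable)
  also have "\<dots> \<le> K"
    using X_bound by (intro integral_le_const) (auto simp: X_mult_integrable power2_eq_square)
  finally have "real (card I) \<le> K" .
  moreover have "1 \<le> card I"
    using finite_I I_ne by (simp add: Suc_leI card_gt_0_iff)
  ultimately show ?thesis by linarith
qed

lemma moment_integral:
  assumes "sym_psd I A"
  shows "integrable \<rho> (\<lambda>y. dotp I (\<lambda>i. X i y) (mvpow I A k (\<lambda>i. X i y)))"
    and "(\<integral>y. dotp I (\<lambda>i. X i y) (mvpow I A k (\<lambda>i. X i y)) \<partial>\<rho>) = trpow I A k"
proof -
  let ?W = "\<lambda>i e. mvpow I A k (\<lambda>i. of_bool (i = e)) i"
  have *: "dotp I (\<lambda>i. X i y) (mvpow I A k (\<lambda>i. X i y)) = (\<Sum>i\<in>I. \<Sum>e\<in>I. (X i y * X e y) * ?W i e)" for y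
    unfolding dotp_def by (simp add: mvpow_expand[OF finite_I assms, of _ k "\<lambda>i. X i y"] sum_distrib_left mult_ac)
  show "integrable \<rho> (\<lambda>y. dotp I (\<lambda>i. X i y) (mvpow I A k (\<lambda>i. X i y)))"
    unfolding * by (intro Bochner_Integration.integrable_sum integrable_mult_left X_mult_integrable)
  have "(\<integral>y. dotp I (\<lambda>i. X i y) (mvpow I A k (\<lambda>i. X i y)) \<partial>\<rho>) =
    (\<Sum>i\<in>I. \<Sum>e\<in>I. (\<integral>y. X i y * X e y \<partial>\<rho>) * ?W i e)"
    unfolding * by (simp add: Bochner_Integration.integral_sum X_mult_integrable)
  also have "\<dots> = (\<Sum>i\<in>I. \<Sum>e\<in>I. if i = e then ?W i e else 0)"
    by (intro sum.cong refl) (simp add: X_orthonormal)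
  also have "\<dots> = trpow I A k"
    using finite_I by (simp add: trpow_def)
  finally show "(\<integral>y. dotp I (\<lambda>i. X i y) (mvpow I A k (\<lambda>i. X i y)) \<partial>\<rho>) = trpow I A k" .
qed

text \<open>The bound of \<open>trpow_perturb_le\<close> is affine in the moments of x, so its
  expectation is computed exactly: each moment becomes a trace and the coefficients become K^j -
  K^(j-1).\<close>

lemma nn_integral_trpow_perturb:
  assumes "sym_psd I A"
  shows "(\<integral>\<^sup>+y. ennreal (trpow I (\<lambda>i j. A i j + 1 * reflector K (\<lambda>i. X i y) i j) k) \<partial>\<rho>)
    \<le> ennreal (\<Sum>j\<le>k. real (k choose j) * chernoff_coeff K j * trpow I A (k - j))"
proof -
  define R where "R = (\<lambda>y. trpow I A k + (\<Sum>j\<in>{1..k}. real (k choose j) * 1 ^ j *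
      (K ^ j * trpow I A (k - j) - K ^ (j - 1) * dotp I (\<lambda>i. X i y) (mvpow I A (k - j) (\<lambda>i. X i y)))))"
  have le: "trpow I (\<lambda>i j. A i j + 1 * reflector K (\<lambda>i. X i y) i j) k \<le> R y" if "y \<in> space \<rho>" for y
    unfolding R_def by (rule trpow_perturb_le[OF finite_I assms dotp_X[OF that]]) simp
  have nn: "0 \<le> R y" if "y \<in> space \<rho>" for y
  proof -
    have "0 \<le> trpow I (\<lambda>i j. A i j + 1 * reflector K (\<lambda>i. X i y) i j) k"
      by (intro trpow_nonneg sym_psd_add sym_psd_reflector finite_I assms dotp_X that) simp
    then show ?thesis using le[OF that] by linarith
  qed
  have int: "integrable \<rho> R"
    unfolding R_def
    by (intro Bochner_Integration.integrable_add Bochner_Integration.integrable_sum integrable_mult_right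
        Bochner_Integration.integrable_diff moment_integral assms integrable_const)
  have "(\<integral>y. R y \<partial>\<rho>) = trpow I A k + (\<Sum>j\<in>{1..k}. real (k choose j) *
      (K ^ j * trpow I A (k - j) - K ^ (j - 1) * trpow I A (k - j)))"
    unfolding R_def by (simp add: moment_integral[OF assms] Bochner_Integration.integral_sum prob_space)
  also have "\<dots> = trpow I A k + (\<Sum>j\<in>{1..k}. real (k choose j) * chernoff_coeff K j * trpow I A (k - j))"
  proof -
    have "K ^ j - K ^ (j - 1) = chernoff_coeff K j" if "j \<in> {1..k}" for j
      using that one_le_K by (cases j) (auto simp: chernoff_coeff_def field_simps)
    then show ?thesis
      by (simp add: left_diff_distrib[symmetric] mult.assoc)
  qed
  also have "\<dots> = (\<Sum>j\<le>k. real (k choose j) * chernoff_coeff K j * trpow I A (k - j))"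
    using one_le_K by (simp add: atMost_atLeast0 sum.atLeast_Suc_atMost chernoff_coeff_def)
  finally have eq: "(\<integral>y. R y \<partial>\<rho>) = (\<Sum>j\<le>k. real (k choose j) * chernoff_coeff K j * trpow I A (k - j))" .
  have "(\<integral>\<^sup>+y. ennreal (trpow I (\<lambda>i j. A i j + 1 * reflector K (\<lambda>i. X i y) i j) k) \<partial>\<rho>)
    \<le> (\<integral>\<^sup>+y. ennreal (R y) \<partial>\<rho>)"
    by (intro nn_integral_mono ennreal_leI le)
  also have "\<dots> = ennreal (\<integral>y. R y \<partial>\<rho>)"
    by (intro nn_integral_eq_integral int AE_I2 nn)
  finally show ?thesis unfolding eq .
qed

lemma gram_defect_measurable:
  assumes "i \<in> I" "j \<in> I"
  shows "(\<lambda>ys. gram_defect K X m ys i j) \<in> borel_measurable (PiM {..<m} (\<lambda>_. \<rho>))"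
  unfolding gram_defect_def reflector_def
  using assms by measurable

lemma space_PiM_D: "ys \<in> space (PiM {..<m} (\<lambda>_. \<rho>)) \<Longrightarrow> l < m \<Longrightarrow> ys l \<in> space \<rho>"
  by (auto simp: space_PiM)

lemma sym_psd_gram_defect_PiM:
  "ys \<in> space (PiM {..<m} (\<lambda>_. \<rho>)) \<Longrightarrow> sym_psd I (gram_defect K X m ys)"
  by (intro sym_psd_gram_defect finite_I dotp_X space_PiM_D)

text \<open>Fubini: the last sample is integrated first, with the others fixed. The induction runs
  over all k at once, since one step refers to the traces of all lower powers.\<close>

lemma nn_integral_trpow_gram_defect:
  "(\<integral>\<^sup>+ys. ennreal (trpow I (gram_defect K X m ys) k) \<partial>PiM {..<m} (\<lambda>_. \<rho>))
    \<le> ennreal (real (card I) * chernoff_moment K m k)"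
proof (induction m arbitrary: k)
  case 0
  have "mvpow I (\<lambda>_ _. 0) k v i = of_bool (k = 0) * v i" for v i
    by (cases k) (simp_all add: mvpow_Suc mvmult_def)
  then have "trpow I (gram_defect K X 0 ys) k = real (card I) * of_bool (k = 0)" for ys
    by (simp add: gram_defect_def trpow_def)
  moreover have "emeasure (PiM ({} :: nat set) (\<lambda>_. \<rho>)) (space (PiM {} (\<lambda>_. \<rho>))) = 1"
    by (intro prob_space.emeasure_space_1 prob_space_PiM prob_space_axioms)
  ultimately show ?case by simp
next
  case (Suc m)
  interpret P: product_sigma_finite "\<lambda>_::nat. \<rho>"
    by standard
  let ?P = "PiM {..<m} (\<lambda>_. \<rho>)"
  let ?f = "\<lambda>ys. ennreal (trpow I (gram_defect K X (Suc m) ys) k)"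
  have meas: "?f \<in> borel_measurable (PiM (insert m {..<m}) (\<lambda>_. \<rho>))"
    unfolding lessThan_Suc[symmetric]
    by (intro measurable_compose[OF trpow_measurable measurable_ennreal] gram_defect_measurable)
  have "(\<integral>\<^sup>+ys. ?f ys \<partial>PiM {..<Suc m} (\<lambda>_. \<rho>)) = (\<integral>\<^sup>+ys. \<integral>\<^sup>+y. ?f (ys(m := y)) \<partial>\<rho> \<partial>?P)"
    unfolding lessThan_Suc by (rule P.product_nn_integral_insert[OF _ _ meas]) auto
  also have "\<dots> \<le> (\<integral>\<^sup>+ys. ennreal (\<Sum>j\<le>k. real (k choose j) * chernoff_coeff K j *
      trpow I (gram_defect K X m ys) (k - j)) \<partial>?P)"
  proof (rule nn_integral_mono)
    fix ys assume ys: "ys \<in> space ?P"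
    have "gram_defect K X (Suc m) (ys(m := y)) =
      (\<lambda>i j. gram_defect K X m ys i j + 1 * reflector K (\<lambda>i. X i y) i j)" for y
      by (simp add: gram_defect_def)
    then show "(\<integral>\<^sup>+y. ?f (ys(m := y)) \<partial>\<rho>) \<le> ennreal (\<Sum>j\<le>k. real (k choose j) * chernoff_coeff K j *
      trpow I (gram_defect K X m ys) (k - j))"
      using nn_integral_trpow_perturb[OF sym_psd_gram_defect_PiM[OF ys]] by simp
  qed
  also have "\<dots> = (\<integral>\<^sup>+ys. (\<Sum>j\<le>k. ennreal (real (k choose j) * chernoff_coeff K j) *
      ennreal (trpow I (gram_defect K X m ys) (k - j))) \<partial>?P)"
  proof (intro nn_integral_cong)
    fix ys assume "ys \<in> space ?P"
    then have *: "0 \<le> trpow I (gram_defect K X m ys) k" for k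
      by (intro trpow_nonneg finite_I sym_psd_gram_defect_PiM)
    show "ennreal (\<Sum>j\<le>k. real (k choose j) * chernoff_coeff K j * trpow I (gram_defect K X m ys) (k - j))
      = (\<Sum>j\<le>k. ennreal (real (k choose j) * chernoff_coeff K j) *
          ennreal (trpow I (gram_defect K X m ys) (k - j)))"
      by (subst sum_ennreal[symmetric])
         (simp_all add: * chernoff_coeff_nonneg one_le_K ennreal_mult)
  qed
  also have "\<dots> = (\<Sum>j\<le>k. ennreal (real (k choose j) * chernoff_coeff K j) *
      (\<integral>\<^sup>+ys. ennreal (trpow I (gram_defect K X m ys) (k - j)) \<partial>?P))"
  proof -
    have [measurable]: "(\<lambda>ys. ennreal (trpow I (gram_defect K X m ys) k)) \<in> borel_measurable ?P" for k
      by (intro measurable_compose[OF trpow_measurable measurable_ennreal] gram_defect_measurable)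
    show ?thesis
      by (subst nn_integral_sum) (measurable, simp add: nn_integral_cmult)
  qed
  also have "\<dots> \<le> (\<Sum>j\<le>k. ennreal (real (k choose j) * chernoff_coeff K j) *
      ennreal (real (card I) * chernoff_moment K m (k - j)))"
    by (intro sum_mono mult_left_mono Suc.IH) simp
  also have "\<dots> = ennreal (real (card I) * chernoff_moment K (Suc m) k)"
  proof -
    have "real (card I) * chernoff_moment K (Suc m) k = (\<Sum>j\<le>k. (real (k choose j) * chernoff_coeff K j) *
      (real (card I) * chernoff_moment K m (k - j)))"
      by (simp add: sum_distrib_left mult_ac)
    then show ?thesis
      by (simp only:) (subst sum_ennreal[symmetric],
        simp_all add: ennreal_mult' chernoff_coeff_nonneg chernoff_moment_nonneg one_le_K)
  qed
  finally show ?case .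
qed

text \<open>Markov's inequality for the trace of exp (t A), where A is the
  \<open>gram_defect\<close>. If the claim fails for some coefficients, the normalized vector gives
  the form of A a value of at least s; then tr A^k \<ge> s^k for every k, and the trace of the
  exponential is at least exp (t s).\<close>

theorem gram_lower_tail:
  assumes m: "0 < m"
  obtains B where "B \<in> sets (PiM {..<m} (\<lambda>_. \<rho>))"
    and "measure (PiM {..<m} (\<lambda>_. \<rho>)) B \<le> real (card I) * exp (- ((1 - ln 2) / 2 * real m / K))"
    and "\<And>ys a. ys \<in> space (PiM {..<m} (\<lambda>_. \<rho>)) - B \<Longrightarrow>
      (\<Sum>i\<in>I. (a i)\<^sup>2) / 2 \<le> (\<Sum>l<m. (\<Sum>i\<in>I. a i * X i (ys l))\<^sup>2) / real m"
proof -
  let ?P = "PiM {..<m} (\<lambda>_. \<rho>)"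
  interpret P: prob_space ?P
    by (intro prob_space_PiM prob_space_axioms)
  \<comment> \<open>Since ln (1 + z) \<le> z, the exponent per sample is at most t / 2 - (1 - exp (-
    t K)) / K; this t minimizes it, and the minimum is - (1 - ln 2) / (2 K).\<close>
  define t where "t = ln 2 / K"
  let ?g = "exp (t * K) * (1 - 1 / K) + 1 / K"
  have t: "0 \<le> t" using one_le_K by (simp add: t_def)
  define s where "s = real m * K - real m / 2"
  have s: "0 \<le> s"
    using one_le_K mult_left_mono[of "1/2" K "real m"] by (simp add: s_def)
  define \<Phi> where "\<Phi> ys = (\<Sum>k. ennreal (t ^ k / fact k) * ennreal (trpow I (gram_defect K X m ys) k))" for ys
  have tr_meas [measurable]: "(\<lambda>ys. ennreal (trpow I (gram_defect K X m ys) k)) \<in> borel_measurable ?P" for k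
    by (intro measurable_compose[OF trpow_measurable measurable_ennreal] gram_defect_measurable)
  have \<Phi>_meas [measurable]: "\<Phi> \<in> borel_measurable ?P"
    unfolding \<Phi>_def by measurable
  \<comment> \<open>A set defined through \<Phi> is measurable at once, unlike a condition that
    quantifies over all coefficient vectors.\<close>
  define B where "B = {ys \<in> space ?P. 1 \<le> ennreal (exp (- (t * s))) * \<Phi> ys}"
  have "(\<integral>\<^sup>+ys. \<Phi> ys \<partial>?P) =
    (\<Sum>k. ennreal (t ^ k / fact k) * (\<integral>\<^sup>+ys. ennreal (trpow I (gram_defect K X m ys) k) \<partial>?P))"
    unfolding \<Phi>_def
    by (subst nn_integral_suminf) (measurable, intro suminf_cong nn_integral_cmult tr_meas)
  also have "\<dots> \<le> (\<Sum>k. ennreal (t ^ k / fact k) * ennreal (real (card I) * chernoff_moment K m k))"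
    by (intro suminf_le mult_left_mono nn_integral_trpow_gram_defect) auto
  also have "\<dots> = (\<Sum>k. ennreal (real (card I) * (t ^ k / fact k * chernoff_moment K m k)))"
    using t by (intro suminf_cong) (simp add: ennreal_mult[symmetric] chernoff_moment_nonneg one_le_K mult_ac)
  also have "\<dots> = ennreal (real (card I) * ?g ^ m)"
  proof (intro suminf_ennreal_eq)
    show "(\<lambda>k. real (card I) * (t ^ k / fact k * chernoff_moment K m k)) sums
       (real (card I) * ?g ^ m)"
      by (intro sums_mult chernoff_moment_sums one_le_K t)
  qed (use t one_le_K in \<open>simp add: chernoff_moment_nonneg\<close>)
  finally have \<Phi>_int: "(\<integral>\<^sup>+ys. \<Phi> ys \<partial>?P) \<le> ennreal (real (card I) * ?g ^ m)" .
  have "emeasure ?P B \<le> ennreal (exp (- (t * s))) * (\<integral>\<^sup>+ys. \<Phi> ys * indicator (space ?P) ys \<partial>?P)"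
    unfolding B_def by (rule nn_integral_Markov_inequality) measurable
  also have "\<dots> = ennreal (exp (- (t * s))) * (\<integral>\<^sup>+ys. \<Phi> ys \<partial>?P)"
    by (intro arg_cong[of _ _ "\<lambda>x. _ * x"] nn_integral_cong) simp
  also have "\<dots> \<le> ennreal (exp (- (t * s))) * ennreal (real (card I) * ?g ^ m)"
    by (intro mult_left_mono \<Phi>_int) simp
  also have "\<dots> = ennreal (exp (- (t * s)) * (real (card I) * ?g ^ m))"
    by (simp add: ennreal_mult')
  finally have "measure ?P B \<le> exp (- (t * s)) * (real (card I) * ?g ^ m)"
    using one_le_K by (simp add: P.emeasure_eq_measure)
  also have "\<dots> \<le> exp (- (t * s)) * (real (card I) * (2 * exp (- (1 / (2 * K)))) ^ m)"
  proof -
    have "exp (t * K) * (1 - 1 / K) + 1 / K = 2 * (1 + - (1 / (2 * K)))"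
      using one_le_K by (simp add: t_def field_simps)
    also have "\<dots> \<le> 2 * exp (- (1 / (2 * K)))"
      using exp_ge_add_one_self[of "- (1 / (2 * K))"] by simp
    finally show ?thesis
      using one_le_K by (intro mult_left_mono power_mono) auto
  qed
  also have "\<dots> = real (card I) * exp (- ((1 - ln 2) / 2 * real m / K))"
  proof -
    have "(2 * exp (- (1 / (2 * K)))) ^ m = exp (ln 2 - 1 / (2 * K)) ^ m"
      using exp_add[of "ln 2" "- (1 / (2 * K))"] by simp
    also have "\<dots> = exp (real m * (ln 2 - 1 / (2 * K)))"
      by (rule exp_of_nat_mult[symmetric])
    finally have "exp (- (t * s)) * (2 * exp (- (1 / (2 * K)))) ^ m =
      exp (- (t * s) + real m * (ln 2 - 1 / (2 * K)))"
      by (simp only: exp_add)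
    also have "- (t * s) + real m * (ln 2 - 1 / (2 * K)) = - ((1 - ln 2) / 2 * real m / K)"
      using one_le_K by (simp add: t_def s_def field_simps)
    finally show ?thesis by (simp add: mult_ac)
  qed
  finally have B_le: "measure ?P B \<le> real (card I) * exp (- ((1 - ln 2) / 2 * real m / K))" .
  have good: "(\<Sum>i\<in>I. (a i)\<^sup>2) / 2 \<le> (\<Sum>l<m. (\<Sum>i\<in>I. a i * X i (ys l))\<^sup>2) / real m"
    if ys: "ys \<in> space ?P - B" for ys a
  proof (rule ccontr)
    assume "\<not> ?thesis"
    then have less: "(\<Sum>l<m. (\<Sum>i\<in>I. a i * X i (ys l))\<^sup>2) / real m < (\<Sum>i\<in>I. (a i)\<^sup>2) / 2"
      by simp
    define S where "S = (\<Sum>i\<in>I. (a i)\<^sup>2)"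
    have "0 \<le> (\<Sum>l<m. (\<Sum>i\<in>I. a i * X i (ys l))\<^sup>2) / real m"
      by (simp add: sum_nonneg)
    also note less
    finally have S: "0 < S" by (simp add: S_def)
    define v where "v = (\<lambda>i. a i / sqrt S)"
    have v: "dotp I v v = 1"
    proof -
      have "dotp I v v = (\<Sum>i\<in>I. (a i)\<^sup>2 / S)"
        unfolding dotp_def v_def using S by (intro sum.cong) (auto simp: power2_eq_square)
      then show ?thesis using S by (simp add: S_def flip: sum_divide_distrib)
    qed
    have "(dotp I (\<lambda>i. X i y) v)\<^sup>2 = (\<Sum>i\<in>I. a i * X i y)\<^sup>2 / S" for y
      using S by (simp add: dotp_def v_def power_divide mult.commute flip: sum_divide_distrib)
    then have "(\<Sum>l<m. (dotp I (\<lambda>i. X i (ys l)) v)\<^sup>2) = (\<Sum>l<m. (\<Sum>i\<in>I. a i * X i (ys l))\<^sup>2) / S"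
      by (simp add: sum_divide_distrib)
    also have "\<dots> < real m / 2"
      using less S m by (simp add: S_def field_simps)
    finally have "s \<le> dotp I v (mvmult I (gram_defect K X m ys) v)"
      using dotp_gram_defect[OF finite_I, of v K X m ys] v by (simp add: s_def)
    then have "s ^ k \<le> trpow I (gram_defect K X m ys) k" for k
      using power_mono[OF _ s, of "dotp I v (mvmult I (gram_defect K X m ys) v)" k]
        moment_power[OF sym_psd_gram_defect_PiM v, of ys m k]
        moment_le_trpow[OF finite_I sym_psd_gram_defect_PiM v, of ys m k] ys by auto
    then have "(\<Sum>k. ennreal (t ^ k / fact k) * ennreal (s ^ k)) \<le> \<Phi> ys"
      unfolding \<Phi>_def by (intro suminf_le mult_left_mono ennreal_leI) auto
    moreover have "(\<Sum>k. ennreal (t ^ k / fact k) * ennreal (s ^ k)) = ennreal (exp (t * s))"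
    proof -
      have "(\<Sum>k. ennreal (t ^ k / fact k) * ennreal (s ^ k)) = (\<Sum>k. ennreal ((t * s) ^ k / fact k))"
        using s t by (intro suminf_cong) (simp add: ennreal_mult[symmetric] power_mult_distrib)
      also have "\<dots> = ennreal (exp (t * s))"
        using exp_converges[of "t * s"] s t by (intro suminf_ennreal_eq) (simp_all add: field_simps)
      finally show ?thesis .
    qed
    ultimately have "ennreal (exp (- (t * s))) * ennreal (exp (t * s)) \<le> ennreal (exp (- (t * s))) * \<Phi> ys"
      by (intro mult_left_mono) auto
    then have "1 \<le> ennreal (exp (- (t * s))) * \<Phi> ys"
      by (simp add: ennreal_mult'[symmetric] exp_minus)
    then show False using ys by (simp add: B_def)
  qed
  have "B \<in> sets ?P" unfolding B_def by measurable
  from that[OF this B_le good] show ?thesis .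
qed

end

section \<open>One-dimensional Christoffel functions\<close>

lemma poly_eq_0_of_interval:
  fixes p :: "real poly"
  assumes "a < b" and "\<And>x. x \<in> {a..b} \<Longrightarrow> poly p x = 0"
  shows "p = 0"
proof (rule ccontr)
  assume "p \<noteq> 0"
  then have "finite {a..b}"
    using assms(2) by (intro finite_subset[OF _ poly_roots_finite[of p]]) auto
  then show False using infinite_Icc[OF assms(1)] by simp
qed

text \<open>One theory of orthonormal polynomials serves two functionals: the Lebesgue integral over
  an interval, from which the Legendre polynomials arise, and the integral against a probability
  measure on [-1, 1].\<close>

locale positive_functional =
  fixes \<I> :: "real poly \<Rightarrow> real"
  assumes add: "\<I> (p + q) = \<I> p + \<I> q"
    and scale: "\<I> (smult c p) = c * \<I> p"
    and pos: "p \<noteq> 0 \<Longrightarrow> 0 < \<I> (p * p)"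
begin

lemma zero [simp]: "\<I> 0 = 0"
  using scale[of 0 0] by simp

lemma diff: "\<I> (p - q) = \<I> p - \<I> q"
  using add[of "p - q" q] by simp

lemma sum: "\<I> (\<Sum>k\<in>A. f k) = (\<Sum>k\<in>A. \<I> (f k))"
  by (induction A rule: infinite_finite_induct) (simp_all add: add)

context notes [fundef_cong] = sum.cong begin
text \<open>Gram-Schmidt applied to the monomials. The congruence rule for sums lets the termination
  argument see that \<open>k < n\<close>.\<close>

fun ortho_poly :: "nat \<Rightarrow> real poly" where
  "ortho_poly n =
    (let q = monom 1 n - (\<Sum>k<n. smult (\<I> (monom 1 n * ortho_poly k)) (ortho_poly k))
     in smult (1 / sqrt (\<I> (q * q))) q)"
end

declare ortho_poly.simps [simp del]

text \<open>Degree, norm and orthogonality support each other: the lower degrees make q monic of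
  degree n, hence nonzero, so its norm is positive; orthogonality uses the orthonormality of all
  earlier polynomials.\<close>

lemma ortho_poly_properties:
  "degree (ortho_poly n) = n \<and> \<I> (ortho_poly n * ortho_poly n) = 1 \<and>
    (\<forall>j<n. \<I> (ortho_poly n * ortho_poly j) = 0)"
proof (induction n rule: less_induct)
  case (less n)
  define r where "r = (\<Sum>k<n. smult (\<I> (monom 1 n * ortho_poly k)) (ortho_poly k))"
  define q where "q = monom 1 n - r"
  have P: "ortho_poly n = smult (1 / sqrt (\<I> (q * q))) q"
    by (subst ortho_poly.simps) (simp add: q_def r_def Let_def)
  have r: "coeff r i = 0" if "n \<le> i" for i
    unfolding r_def coeff_sum using less that
    by (intro sum.neutral ballI) (simp add: coeff_eq_0)
  have lead: "coeff q n = 1" by (simp add: q_def r)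
  then have q0: "q \<noteq> 0" by auto
  have deg: "degree q = n"
  proof (rule antisym)
    show "degree q \<le> n" by (rule degree_le) (simp add: q_def r)
    show "n \<le> degree q" using lead by (intro le_degree) simp
  qed
  have pos: "0 < \<I> (q * q)" by (rule pos[OF q0])
  have orth: "\<I> (q * ortho_poly j) = 0" if j: "j < n" for j
  proof -
    have PP: "\<I> (ortho_poly k * ortho_poly j) = of_bool (k = j)" if "k < n" for k
      using less[OF that] less[OF j] by (cases k j rule: linorder_cases) (auto simp: mult.commute)
    have "\<I> (r * ortho_poly j) = (\<Sum>k<n. \<I> (monom 1 n * ortho_poly k) * of_bool (k = j))"
      by (simp add: r_def sum_distrib_right sum scale PP)
    also have "\<dots> = \<I> (monom 1 n * ortho_poly j)"
      using j by simp
    finally show ?thesis by (simp add: q_def left_diff_distrib diff)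
  qed
  have "\<I> (ortho_poly n * ortho_poly n) = 1"
    using pos by (simp add: P scale real_sqrt_mult_self)
  then show ?case
    using deg pos orth by (auto simp: P scale)
qed

lemma degree_ortho_poly [simp]: "degree (ortho_poly n) = n"
  using ortho_poly_properties[of n] by blast

lemma ortho_poly_orthonormal: "\<I> (ortho_poly i * ortho_poly j) = of_bool (i = j)"
  using ortho_poly_properties[of i] ortho_poly_properties[of j]
  by (cases i j rule: linorder_cases) (auto simp: mult.commute)

lemma ortho_poly_0: "\<I> 1 = 1 \<Longrightarrow> ortho_poly 0 = 1"
  by (subst ortho_poly.simps) (simp add: monom_0 one_pCons[symmetric])

text \<open>Subtracting a multiple of \<open>ortho_poly n\<close> removes the top coefficient. The
  hypothesis is about coefficients because at n = 0 it has to say p = 0, which no degree bound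
  expresses.\<close>

lemma ortho_poly_span:
  assumes "\<And>i. n \<le> i \<Longrightarrow> coeff p i = 0"
  shows "\<exists>a. p = (\<Sum>k<n. smult (a k) (ortho_poly k))"
  using assms
proof (induction n arbitrary: p)
  case 0
  then show ?case by (simp add: poly_eq_iff)
next
  case (Suc n)
  let ?l = "lead_coeff (ortho_poly n)"
  have "ortho_poly n \<noteq> 0"
    using ortho_poly_orthonormal[of n n] by auto
  then have l: "?l \<noteq> 0"
    by (simp only: leading_coeff_0_iff not_False_eq_True)
  define p' where "p' = p - smult (coeff p n / ?l) (ortho_poly n)"
  have "coeff p' i = 0" if "n \<le> i" for i
  proof (cases "i = n")
    case True
    then show ?thesis using l by (simp add: p'_def)
  next
    case False
    then show ?thesis using that Suc.prems[of i] by (simp add: p'_def coeff_eq_0)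
  qed
  then obtain a where "p' = (\<Sum>k<n. smult (a k) (ortho_poly k))"
    using Suc.IH by blast
  then have "p = (\<Sum>k<Suc n. smult ((a(n := coeff p n / ?l)) k) (ortho_poly k))"
    by (simp add: p'_def algebra_simps)
  then show ?case by blast
qed

lemma ortho_poly_low_degree:
  assumes "\<And>i. n \<le> i \<Longrightarrow> coeff p i = 0"
  shows "\<I> (p * ortho_poly n) = 0"
proof -
  obtain a where "p = (\<Sum>k<n. smult (a k) (ortho_poly k))"
    using ortho_poly_span[OF assms] by blast
  then show ?thesis
    by (simp add: sum_distrib_right sum scale ortho_poly_orthonormal)
qed

lemma square_span: 
  "\<I> ((\<Sum>k<n. smult (a k) (ortho_poly k)) * (\<Sum>k<n. smult (a k) (ortho_poly k))) = (\<Sum>k<n. (a k)\<^sup>2)"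
proof -
  have "\<I> ((\<Sum>k<n. smult (a k) (ortho_poly k)) * (\<Sum>k<n. smult (a k) (ortho_poly k))) =
    (\<Sum>k<n. \<Sum>j<n. a k * (a j * of_bool (k = j)))"
    by (simp add: sum_product sum scale ortho_poly_orthonormal mult_ac)
  also have "\<dots> = (\<Sum>k<n. (a k)\<^sup>2)"
    by (simp add: of_bool_def if_distrib power2_eq_square cong: if_cong)
  finally show ?thesis .
qed

lemma christoffel_ge:
  assumes "degree p < n"
  shows "(poly p t)\<^sup>2 \<le> (\<Sum>k<n. (poly (ortho_poly k) t)\<^sup>2) * \<I> (p * p)"
proof -
  obtain a where p: "p = (\<Sum>k<n. smult (a k) (ortho_poly k))"
    using ortho_poly_span[of n p] assms by (metis coeff_eq_0 less_le_trans)
  have "(poly p t)\<^sup>2 = (\<Sum>k<n. poly (ortho_poly k) t * a k)\<^sup>2"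
    by (simp add: p poly_sum mult.commute)
  also have "\<dots> \<le> (\<Sum>k<n. (poly (ortho_poly k) t)\<^sup>2) * (\<Sum>k<n. (a k)\<^sup>2)"
    by (rule Cauchy_Schwarz_ineq_sum)
  also have "(\<Sum>k<n. (a k)\<^sup>2) = \<I> (p * p)"
    by (simp only: p square_span)
  finally show ?thesis .
qed

text \<open>The reproducing kernel at t is extremal: for this p both p(t) and
  \<open>\<I> (p * p)\<close> are equal to the kernel sum s, so s^2 \<le> \<kappa> s. The maximum
  with 0 covers s = 0.\<close>

lemma christoffel_le:
  assumes "\<And>p. degree p < n \<Longrightarrow> (poly p t)\<^sup>2 \<le> \<kappa> * \<I> (p * p)"
  shows "(\<Sum>k<n. (poly (ortho_poly k) t)\<^sup>2) \<le> max \<kappa> 0"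
proof (cases "n = 0")
  case False
  define s where "s = (\<Sum>k<n. (poly (ortho_poly k) t)\<^sup>2)"
  define p where "p = (\<Sum>k<n. smult (poly (ortho_poly k) t) (ortho_poly k))"
  have "degree p < n"
    unfolding p_def using False by (intro degree_sum_less) (auto intro: le_less_trans[OF degree_smult_le])
  then have "(poly p t)\<^sup>2 \<le> \<kappa> * \<I> (p * p)" by (rule assms)
  also have "\<I> (p * p) = s" by (simp only: p_def square_span s_def)
  also have "poly p t = s" by (simp add: p_def poly_sum s_def power2_eq_square)
  finally have "s * s \<le> \<kappa> * s" by (simp add: power2_eq_square)
  moreover have "0 \<le> s" by (simp add: s_def sum_nonneg)
  ultimately have "s \<le> max \<kappa> 0"
    by (cases "s = 0") auto
  then show ?thesis by (simp add: s_def)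
qed simp

end

section \<open>Integrals of polynomials over intervals and endpoint estimates\<close>

definition pint :: "real \<Rightarrow> real \<Rightarrow> real poly \<Rightarrow> real" where
  "pint a b p = integral {a..b} (poly p)"

lemma poly_integrable: "poly p integrable_on {a..b :: real}"
  by (intro integrable_continuous_real continuous_intros)

lemma pint_add: "pint a b (p + q) = pint a b p + pint a b q"
proof -
  have "poly (p + q) = (\<lambda>x. poly p x + poly q x)" by auto
  then show ?thesis unfolding pint_def by (simp add: integral_add poly_integrable)
qed

lemma pint_scale: "pint a b (smult c p) = c * pint a b p"
proof -
  have "poly (smult c p) = (\<lambda>x. c * poly p x)" by auto
  then show ?thesis unfolding pint_def by simp
qed

lemma pint_const: "a \<le> b \<Longrightarrow> pint a b [:c:] = (b - a) * c"
proof -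
  assume "a \<le> b"
  moreover have "poly [:c:] = (\<lambda>x. c)" by auto
  ultimately show ?thesis unfolding pint_def by simp
qed

lemma pint_0: "pint a b 0 = 0"
  using pint_scale[of a b 0 0] by simp

lemma pint_diff: "pint a b (p - q) = pint a b p - pint a b q"
  using pint_add[of a b "p - q" q] by simp

lemma pint_mono:
  assumes "\<And>x. x \<in> {a..b} \<Longrightarrow> poly p x \<le> poly q x"
  shows "pint a b p \<le> pint a b q"
  unfolding pint_def by (intro integral_le poly_integrable assms)

lemma pint_nonneg:
  assumes "\<And>x. x \<in> {a..b} \<Longrightarrow> 0 \<le> poly p x"
  shows "0 \<le> pint a b p"
  unfolding pint_def by (intro integral_nonneg poly_integrable assms)

lemma pint_pderiv: "a \<le> b \<Longrightarrow> pint a b (pderiv p) = poly p b - poly p a"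
  unfolding pint_def
  by (intro integral_unique fundamental_theorem_of_calculus)
     (auto simp: has_real_derivative_iff_has_vector_derivative[symmetric]
       intro: DERIV_subset[OF poly_DERIV])

lemma pderiv_sum: "pderiv (\<Sum>i\<in>A. f i) = (\<Sum>i\<in>A. pderiv (f i))"
  by (induction A rule: infinite_finite_induct) (simp_all add: pderiv_add)

lemma pderiv_mult_square:
  fixes x P :: "real poly"
  assumes "pderiv x = 1"
  shows "pderiv (x * (P * P)) = P * P + smult 2 ((x * pderiv P) * P)"
proof -
  have "smult 2 q = q + q" for q :: "real poly"
    using smult_add_left[of 1 1 q] by simp
  then show ?thesis by (simp add: pderiv_mult assms algebra_simps)
qed

lemma pcompose_power: "pcompose (p ^ n) q = pcompose p q ^ n"
  by (induction n) (simp_all add: pcompose_mult pcompose_1)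

lemma pderiv_surj: "\<exists>p. pderiv p = (q :: real poly)"
proof -
  let ?p = "\<Sum>i\<le>degree q. monom (coeff q i / real (Suc i)) (Suc i)"
  have "pderiv ?p = (\<Sum>i\<le>degree q. monom (coeff q i) i)"
    unfolding pderiv_sum by (intro sum.cong refl) (simp add: pderiv_monom del: of_nat_Suc)
  also have "\<dots> = q"
    by (rule poly_as_sum_of_monoms)
  finally show ?thesis by (rule exI)
qed

lemma antiderivative_exists:
  obtains P where "pderiv P = (q :: real poly)" and "poly P c = 0"
proof -
  obtain p where "pderiv p = q" using pderiv_surj by blast
  then show ?thesis using that[of "p - [:poly p c:]"] by (simp add: pderiv_diff)
qed

lemma pint_combine: "a \<le> c \<Longrightarrow> c \<le> b \<Longrightarrow> pint a c p + pint c b p = pint a b p"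
  unfolding pint_def by (rule Henstock_Kurzweil_Integration.integral_combine) (auto intro: poly_integrable)

lemma pint_square_pos:
  assumes "a < b" and "p \<noteq> 0"
  shows "0 < pint a b (p * p)"
proof -
  have "0 \<le> pint a b (p * p)" by (rule pint_nonneg) simp
  moreover have "pint a b (p * p) \<noteq> 0"
  proof
    assume "pint a b (p * p) = 0"
    then have 0: "(poly (p * p) has_integral 0) (cbox a b)"
      using integrable_integral[OF poly_integrable[of "p * p" a b]] by (simp add: pint_def)
    have cont: "continuous_on (cbox a b) (poly (p * p))"
      by (rule continuous_on_poly[OF continuous_on_id])
    have "poly (p * p) x = 0" if "x \<in> {a..b}" for x
      using has_integral_0_cbox_imp_0[OF cont _ 0, of x] that assms(1)
      by (auto simp: box_real box_ne_empty)
    then have "p = 0" by (intro poly_eq_0_of_interval[OF assms(1)]) simp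
    then show False using assms(2) by simp
  qed
  ultimately show ?thesis by linarith
qed

lemma positive_functional_pint: "a < b \<Longrightarrow> positive_functional (pint a b)"
  by standard (auto simp: pint_add pint_scale pint_square_pos)

text \<open>The normalized Legendre polynomials \<open>P\<^sub>k\<close> on \<open>[a, b]\<close> satisfy
  \<open>P\<^sub>k(a)\<^sup>2 = P\<^sub>k(b)\<^sup>2 = (2 k + 1) / (b - a)\<close>: integrate the derivatives of \<open>P\<^sub>k\<^sup>2\<close> and of
  \<open>(x - a) P\<^sub>k\<^sup>2\<close> and use that \<open>P\<^sub>k\<close> is orthogonal to all polynomials of lower degree.\<close>

lemma legendre_endpoint:
  assumes "a \<le> b" and "degree p < n"
  shows "(b - a) * (poly p a)\<^sup>2 \<le> (real n)\<^sup>2 * pint a b (p * p)"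
proof (cases "a = b")
  case True
  then show ?thesis by (simp add: pint_def)
next
  case False
  then have ab: "a < b" using assms(1) by simp
  interpret positive_functional "pint a b" by (rule positive_functional_pint[OF ab])
  have val: "(b - a) * (poly (ortho_poly k) a)\<^sup>2 = 2 * real k + 1" for k
  proof -
    let ?P = "ortho_poly k" and ?x = "[:- a, 1:]"
    have low: "pint a b (q * ?P) = 0" if "\<And>i. k \<le> i \<Longrightarrow> coeff q i = 0" for q
      by (rule ortho_poly_low_degree[OF that])
    have "pint a b (pderiv ?P * ?P) = 0"
      by (rule low) (simp add: coeff_pderiv coeff_eq_0)
    moreover have "pint a b (pderiv (?P * ?P)) = pint a b (pderiv ?P * ?P) + pint a b (pderiv ?P * ?P)"
      by (simp only: pderiv_mult pint_add mult.commute[of ?P "pderiv ?P"])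
    ultimately have "(poly ?P b)\<^sup>2 = (poly ?P a)\<^sup>2"
      using pint_pderiv[of a b "?P * ?P"] ab by (simp add: power2_eq_square)
    moreover have "(b - a) * (poly ?P b)\<^sup>2 = 2 * real k + 1"
    proof -
      \<comment> \<open>The leading terms of (x - a) P' and k P agree, so their difference has
        degree below k and is orthogonal to P.\<close>
      have "coeff (?x * pderiv ?P - smult (real k) ?P) i = 0" if "k \<le> i" for i
        using that by (cases i; cases "i = k") (auto simp: coeff_pCons coeff_pderiv coeff_eq_0 split: nat.splits)
      from low[OF this] have "pint a b ((?x * pderiv ?P) * ?P) = real k"
        using ortho_poly_orthonormal[of k k]
        by (simp only: left_diff_distrib pint_diff mult_smult_left pint_scale) simp
      moreover have "pderiv (?x * (?P * ?P)) = ?P * ?P + smult 2 ((?x * pderiv ?P) * ?P)"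
        by (rule pderiv_mult_square) (simp add: pderiv_pCons)
      ultimately have "pint a b (pderiv (?x * (?P * ?P))) = 1 + 2 * real k"
        using ortho_poly_orthonormal[of k k] by (simp only: pint_add pint_scale) simp
      then show ?thesis
        using pint_pderiv[of a b "?x * (?P * ?P)"] ab by (simp add: power2_eq_square algebra_simps)
    qed
    ultimately show ?thesis by simp
  qed
  have "(b - a) * (\<Sum>k<n. (poly (ortho_poly k) a)\<^sup>2) = (\<Sum>k<n. 2 * real k + 1)"
    by (simp add: sum_distrib_left val)
  also have "\<dots> = (real n)\<^sup>2"
    by (induction n) (simp_all add: power2_eq_square algebra_simps)
  finally have sum: "(b - a) * (\<Sum>k<n. (poly (ortho_poly k) a)\<^sup>2) = (real n)\<^sup>2" .
  have "(b - a) * (poly p a)\<^sup>2 \<le> (b - a) * ((\<Sum>k<n. (poly (ortho_poly k) a)\<^sup>2) * pint a b (p * p))"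
    using ab by (intro mult_left_mono christoffel_ge assms) simp
  also have "\<dots> = (real n)\<^sup>2 * pint a b (p * p)"
    by (simp only: mult.assoc[symmetric] sum)
  finally show ?thesis .
qed

text \<open>By \<open>legendre_endpoint\<close> on every interval [t, s], the antiderivative H of
  n^2 p^2 - p(t)^2 with H(t) = 0 is nonnegative to the right of t. As (1 - x)^a is nonincreasing,
  integration by parts against it leaves only nonnegative terms.\<close>

lemma jacobi_endpoint_0:
  assumes "t \<le> 1" and "degree p < n"
  shows "(poly p t)\<^sup>2 * pint t 1 ([:1, -1:] ^ a) \<le> (real n)\<^sup>2 * pint t 1 ([:1, -1:] ^ a * (p * p))"
proof -
  define h where "h = smult ((real n)\<^sup>2) (p * p) - [:(poly p t)\<^sup>2:]"
  obtain H where H: "pderiv H = h" "poly H t = 0" by (rule antiderivative_exists)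
  have Hpos: "0 \<le> poly H s" if "t \<le> s" for s
  proof -
    have "poly H s = pint t s h" using pint_pderiv[OF that, of H] H by simp
    also have "\<dots> = (real n)\<^sup>2 * pint t s (p * p) - (s - t) * (poly p t)\<^sup>2"
      using that by (simp add: h_def pint_diff pint_scale pint_const)
    finally show ?thesis using legendre_endpoint[OF that assms(2)] by simp
  qed
  let ?w = "[:1, -1 :: real:] ^ a"
  have "pint t 1 (pderiv (?w * H)) = poly (?w * H) 1"
    using pint_pderiv[OF assms(1), of "?w * H"] H(2) by simp
  moreover have "0 \<le> poly (?w * H) 1" using Hpos[OF assms(1)] by simp
  moreover have "pint t 1 (pderiv (?w * H)) = pint t 1 (?w * h) + pint t 1 (H * pderiv ?w)"
    by (simp add: pderiv_mult pint_add H)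
  moreover have "pint t 1 (H * pderiv ?w) \<le> pint t 1 0"
  proof (rule pint_mono)
    fix x assume "x \<in> {t..1}"
    then have "0 \<le> poly H x" "0 \<le> 1 - x" using Hpos by auto
    then show "poly (H * pderiv ?w) x \<le> poly 0 x"
      by (simp add: pderiv_power pderiv_pCons)
  qed
  ultimately have "0 \<le> pint t 1 (?w * h)" by (simp add: pint_0)
  also have "?w * h = smult ((real n)\<^sup>2) (?w * (p * p)) - smult ((poly p t)\<^sup>2) ?w"
    by (simp add: h_def right_diff_distrib)
  finally show ?thesis by (simp add: pint_diff pint_scale)
qed

lemma pint_one_minus_power:
  "t \<le> 1 \<Longrightarrow> pint t 1 ([:1, -1:] ^ a) = (1 - t) ^ Suc a / real (Suc a)"
proof -
  assume "t \<le> 1"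
  have "pderiv (smult (- 1 / real (Suc a)) ([:1, -1:] ^ Suc a)) = [:1, -1 :: real:] ^ a"
    by (simp add: pderiv_smult pderiv_minus pderiv_power_Suc pderiv_pCons del: of_nat_Suc power_Suc)
  then show ?thesis
    using pint_pderiv[OF \<open>t \<le> 1\<close>, of "smult (- 1 / real (Suc a)) ([:1, -1:] ^ Suc a)"]
    by (simp del: power_Suc of_nat_Suc)
qed

text \<open>Integration by parts raises the exponent of \<open>1 - x\<close> by one, at the price of a factor
  \<open>n\<^sup>2\<close> from the case \<open>b = 0\<close>; all inequalities used are equalities for \<open>n = 1\<close>.\<close>

lemma jacobi_endpoint:
  assumes "-1 \<le> t" and "t \<le> 1" and "degree p < n"
  shows "(poly p t)\<^sup>2 * pint t 1 ([:1, -1:] ^ a * [:1, 1:] ^ b)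
    \<le> real n ^ (2 * b + 2) * pint t 1 ([:1, -1:] ^ a * [:1, 1:] ^ b * (p * p))"
  using assms(1,2)
proof (induction b arbitrary: a t)
  case 0
  then show ?case using jacobi_endpoint_0[OF _ assms(3)] by (simp add: power2_eq_square)
next
  case (Suc b)
  have n: "1 \<le> real n" using assms(3) by simp
  let ?u = "[:1, -1 :: real:]" and ?v = "[:1, 1 :: real:]"
  \<comment> \<open>G(x) is the integral of (1 - y)^a p(y)^2 over [x, 1]; F below is the same with 1
    in place of p.\<close>
  obtain G where G: "pderiv G = - (?u ^ a * (p * p))" "poly G 1 = 0" by (rule antiderivative_exists)
  have parts: "pint t 1 (?u ^ a * ?v ^ Suc b * q) =
    (1 + t) ^ Suc b * poly F t + real (Suc b) * pint t 1 (?v ^ b * F)"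
    if "pderiv F = - (?u ^ a * q)" "poly F 1 = 0" for F q
  proof -
    have "pderiv (?v ^ Suc b * F) = smult (real (Suc b)) (?v ^ b * F) - ?u ^ a * ?v ^ Suc b * q"
      unfolding pderiv_mult that(1) by (simp add: pderiv_power_Suc pderiv_pCons mult_ac del: power_Suc of_nat_Suc)
    then have "poly (?v ^ Suc b * F) 1 - poly (?v ^ Suc b * F) t =
      real (Suc b) * pint t 1 (?v ^ b * F) - pint t 1 (?u ^ a * ?v ^ Suc b * q)"
      using pint_pderiv[OF Suc.prems(2), of "?v ^ Suc b * F"] by (simp only: pint_diff pint_scale)
    then show ?thesis using that(2) by (simp del: power_Suc of_nat_Suc)
  qed
  define F where "F = smult (1 / real (Suc a)) (?u ^ Suc a)"
  have F: "pderiv F = - (?u ^ a * 1)" "poly F 1 = 0"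
    by (simp_all add: F_def pderiv_smult pderiv_power_Suc pderiv_pCons del: of_nat_Suc power_Suc)
  \<comment> \<open>Used at x = t for the boundary term, and at every x of [t, 1] under the
    remaining integral.\<close>
  have GF: "(poly p x)\<^sup>2 * poly F x \<le> (real n)\<^sup>2 * poly G x" if "x \<le> 1" for x
  proof -
    have "pint x 1 (?u ^ a * (p * p)) = poly G x"
      using pint_pderiv[OF that, of G] G pint_scale[of x 1 "-1" "?u ^ a * (p * p)"] by simp
    moreover have "pint x 1 (?u ^ a) = poly F x"
      using pint_one_minus_power[OF that] by (simp add: F_def del: power_Suc of_nat_Suc)
    ultimately show ?thesis using jacobi_endpoint_0[OF that assms(3), of a] by simp
  qed
  have F0: "0 \<le> poly F t" using Suc.prems by (simp add: F_def del: power_Suc of_nat_Suc)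
  have "(poly p t)\<^sup>2 * pint t 1 (?u ^ a * ?v ^ Suc b) =
    (1 + t) ^ Suc b * ((poly p t)\<^sup>2 * poly F t) + real (Suc b) * ((poly p t)\<^sup>2 * pint t 1 (?v ^ b * F))"
    using parts[OF F] by (simp add: algebra_simps)
  also have "\<dots> \<le> (1 + t) ^ Suc b * (real n ^ (2 * Suc b + 2) * poly G t) +
     real (Suc b) * (real n ^ (2 * Suc b + 2) * pint t 1 (?v ^ b * G))"
  proof (intro add_mono mult_left_mono)
    have "(poly p t)\<^sup>2 * poly F t \<le> (real n)\<^sup>2 * poly G t"
      using GF Suc.prems by simp
    also have "\<dots> \<le> real n ^ (2 * Suc b) * ((real n)\<^sup>2 * poly G t)"
    proof -
      have "0 \<le> (real n)\<^sup>2 * poly G t"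
        by (rule order_trans[OF _ GF[OF Suc.prems(2)]]) (use F0 in simp)
      moreover have "1 \<le> real n ^ (2 * Suc b)" using n by (rule one_le_power)
      ultimately show ?thesis using mult_right_mono by fastforce
    qed
    finally show "(poly p t)\<^sup>2 * poly F t \<le> real n ^ (2 * Suc b + 2) * poly G t"
      by (simp add: power_add power2_eq_square mult_ac)
    have "(poly p t)\<^sup>2 * pint t 1 (?v ^ b * F) =
      (poly p t)\<^sup>2 * pint t 1 (?u ^ Suc a * ?v ^ b) / real (Suc a)"
      by (simp add: F_def pint_scale mult.commute)
    \<comment> \<open>F is a multiple of (1 - x)^(a+1), so the induction hypothesis applies with a +
      1 in place of a.\<close>
    also have "\<dots> \<le> real n ^ (2 * b + 2) * pint t 1 (?u ^ Suc a * ?v ^ b * (p * p)) / real (Suc a)"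
      by (intro divide_right_mono Suc.IH Suc.prems) simp
    also have "\<dots> = real n ^ (2 * b + 2) * pint t 1 (?v ^ b * (F * (p * p)))"
      by (simp add: F_def pint_scale mult_ac)
    also have "\<dots> \<le> real n ^ (2 * b + 2) * pint t 1 (?v ^ b * smult ((real n)\<^sup>2) G)"
    proof (intro mult_left_mono pint_mono)
      fix x assume x: "x \<in> {t..1}"
      have "poly (F * (p * p)) x \<le> poly (smult ((real n)\<^sup>2) G) x"
        using GF[of x] x by (simp add: power2_eq_square mult_ac)
      moreover have "0 \<le> poly (?v ^ b) x" using x Suc.prems by simp
      ultimately show "poly (?v ^ b * (F * (p * p))) x \<le> poly (?v ^ b * smult ((real n)\<^sup>2) G) x"
        unfolding poly_mult[of "?v ^ b"] by (rule mult_left_mono)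
    qed simp
    finally show "(poly p t)\<^sup>2 * pint t 1 (?v ^ b * F) \<le> real n ^ (2 * Suc b + 2) * pint t 1 (?v ^ b * G)"
      by (simp add: pint_scale power_add power2_eq_square mult_ac)
  qed (use Suc.prems in auto)
  also have "\<dots> = real n ^ (2 * Suc b + 2) * pint t 1 (?u ^ a * ?v ^ Suc b * (p * p))"
    using parts[OF G] by (simp add: algebra_simps)
  finally show ?case .
qed

lemma pint_reflect: "pint (- b) (- a) (pcompose p [:0, -1:]) = pint a b p"
proof -
  have "poly (pcompose p [:0, -1:]) = (\<lambda>x. poly p (- x))"
    by (auto simp: poly_pcompose)
  then show ?thesis unfolding pint_def by simp
qed

text \<open>The integral is split at t, which is an endpoint of both pieces. The right piece is
  \<open>jacobi_endpoint\<close>; reflection about 0 turns the left piece into a right one with a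
  and b exchanged, hence the maximum in the exponent.\<close>

theorem jacobi_christoffel:
  assumes "-1 \<le> t" and "t \<le> 1" and "degree p < n"
  shows "(poly p t)\<^sup>2 * pint (-1) 1 ([:1, -1:] ^ a * [:1, 1:] ^ b)
    \<le> real n ^ (2 * max a b + 2) * pint (-1) 1 ([:1, -1:] ^ a * [:1, 1:] ^ b * (p * p))"
proof -
  let ?w = "[:1, -1 :: real:] ^ a * [:1, 1 :: real:] ^ b" and ?r = "\<lambda>q. pcompose q [:0, -1 :: real:]"
  let ?N = "real n ^ (2 * max a b + 2)"
  have n: "1 \<le> real n" using assms(3) by simp
  have nonneg: "0 \<le> poly (?w * (p * p)) x" if "x \<in> {-1..1}" for x
    using that by simp
  have "(poly p t)\<^sup>2 * pint t 1 ?w \<le> real n ^ (2 * b + 2) * pint t 1 (?w * (p * p))"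
    using jacobi_endpoint[OF assms] by (simp add: mult.assoc)
  also have "\<dots> \<le> ?N * pint t 1 (?w * (p * p))"
    using n assms by (intro mult_right_mono power_increasing pint_nonneg nonneg) auto
  finally have right: "(poly p t)\<^sup>2 * pint t 1 ?w \<le> ?N * pint t 1 (?w * (p * p))" .
  have refl: "?r ?w = [:1, -1:] ^ b * [:1, 1:] ^ a"
    by (simp add: pcompose_mult pcompose_power pcompose_pCons mult.commute)
  have "(poly (?r p) (- t))\<^sup>2 * pint (- t) 1 (?r ?w) \<le>
    real n ^ (2 * a + 2) * pint (- t) 1 (?r ?w * (?r p * ?r p))"
    unfolding refl using assms by (intro jacobi_endpoint) (auto simp: degree_pcompose)
  moreover have "pint (- t) 1 (?r ?w) = pint (-1) t ?w"
    using pint_reflect[of t "-1" ?w] by simp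
  moreover have "pint (- t) 1 (?r ?w * (?r p * ?r p)) = pint (-1) t (?w * (p * p))"
    using pint_reflect[of t "-1" "?w * (p * p)"] by (simp add: pcompose_mult)
  ultimately have "(poly p t)\<^sup>2 * pint (-1) t ?w \<le> real n ^ (2 * a + 2) * pint (-1) t (?w * (p * p))"
    by (simp add: poly_pcompose)
  also have "\<dots> \<le> ?N * pint (-1) t (?w * (p * p))"
    using n assms by (intro mult_right_mono power_increasing pint_nonneg nonneg) auto
  finally have left: "(poly p t)\<^sup>2 * pint (-1) t ?w \<le> ?N * pint (-1) t (?w * (p * p))" .
  from add_mono[OF left right] show ?thesis
    using assms by (simp add: pint_combine flip: distrib_left)
qed

section \<open>Jacobi measures\<close>

definition fin_span :: "'i set \<Rightarrow> ('i \<Rightarrow> 'a \<Rightarrow> real) \<Rightarrow> ('a \<Rightarrow> real) \<Rightarrow> bool" where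
  "fin_span I b f \<longleftrightarrow> (\<exists>c. \<forall>x. f x = (\<Sum>i\<in>I. c i * b i x))"

lemma fin_span_base: "finite I \<Longrightarrow> i \<in> I \<Longrightarrow> fin_span I b (b i)"
  unfolding fin_span_def
  by (intro exI[of _ "\<lambda>j. of_bool (j = i)"]) (simp add: of_bool_def if_distrib[of "\<lambda>c. c * _"] cong: if_cong)

lemma fin_span_add: "fin_span I b f \<Longrightarrow> fin_span I b g \<Longrightarrow> fin_span I b (\<lambda>x. f x + g x)"
proof -
  assume "fin_span I b f" "fin_span I b g"
  then obtain c d where "\<And>x. f x = (\<Sum>i\<in>I. c i * b i x)" "\<And>x. g x = (\<Sum>i\<in>I. d i * b i x)"
    unfolding fin_span_def by blast
  then show ?thesis
    unfolding fin_span_def by (intro exI[of _ "\<lambda>i. c i + d i"]) (simp add: distrib_right sum.distrib)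
qed

lemma fin_span_scale: "fin_span I b f \<Longrightarrow> fin_span I b (\<lambda>x. a * f x)"
proof -
  assume "fin_span I b f"
  then obtain c where "\<And>x. f x = (\<Sum>i\<in>I. c i * b i x)" unfolding fin_span_def by blast
  then show ?thesis
    unfolding fin_span_def by (intro exI[of _ "\<lambda>i. a * c i"]) (simp add: sum_distrib_left mult.assoc)
qed

lemma fin_span_sum:
  assumes "finite A" and "\<And>k. k \<in> A \<Longrightarrow> fin_span I b (f k)"
  shows "fin_span I b (\<lambda>x. \<Sum>k\<in>A. f k x)"
  using assms
proof (induction A rule: finite_induct)
  case empty
  show ?case by (simp add: fin_span_def exI[of _ "\<lambda>_. 0"])
qed (simp add: fin_span_add)

abbreviation cosine_sum :: "nat \<Rightarrow> (real \<Rightarrow> real) \<Rightarrow> bool" where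
  "cosine_sum n \<equiv> fin_span {..<n} (\<lambda>k x. cos (real k * x))"

lemma cosine_sum_cos: "k < n \<Longrightarrow> cosine_sum n (\<lambda>x. cos (real k * x))"
  by (rule fin_span_base) auto

text \<open>The product formula replaces cos x cos (k x) by the frequencies k + 1 and k - 1; k = 0
  is separate because k - 1 would leave the natural numbers.\<close>

lemma cosine_sum_mult_cos:
  assumes "cosine_sum n f"
  shows "cosine_sum (Suc n) (\<lambda>x. cos x * f x)"
proof -
  obtain a where f: "\<And>x. f x = (\<Sum>k<n. a k * cos (real k * x))"
    using assms unfolding fin_span_def by blast
  have "cosine_sum (Suc n) (\<lambda>x. cos x * cos (real k * x))" if "k < n" for k
  proof (cases k)
    case 0
    then show ?thesis using cosine_sum_cos[of 1 "Suc n"] that by simp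
  next
    case (Suc j)
    have "cosine_sum (Suc n) (\<lambda>x. 1 / 2 * cos (real (Suc (Suc j)) * x) + 1 / 2 * cos (real j * x))"
      using that Suc by (intro fin_span_add fin_span_scale cosine_sum_cos) auto
    moreover have "1 / 2 * cos (real (Suc (Suc j)) * x) + 1 / 2 * cos (real j * x) = cos x * cos (real k * x)" for x
    proof -
      have "real (Suc (Suc j)) * x = real k * x + x" "real j * x = real k * x - x"
        using Suc by (simp_all add: algebra_simps)
      then show ?thesis by (simp only: cos_add cos_diff) (simp add: field_simps)
    qed
    ultimately show ?thesis by simp
  qed
  then have "cosine_sum (Suc n) (\<lambda>x. \<Sum>k<n. a k * (cos x * cos (real k * x)))"
    by (intro fin_span_sum fin_span_scale) auto
  then show ?thesis by (simp add: f sum_distrib_left mult.left_commute)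
qed

text \<open>Horner's scheme in -cos x. The sign makes the substitution increase from -1 to 1 on
  [0, pi].\<close>

lemma poly_cos_cosine_sum:
  assumes "\<And>i. n \<le> i \<Longrightarrow> coeff p i = 0"
  shows "cosine_sum n (\<lambda>x. poly p (- cos x))"
  using assms
proof (induction n arbitrary: p)
  case 0
  then have "p = 0" by (simp add: poly_eq_iff)
  then show ?case by (simp add: fin_span_def)
next
  case (Suc n)
  obtain c q where p: "p = pCons c q" by (cases p)
  have "coeff q i = 0" if "n \<le> i" for i
    using Suc.prems[of "Suc i"] that by (simp add: p)
  then have "cosine_sum (Suc n) (\<lambda>x. c * cos (real 0 * x) + (- 1) * (cos x * poly q (- cos x)))"
    by (intro fin_span_add fin_span_scale cosine_sum_mult_cos Suc.IH cosine_sum_cos) auto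
  then show ?case by (simp add: p)
qed

lemma integral_cos_multiple:
  "((\<lambda>x. cos (of_int l * x)) has_integral (if l = 0 then pi else 0)) {0..pi}"
proof (cases "l = 0")
  case True
  then show ?thesis using has_integral_const_real[of "1::real" 0 pi] by simp
next
  case False
  have "((\<lambda>x. cos (of_int l * x)) has_integral (sin (of_int l * pi) / of_int l - sin (of_int l * 0) / of_int l)) {0..pi}"
    by (rule fundamental_theorem_of_calculus)
       (auto simp: has_real_derivative_iff_has_vector_derivative[symmetric] False intro!: derivative_eq_intros)
  then show ?thesis using False sin_npi_int[of l] by (simp add: mult.commute)
qed

lemma integral_cos_mult:
  "((\<lambda>x. cos (real j * x) * cos (real k * x)) has_integral (if j = k then if j = 0 then pi else pi / 2 else 0)) {0..pi}"
proof -
  have "((\<lambda>x. 1 / 2 * cos (of_int (int j - int k) * x) + 1 / 2 * cos (of_int (int j + int k) * x)) has_integral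
    (1 / 2 * (if int j - int k = 0 then pi else 0) + 1 / 2 * (if int j + int k = 0 then pi else 0))) {0..pi}"
    by (intro has_integral_add has_integral_mult_right integral_cos_multiple)
  moreover have "1 / 2 * cos (of_int (int j - int k) * x) + 1 / 2 * cos (of_int (int j + int k) * x) =
    cos (real j * x) * cos (real k * x)" for x
    by (simp add: left_diff_distrib distrib_right cos_add cos_diff add_divide_distrib diff_divide_distrib)
  moreover have "1 / 2 * (if int j - int k = 0 then pi else 0) + 1 / 2 * (if int j + int k = 0 then pi else 0)
    = (if j = k then if j = 0 then pi else pi / 2 else 0)"
    by auto
  ultimately show ?thesis by (simp only:)
qed

text \<open>The squared norm of cos (k x) on [0, pi] is pi / d k, so Cauchy-Schwarz with the weights
  d k bounds the kernel by their sum 1 + 2 (n - 1), because cosines are at most 1 in absolute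
  value.\<close>

lemma chebyshev_christoffel_cos:
  assumes "degree p < n"
  shows "pi * (poly p (- cos y))\<^sup>2 \<le> (2 * real n - 1) * integral {0..pi} (\<lambda>x. (poly p (- cos x))\<^sup>2)"
proof -
  have "cosine_sum n (\<lambda>x. poly p (- cos x))"
    using assms by (intro poly_cos_cosine_sum coeff_eq_0) simp
  then obtain a where a: "\<And>x. poly p (- cos x) = (\<Sum>k<n. a k * cos (real k * x))"
    unfolding fin_span_def by blast
  define d :: "nat \<Rightarrow> real" where "d k = (if k = 0 then 1 else 2)" for k
  have d: "0 < d k" for k by (simp add: d_def)
  have "((\<lambda>x. \<Sum>j<n. \<Sum>k<n. (a j * a k) * (cos (real j * x) * cos (real k * x))) has_integral
    (\<Sum>j<n. \<Sum>k<n. (a j * a k) * (if j = k then if j = 0 then pi else pi / 2 else 0))) {0..pi}"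
    by (intro has_integral_sum has_integral_mult_right integral_cos_mult) auto
  moreover have "(\<Sum>j<n. \<Sum>k<n. (a j * a k) * (cos (real j * x) * cos (real k * x))) = (poly p (- cos x))\<^sup>2" for x
    by (simp add: a power2_eq_square sum_product mult_ac)
  moreover have "(\<Sum>j<n. \<Sum>k<n. (a j * a k) * (if j = k then if j = 0 then pi else pi / 2 else 0)) =
    pi * (\<Sum>k<n. (a k)\<^sup>2 / d k)"
    by (simp add: if_distrib[of "\<lambda>c. _ * c"] sum_distrib_left d_def power2_eq_square cong: if_cong)
       (intro sum.cong refl, simp)
  ultimately have int: "integral {0..pi} (\<lambda>x. (poly p (- cos x))\<^sup>2) = pi * (\<Sum>k<n. (a k)\<^sup>2 / d k)"
    by (auto intro: integral_unique)
  have "(poly p (- cos y))\<^sup>2 = (\<Sum>k<n. sqrt (d k) * (a k * cos (real k * y) / sqrt (d k)))\<^sup>2"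
    unfolding a using d by (intro arg_cong[of _ _ "\<lambda>x. x\<^sup>2"] sum.cong refl) (simp add: less_imp_neq[symmetric])
  also have "\<dots> \<le> (\<Sum>k<n. (sqrt (d k))\<^sup>2) * (\<Sum>k<n. (a k * cos (real k * y) / sqrt (d k))\<^sup>2)"
    by (rule Cauchy_Schwarz_ineq_sum)
  also have "\<dots> \<le> (\<Sum>k<n. d k) * (\<Sum>k<n. (a k)\<^sup>2 / d k)"
  proof (intro mult_mono sum_mono)
    fix k
    have "(cos (real k * y))\<^sup>2 \<le> 1" by (simp add: abs_square_le_1)
    then have "(a k)\<^sup>2 * (cos (real k * y))\<^sup>2 \<le> (a k)\<^sup>2 * 1"
      by (intro mult_left_mono) auto
    then show "(a k * cos (real k * y) / sqrt (d k))\<^sup>2 \<le> (a k)\<^sup>2 / d k"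
      using d[of k] by (simp add: power_mult_distrib power_divide divide_right_mono)
  qed (use d in \<open>auto intro!: sum_nonneg simp: less_imp_le\<close>)
  also have "(\<Sum>k<n. d k) = 2 * real n - 1"
  proof -
    obtain n' where "n = Suc n'" using assms by (cases n) auto
    then show ?thesis by (simp add: d_def sum.lessThan_Suc_shift del: sum.lessThan_Suc)
  qed
  finally show ?thesis by (simp add: int mult_ac)
qed

text \<open>This s is the exponent with 2^s = 3, so equality holds at n = 1 and n = 2. From n = 2
  on, write n = 2 (1 + x) and use Bernoulli's inequality; the slope 3 s is at least 4 because 2^4
  \<le> 3^3.\<close>

lemma odd_le_powr_log2_3:
  assumes "1 \<le> n"
  shows "2 * real n - 1 \<le> real n powr (ln 3 / ln 2)"
proof -
  define s :: real where "s = ln 3 / ln 2"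
  have two: "2 powr s = 3" by (simp add: s_def powr_def)
  have s: "4 / 3 \<le> s"
  proof -
    have "ln (2 ^ 4) \<le> ln ((3::real) ^ 3)" by (subst ln_le_cancel_iff) auto
    then have "4 * ln 2 \<le> 3 * ln (3::real)" by (simp add: ln_realpow del: power_numeral)
    then show ?thesis by (simp add: s_def field_simps)
  qed
  show ?thesis
  proof (cases "n = 1")
    case False
    define x where "x = (real n - 2) / 2"
    have x: "0 \<le> x" using False assms by (simp add: x_def)
    have "1 + s * x \<le> (1 + x) powr s"
    proof -
      show ?thesis
      proof (rule deriv_mono_nonneg[OF _ x])
        fix y :: real assume y: "0 \<le> y"
        show "((\<lambda>x. 1 + s * x) has_real_derivative s) (at y)"
          by (auto intro!: derivative_eq_intros)
        show "((\<lambda>x. (1 + x) powr s) has_real_derivative s * (1 + y) powr (s - 1)) (at y)"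
          using y by (auto intro!: derivative_eq_intros)
        show "s \<le> s * (1 + y) powr (s - 1)"
          using s y ge_one_powr_ge_zero[of "1 + y" "s - 1"] by simp
      qed simp
    qed
    then have "3 * (1 + 4 / 3 * x) \<le> 2 powr s * (1 + x) powr s"
      using mult_right_mono[OF s x] by (simp add: two)
    also have "\<dots> = real n powr s"
    proof -
      have "real n = 2 * (1 + x)" by (simp add: x_def field_simps)
      then show ?thesis using x by (simp only: powr_mult)
    qed
    finally show ?thesis by (simp add: s_def x_def field_simps)
  qed simp
qed


section \<open>Normalized weights on [-1, 1]\<close>

lemma weighted_measure:
  fixes w :: "real \<Rightarrow> real"
  defines "c \<equiv> LBINT t:{-1..1}. w t"
  defines "\<beta> \<equiv> density (restrict_space lborel {-1..1}) (\<lambda>t. ennreal (w t / c))"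
  assumes meas [measurable]: "w \<in> borel_measurable borel" and nonneg: "\<And>t. 0 \<le> w t"
    and int: "set_integrable lborel {-1..1} w" and c: "0 < c"
  shows weighted_measure_prob_space: "prob_space \<beta>"
    and weighted_measure_integral:
      "\<And>f :: real \<Rightarrow> real. f \<in> borel_measurable borel \<Longrightarrow> c * (\<integral>t. f t \<partial>\<beta>) = (LBINT t:{-1..1}. w t * f t)"
proof -
  have rm: "f \<in> borel_measurable (restrict_space lborel {-1..1})" if "f \<in> borel_measurable borel" for f :: "real \<Rightarrow> real"
    using that by (intro measurable_restrict_space1) simp
  show "prob_space \<beta>"
  proof (rule prob_spaceI)
    have [measurable]: "(\<lambda>t. ennreal (w t / c)) \<in> borel_measurable (restrict_space lborel {-1..1})"
      by (intro measurable_compose[OF rm measurable_ennreal]) measurable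
    have "emeasure \<beta> (space \<beta>) = (\<integral>\<^sup>+t. ennreal (w t / c) \<partial>restrict_space lborel {-1..1})"
      unfolding \<beta>_def space_density
      by (subst emeasure_density[OF _ sets.top]) (measurable, auto intro!: nn_integral_cong)
    also have "\<dots> = (\<integral>\<^sup>+t. ennreal (indicator {-1..1} t *\<^sub>R w t / c) \<partial>lborel)"
      by (subst nn_integral_restrict_space) (auto intro!: nn_integral_cong simp: indicator_def)
    also have "\<dots> = ennreal (\<integral>t. indicator {-1..1} t *\<^sub>R w t / c \<partial>lborel)"
      using int nonneg c unfolding set_integrable_def
      by (intro nn_integral_eq_integral integrable_divide) auto
    also have "(\<integral>t. indicator {-1..1} t *\<^sub>R w t / c \<partial>lborel) = 1"
      using c by (simp add: c_def set_lebesgue_integral_def)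
    finally show "emeasure \<beta> (space \<beta>) = 1" by simp
  qed
  fix f :: "real \<Rightarrow> real" assume f [measurable]: "f \<in> borel_measurable borel"
  have "(\<integral>t. f t \<partial>\<beta>) = (\<integral>t. w t / c * f t \<partial>restrict_space lborel {-1..1})"
    unfolding \<beta>_def using c nonneg
    by (subst integral_density) (auto intro!: rm)
  also have "\<dots> = (\<integral>t. (indicator {-1..1} t *\<^sub>R (w t * f t)) / c \<partial>lborel)"
    by (subst integral_restrict_space) (auto intro!: Bochner_Integration.integral_cong simp: indicator_def)
  also have "\<dots> = (LBINT t:{-1..1}. w t * f t) / c"
    by (simp add: set_lebesgue_integral_def)
  finally show "c * (\<integral>t. f t \<partial>\<beta>) = (LBINT t:{-1..1}. w t * f t)"
    using c by simp
qed

lemma poly_borel_measurable: "poly (p :: real poly) \<in> borel_measurable borel"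
  by (intro borel_measurable_continuous_onI continuous_on_poly continuous_on_id)

lemma LBINT_poly: "set_integrable lborel {a..b} (poly p)" "(LBINT t:{a..b}. poly p t) = pint a b p"
proof -
  show *: "set_integrable lborel {a..b} (poly p)"
    by (intro borel_integrable_atLeastAtMost' continuous_on_poly continuous_on_id)
  show "(LBINT t:{a..b}. poly p t) = pint a b p"
    unfolding pint_def by (rule set_borel_integral_eq_integral[OF *])
qed

lemma jacobi_weight_nonneg: "0 \<le> jacobi_weight \<theta>1 \<theta>2 t"
  by (simp add: jacobi_weight_def)

lemma jacobi_weight_measurable [measurable]: "jacobi_weight \<theta>1 \<theta>2 \<in> borel_measurable borel"
  unfolding jacobi_weight_def by measurable

text \<open>The endpoints are excluded because for exponent 0 they give \<open>0 powr 0 = 0\<close>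
  but \<open>0 ^ 0 = 1\<close>.\<close>

lemma jacobi_weight_nat:
  "AE t\<in>{-1..1} in lborel. jacobi_weight (real a) (real b) t = poly ([:1, -1:] ^ a * [:1, 1:] ^ b) t"
  using AE_lborel_singleton[of "1::real"] AE_lborel_singleton[of "-1::real"]
proof eventually_elim
  case (elim t)
  show ?case
  proof
    assume "t \<in> {-1..1}"
    with elim have "0 < 1 - t" "0 < 1 + t" by auto
    then show "jacobi_weight (real a) (real b) t = poly ([:1, -1:] ^ a * [:1, 1:] ^ b) t"
      by (simp add: jacobi_weight_def powr_realpow)
  qed
qed

lemma jacobi_measure_nat:
  assumes "-1 \<le> t" and "t \<le> 1" and "degree p < n"
  shows "prob_space (jacobi_measure (real a) (real b))"
    and "(poly p t)\<^sup>2 \<le> real n ^ (2 * max a b + 2) * (\<integral>x. (poly p x)\<^sup>2 \<partial>jacobi_measure (real a) (real b))"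
proof -
  let ?q = "[:1, -1:] ^ a * [:1, 1 :: real:] ^ b" and ?w = "jacobi_weight (real a) (real b)"
  have int: "set_integrable lborel {-1..1} ?w"
    using LBINT_poly(1)[of "-1" 1 ?q] jacobi_weight_nat[of a b]
    by (subst set_integrable_cong_AE[of ?w _ "poly ?q"]) (auto simp: poly_borel_measurable)
  have val: "(LBINT t:{-1..1}. ?w t * poly r t) = pint (-1) 1 (?q * r)" for r
  proof -
    have "(LBINT t:{-1..1}. ?w t * poly r t) = (LBINT t:{-1..1}. poly (?q * r) t)"
      using jacobi_weight_nat[of a b] poly_borel_measurable[of r] poly_borel_measurable[of "?q * r"]
      by (intro set_lebesgue_integral_cong_AE) (auto elim!: eventually_mono)
    then show ?thesis by (simp only: LBINT_poly)
  qed
  have c: "(LBINT t:{-1..1}. ?w t) = pint (-1) 1 ?q"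
    using val[of 1] by simp
  have c0: "0 < (LBINT t:{-1..1}. ?w t)"
  proof -
    have "0 \<le> pint (-1) 1 ?q" by (rule pint_nonneg) simp
    moreover have "pint (-1) 1 ?q \<noteq> 0"
    proof
      assume "pint (-1) 1 ?q = 0"
      then have 0: "integral {-1..1} (poly ?q) = 0" by (simp only: pint_def)
      have cont: "continuous_on {-1..1} (poly ?q)"
        by (intro continuous_on_poly continuous_on_id)
      have "\<forall>x\<in>{-1..1}. poly ?q x = 0"
        by (rule integral_eq_0_iff[THEN iffD1, OF cont _ _ 0]) auto
      then have "poly ?q 0 = 0" by (rule bspec) simp
      then show False by simp
    qed
    ultimately show ?thesis using c by simp
  qed
  note W = weighted_measure[OF jacobi_weight_measurable jacobi_weight_nonneg int c0]
  show "prob_space (jacobi_measure (real a) (real b))"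
    unfolding jacobi_measure_def by (rule W(1))
  have "pint (-1) 1 ?q * (\<integral>x. (poly p x)\<^sup>2 \<partial>jacobi_measure (real a) (real b)) = pint (-1) 1 (?q * (p * p))"
    using W(2)[OF poly_borel_measurable[of "p * p"]] val[of "p * p"] c
    by (simp add: jacobi_measure_def power2_eq_square)
  then have "(poly p t)\<^sup>2 * pint (-1) 1 ?q \<le> real n ^ (2 * max a b + 2) *
      (\<integral>x. (poly p x)\<^sup>2 \<partial>jacobi_measure (real a) (real b)) * pint (-1) 1 ?q"
    using jacobi_christoffel[OF assms, of a b] by (simp add: mult_ac)
  then show "(poly p t)\<^sup>2 \<le> real n ^ (2 * max a b + 2) * (\<integral>x. (poly p x)\<^sup>2 \<partial>jacobi_measure (real a) (real b))"
    using c0 c by simp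
qed

lemma chebyshev_weight_substitution:
  assumes "0 < x" and "x < pi"
  shows "jacobi_weight (-1/2) (-1/2) (- cos x) * sin x = 1"
proof -
  have s: "0 < sin x" using assms by (rule sin_gt_zero)
  have "cos x \<noteq> 1" "cos x \<noteq> - 1"
    using s sin_cos_squared_add[of x] by (auto simp: power2_eq_square)
  then have "- 1 < cos x" "cos x < 1"
    using cos_le_one[of x] cos_ge_minus_one[of x] by (simp_all add: less_le)
  then have pos: "0 < 1 + cos x" "0 < 1 - cos x" by linarith+
  have "jacobi_weight (-1/2) (-1/2) (- cos x) = ((1 + cos x) * (1 - cos x)) powr (-1/2)"
    using pos by (simp add: jacobi_weight_def powr_mult)
  also have "(1 + cos x) * (1 - cos x) = (sin x) powr 2"
    using s by (simp add: algebra_simps sin_squared_eq power2_eq_square[symmetric])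
  also have "((sin x) powr 2) powr (-1/2) = 1 / sin x"
    using s by (simp add: powr_powr powr_minus_divide)
  finally show ?thesis using s by simp
qed

lemma jacobi_measure_chebyshev:
  assumes "-1 \<le> t" and "t \<le> 1" and "degree p < n"
  shows "prob_space (jacobi_measure (-1/2) (-1/2))"
    and "(poly p t)\<^sup>2 \<le> (2 * real n - 1) * (\<integral>x. (poly p x)\<^sup>2 \<partial>jacobi_measure (-1/2) (-1/2))"
proof -
  let ?w = "jacobi_weight (-1/2) (-1/2)" and ?g = "\<lambda>x. - cos x :: real"
  have ae: "AE x in lborel. x \<in> {0..pi} \<longrightarrow> ?w (- cos x) * sin x = 1"
    using AE_lborel_singleton[of "0::real"] AE_lborel_singleton[of "pi"]
  proof eventually_elim
    case (elim x)
    then show ?case using chebyshev_weight_substitution[of x] by auto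
  qed
  have deriv: "(?g has_real_derivative sin x) (at x)" for x
    by (auto intro!: derivative_eq_intros)
  have "(\<integral>\<^sup>+x. ennreal (?w x * indicator {?g 0..?g pi} x) \<partial>lborel) =
      (\<integral>\<^sup>+x. ennreal (?w (?g x) * sin x * indicator {0..pi} x) \<partial>lborel)"
    by (rule nn_integral_substitution) (auto intro!: deriv continuous_intros sin_ge_zero simp: set_borel_measurable_def)
  also have "\<dots> = (\<integral>\<^sup>+x. indicator {0..pi} x \<partial>lborel)"
    using ae by (intro nn_integral_cong_AE)
      (auto elim!: eventually_mono simp: indicator_def)
  also have "\<dots> < \<infinity>" by simp
  finally have fin: "(\<integral>\<^sup>+x. ennreal (?w x * indicator {-1..1} x) \<partial>lborel) < \<infinity>" by simp
  \<comment> \<open>The weight is unbounded at both ends. Its integrability comes from substituting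
    -cos x in the nonnegative integral, where none is presupposed.\<close>
  have int: "set_integrable lborel {-1..1} ?w"
    unfolding set_integrable_def
  proof (rule integrableI_bounded)
    have "(\<integral>\<^sup>+x. ennreal (norm (indicator {-1..1} x *\<^sub>R ?w x)) \<partial>lborel) =
      (\<integral>\<^sup>+x. ennreal (?w x * indicator {-1..1} x) \<partial>lborel)"
      by (intro nn_integral_cong) (auto simp: indicator_def jacobi_weight_nonneg)
    then show "(\<integral>\<^sup>+x. ennreal (norm (indicator {-1..1} x *\<^sub>R ?w x)) \<partial>lborel) < \<infinity>"
      using fin by simp
  qed measurable
  have val: "(LBINT x:{-1..1}. ?w x * poly q x) = integral {0..pi} (\<lambda>x. poly q (- cos x))" for q
  proof -
    have "compact (poly q ` {-1..1})"
      by (intro compact_continuous_image continuous_on_poly continuous_on_id) simp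
    then have "bounded (poly q ` {-1..1})" by (rule compact_imp_bounded)
    then obtain B where "\<forall>y\<in>poly q ` {-1..1}. norm y \<le> B" unfolding bounded_iff by blast
    then have B: "\<And>x. x \<in> {-1..1} \<Longrightarrow> \<bar>poly q x\<bar> \<le> B" by simp
    \<comment> \<open>The signed substitution below presupposes integrability, which follows from
      the boundedness of q on [-1, 1].\<close>
    have "set_integrable lborel {-1..1} (\<lambda>x. ?w x * poly q x)"
    proof (rule set_integrable_bound)
      show "set_integrable lborel {-1..1} (\<lambda>x. B * ?w x)"
        using int by simp
      show "set_borel_measurable lborel {-1..1} (\<lambda>x. ?w x * poly q x)"
        unfolding set_borel_measurable_def using poly_borel_measurable[of q] by measurable
      have "\<bar>?w x * poly q x\<bar> \<le> \<bar>B * ?w x\<bar>" if "x \<in> {-1..1}" for x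
        using mult_left_mono[OF order_trans[OF B[OF that] abs_ge_self] jacobi_weight_nonneg[of "-1/2" "-1/2" x]]
        by (simp add: abs_mult jacobi_weight_nonneg mult.commute)
      then show "AE x in lborel. x \<in> {-1..1} \<longrightarrow> norm (?w x * poly q x) \<le> norm (B * ?w x)"
        by auto
    qed
    then have si: "set_integrable lborel {?g 0..?g pi} (\<lambda>x. ?w x * poly q x)" by simp
    have "(LBINT x:{-1..1}. ?w x * poly q x) = (LBINT x. (?w x * poly q x) * indicator {?g 0..?g pi} x)"
      by (simp add: set_lebesgue_integral_def mult.commute)
    also have "\<dots> = (LBINT x. (?w (?g x) * poly q (?g x)) * sin x * indicator {0..pi} x)"
      using si by (rule integral_substitution(2)[where g = ?g and a = 0 and b = pi]) (auto intro!: deriv continuous_intros sin_ge_zero)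
    also have "\<dots> = (LBINT x:{0..pi}. poly q (?g x))"
      unfolding set_lebesgue_integral_def
    proof (rule integral_cong_AE)
      show "AE x in lborel. (?w (?g x) * poly q (?g x)) * sin x * indicator {0..pi} x =
        indicator {0..pi} x *\<^sub>R poly q (?g x)"
        using ae
      proof eventually_elim
        case (elim x)
        then show ?case by (auto simp: indicator_def mult_ac)
      qed
    qed (use poly_borel_measurable[of q] in measurable)
    also have "\<dots> = integral {0..pi} (\<lambda>x. poly q (- cos x))"
      by (intro set_borel_integral_eq_integral borel_integrable_atLeastAtMost' continuous_intros)
    finally show ?thesis .
  qed
  have c: "(LBINT t:{-1..1}. ?w t) = pi"
    using val[of 1] by simp
  have c0: "0 < (LBINT t:{-1..1}. ?w t)"
    unfolding c by simp
  note W = weighted_measure[OF jacobi_weight_measurable jacobi_weight_nonneg int c0]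
  show "prob_space (jacobi_measure (-1/2) (-1/2))"
    unfolding jacobi_measure_def by (rule W(1))
  have int_eq: "pi * (\<integral>x. (poly p x)\<^sup>2 \<partial>jacobi_measure (-1/2) (-1/2)) = integral {0..pi} (\<lambda>x. (poly p (- cos x))\<^sup>2)"
    using W(2)[OF poly_borel_measurable[of "p * p"]] val[of "p * p"]
    unfolding jacobi_measure_def c by (simp add: power2_eq_square)
  have "pi * (poly p t)\<^sup>2 \<le> (2 * real n - 1) * integral {0..pi} (\<lambda>x. (poly p (- cos x))\<^sup>2)"
    using chebyshev_christoffel_cos[OF assms(3), of "arccos (- t)"] assms(1,2) by simp
  then have "pi * (poly p t)\<^sup>2 \<le> pi * ((2 * real n - 1) * (\<integral>x. (poly p x)\<^sup>2 \<partial>jacobi_measure (-1/2) (-1/2)))"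
    unfolding int_eq[symmetric] by (simp only: mult.left_commute)
  then show "(poly p t)\<^sup>2 \<le> (2 * real n - 1) * (\<integral>x. (poly p x)\<^sup>2 \<partial>jacobi_measure (-1/2) (-1/2))"
    by simp
qed

lemma jacobi_measure_christoffel:
  assumes "\<theta>1 = -1/2 \<and> \<theta>2 = -1/2 \<and> s = ln 3 / ln 2 \<or>
           \<theta>1 \<in> \<nat> \<and> \<theta>2 \<in> \<nat> \<and> s = 2 * max \<theta>1 \<theta>2 + 2"
  shows "prob_space (jacobi_measure \<theta>1 \<theta>2)"
    and "\<And>t p n. t \<in> {-1..1} \<Longrightarrow> degree p < n \<Longrightarrow>
      (poly p t)\<^sup>2 \<le> real n powr s * (\<integral>x. (poly p x)\<^sup>2 \<partial>jacobi_measure \<theta>1 \<theta>2)"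
  using assms
proof (atomize (full), elim disjE conjE)
  assume *: "\<theta>1 = -1/2" "\<theta>2 = -1/2" "s = ln 3 / ln 2"
  have "(poly p t)\<^sup>2 \<le> real n powr s * (\<integral>x. (poly p x)\<^sup>2 \<partial>jacobi_measure \<theta>1 \<theta>2)"
    if "t \<in> {-1..1}" "degree p < n" for t p n
  proof -
    have "(poly p t)\<^sup>2 \<le> (2 * real n - 1) * (\<integral>x. (poly p x)\<^sup>2 \<partial>jacobi_measure \<theta>1 \<theta>2)"
      using jacobi_measure_chebyshev(2) that * by simp
    also have "\<dots> \<le> real n powr s * (\<integral>x. (poly p x)\<^sup>2 \<partial>jacobi_measure \<theta>1 \<theta>2)"
      using odd_le_powr_log2_3[of n] that * by (intro mult_right_mono) auto
    finally show ?thesis .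
  qed
  then show "prob_space (jacobi_measure \<theta>1 \<theta>2) \<and> (\<forall>t p n. t \<in> {-1..1} \<longrightarrow> degree p < n \<longrightarrow>
      (poly p t)\<^sup>2 \<le> real n powr s * (\<integral>x. (poly p x)\<^sup>2 \<partial>jacobi_measure \<theta>1 \<theta>2))"
    using jacobi_measure_chebyshev(1)[of 0 0 1] * by simp
next
  assume *: "\<theta>1 \<in> \<nat>" "\<theta>2 \<in> \<nat>" "s = 2 * max \<theta>1 \<theta>2 + 2"
  then obtain a b where ab: "\<theta>1 = real a" "\<theta>2 = real b" by (auto elim!: Nats_cases)
  have s: "s = real (2 * max a b + 2)" using * ab by simp
  have "real n powr s = real n ^ (2 * max a b + 2)" if "0 < n" for n
    unfolding s using that by (intro powr_realpow) simp
  then show "prob_space (jacobi_measure \<theta>1 \<theta>2) \<and> (\<forall>t p n. t \<in> {-1..1} \<longrightarrow> degree p < n \<longrightarrow>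
      (poly p t)\<^sup>2 \<le> real n powr s * (\<integral>x. (poly p x)\<^sup>2 \<partial>jacobi_measure \<theta>1 \<theta>2))"
    using jacobi_measure_nat(1)[of 0 0 1 a b] jacobi_measure_nat(2)[of _ _ _ a b] ab by auto
qed

section \<open>Downward closed sets\<close>

text \<open>Convexity of x^s, by comparing derivatives in a. For y = 0 the derivative at base 0 is
  avoided: the claim is then superadditivity, which follows from z^s = z * z^(s-1).\<close>

lemma powr_increment_mono:
  fixes x y a s :: real
  assumes "1 \<le> s" and "0 \<le> y" and "y \<le> x" and "0 \<le> a"
  shows "(y + a) powr s - y powr s \<le> (x + a) powr s - x powr s"
proof (cases "y = 0")
  case True
  have split: "z powr s = z * z powr (s - 1)" if "0 \<le> z" for z :: real
    using that powr_mult_base[of z "s - 1"] by simp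
  have "x * x powr (s - 1) + a * a powr (s - 1) \<le> x * (x + a) powr (s - 1) + a * (x + a) powr (s - 1)"
    using assms by (intro add_mono mult_left_mono powr_mono2) auto
  then show ?thesis
    using True assms split[of x] split[of a] split[of "x + a"] by (simp add: distrib_right)
next
  case False
  show ?thesis
  proof (rule deriv_mono_nonneg[OF _ assms(4)])
    fix b :: real assume b: "0 \<le> b"
    show "((\<lambda>a. (y + a) powr s - y powr s) has_real_derivative s * (y + b) powr (s - 1)) (at b)"
      using b False assms by (auto intro!: derivative_eq_intros)
    show "((\<lambda>a. (x + a) powr s - x powr s) has_real_derivative s * (x + b) powr (s - 1)) (at b)"
      using b False assms by (auto intro!: derivative_eq_intros)
    show "s * (y + b) powr (s - 1) \<le> s * (x + b) powr (s - 1)"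
      using b assms by (intro mult_left_mono powr_mono2) auto
  qed simp
qed

text \<open>Summation by parts as an induction: since the partial sums are nonnegative, replacing x
  n by the smaller x (n+1) only lowers the boundary term.\<close>

lemma abel_nonneg:
  fixes g x :: "nat \<Rightarrow> real"
  assumes "\<And>n. 0 \<le> (\<Sum>k<n. g k)" and "\<And>k. x (Suc k) \<le> x k"
  shows "(\<Sum>k<n. g k) * x n \<le> (\<Sum>k<n. g k * x k)"
proof (induction n)
  case (Suc n)
  have "(\<Sum>k<Suc n. g k) * x (Suc n) \<le> (\<Sum>k<Suc n. g k) * x n"
    by (intro mult_left_mono assms)
  also have "\<dots> \<le> (\<Sum>k<Suc n. g k * x k)"
    using Suc by (simp add: distrib_right)
  finally show ?case .
qed simp

text \<open>By summation by parts the worst case is \<open>b\<^sub>k = (k + 1)\<^sup>s - k\<^sup>s\<close>, where the inequality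
  follows from the convexity of \<open>x\<^sup>s\<close>.\<close>

lemma weighted_sum_powr_le:
  fixes a b :: "nat \<Rightarrow> real"
  assumes s: "1 \<le> s" and b: "\<And>n. (\<Sum>k<n. b k) \<le> real n powr s"
    and a: "\<And>k. 0 \<le> a k" "\<And>k. a (Suc k) \<le> a k"
  shows "(\<Sum>k<n. b k * a k powr s) \<le> (\<Sum>k<n. a k) powr s"
proof -
  define f where "f = (\<lambda>k. real (Suc k) powr s - real k powr s)"
  have f: "(\<Sum>k<n. f k) = real n powr s" for n
    unfolding f_def using s by (induction n) auto
  have "0 \<le> (\<Sum>k<n. f k - b k) * a n powr s"
    using b[of n] by (simp add: sum_subtractf f)
  also have "\<dots> \<le> (\<Sum>k<n. (f k - b k) * a k powr s)"
    using b s a by (intro abel_nonneg powr_mono2) (auto simp: sum_subtractf f)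
  finally have "(\<Sum>k<n. b k * a k powr s) \<le> (\<Sum>k<n. f k * a k powr s)"
    by (simp add: left_diff_distrib sum_subtractf)
  also have "\<dots> \<le> (\<Sum>k<n. a k) powr s"
  proof (induction n)
    case (Suc n)
    let ?S = "\<Sum>k<n. a k"
    have anti: "a n \<le> a k" if "k < n" for k
      using that a(2) by (metis lift_Suc_antimono_le less_imp_le)
    \<comment> \<open>The earlier terms are all at least a n. Hence the increment of x^s by a n
      starts further left at n * a n than at the sum, and convexity compares the two.\<close>
    have "real n * a n \<le> ?S"
      using sum_mono[of "{..<n}" "\<lambda>_. a n" a] anti by simp
    have "f n * a n powr s = (real n * a n + a n) powr s - (real n * a n) powr s"
    proof -
      have "(real n * a n + a n) powr s = real (Suc n) powr s * a n powr s"
        using a(1)[of n] powr_mult[of "real (Suc n)" "a n" s] by (simp add: distrib_right add.commute)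
      then show ?thesis
        using a(1)[of n] powr_mult[of "real n" "a n" s] by (simp add: f_def left_diff_distrib)
    qed
    also have "\<dots> \<le> (?S + a n) powr s - ?S powr s"
      using \<open>real n * a n \<le> ?S\<close> a(1)[of n] by (intro powr_increment_mono s) auto
    finally show ?case using Suc by simp
  qed (use s in simp)
  finally show ?thesis .
qed

lemma downward_closedD: "downward_closed \<Lambda> \<Longrightarrow> \<nu> \<in> \<Lambda> \<Longrightarrow> \<mu> \<le> \<nu> \<Longrightarrow> \<mu> \<in> \<Lambda>"
  by (auto simp: downward_closed_def)

lemma zero_in_downward_closed: "downward_closed \<Lambda> \<Longrightarrow> \<Lambda> \<noteq> {} \<Longrightarrow> (\<lambda>_. 0) \<in> \<Lambda>"
  by (auto simp: downward_closed_def le_fun_def)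

text \<open>The slices of \<Lambda> along coordinate q are again downward closed, and they decrease
  as k grows. The induction hypothesis bounds slice k by its cardinality to the power s, and
  \<open>weighted_sum_powr_le\<close> adds the slices up with weights \<open>c q k\<close>.\<close>

lemma downward_closed_sum_prod_le:
  fixes c :: "nat \<Rightarrow> nat \<Rightarrow> real"
  assumes s: "1 \<le> s" and nonneg: "\<And>j k. 0 \<le> c j k"
    and partial_sums: "\<And>j n. (\<Sum>k<n. c j k) \<le> real n powr s"
    and "finite \<Lambda>" and "downward_closed \<Lambda>" and "\<And>\<mu> j. \<mu> \<in> \<Lambda> \<Longrightarrow> q \<le> j \<Longrightarrow> \<mu> j = 0"
  shows "(\<Sum>\<mu>\<in>\<Lambda>. \<Prod>j<q. c j (\<mu> j)) \<le> real (card \<Lambda>) powr s"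
  using assms(4-)
proof (induction q arbitrary: \<Lambda>)
  case 0
  then have "\<mu> = (\<lambda>_. 0)" if "\<mu> \<in> \<Lambda>" for \<mu>
    using that by auto
  then have "\<Lambda> \<subseteq> {\<lambda>_. 0}" by blast
  then have "card \<Lambda> \<le> 1"
    using card_mono[of "{\<lambda>_. 0}" \<Lambda>] by simp
  then have "card \<Lambda> = 0 \<or> card \<Lambda> = 1" by linarith
  then show ?case by auto
next
  case (Suc q)
  \<comment> \<open>Slices are stored with coordinate q reset to 0, so that their indices vanish
    from q on, as the induction hypothesis asks.\<close>
  define S where "S k = {\<mu>. \<mu> q = 0 \<and> \<mu>(q := k) \<in> \<Lambda>}" for k
  \<comment> \<open>A strict bound for coordinate q on \<Lambda>; inserting 0 keeps the maximum
    meaningful for empty \<Lambda>.\<close>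
  define M where "M = Suc (Max (insert 0 ((\<lambda>\<mu>. \<mu> q) ` \<Lambda>)))"
  have M: "\<mu> q < M" if "\<mu> \<in> \<Lambda>" for \<mu>
    using that Suc.prems(1) by (simp add: M_def less_Suc_eq_le)
  have fin: "finite (S k)" for k
  proof (rule inj_on_finite[of "\<lambda>\<mu>. \<mu>(q := k)" _ \<Lambda>])
    show "inj_on (\<lambda>\<mu>. \<mu>(q := k)) (S k)"
    proof (rule inj_onI)
      fix \<mu> \<nu> assume *: "\<mu> \<in> S k" "\<nu> \<in> S k" "\<mu>(q := k) = \<nu>(q := k)"
      have "\<mu> = (\<mu>(q := k))(q := 0)" using *(1) by (simp add: S_def fun_upd_idem)
      also have "\<dots> = (\<nu>(q := k))(q := 0)" by (simp only: *(3))
      also have "\<dots> = \<nu>" using *(2) by (simp add: S_def fun_upd_idem)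
      finally show "\<mu> = \<nu>" .
    qed
  qed (use Suc.prems(1) in \<open>auto simp: S_def\<close>)
  have dc: "downward_closed (S k)" for k
    unfolding downward_closed_def
  proof (intro ballI allI impI)
    fix \<nu> \<mu> assume *: "\<nu> \<in> S k" "\<mu> \<le> \<nu>"
    then have "\<mu> q = 0" using le_funD[OF *(2), of q] by (simp add: S_def)
    with * show "\<mu> \<in> S k"
      using downward_closedD[OF Suc.prems(2), of "\<nu>(q := k)" "\<mu>(q := k)"] by (auto simp: S_def le_fun_def)
  qed
  have supp: "\<mu> j = 0" if "\<mu> \<in> S k" "q \<le> j" for \<mu> j k
  proof (cases "j = q")
    case False
    have "\<mu>(q := k) \<in> \<Lambda>" using that by (simp add: S_def)
    from Suc.prems(3)[OF this, of j] have "(\<mu>(q := k)) j = 0"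
      using that False by simp
    then show ?thesis using False by simp
  qed (use that in \<open>simp add: S_def\<close>)
  have split: "(\<Sum>\<mu>\<in>\<Lambda>. F (\<mu> q) (\<mu>(q := 0))) = (\<Sum>k<M. \<Sum>\<mu>\<in>S k. F k \<mu>)" for F :: "nat \<Rightarrow> (nat \<Rightarrow> nat) \<Rightarrow> real"
  proof -
    have "(\<Sum>k<M. \<Sum>\<mu>\<in>S k. F k \<mu>) = (\<Sum>(k, \<mu>)\<in>Sigma {..<M} S. F k \<mu>)"
      by (rule sum.Sigma) (auto simp: fin)
    also have "\<dots> = (\<Sum>\<mu>\<in>\<Lambda>. F (\<mu> q) (\<mu>(q := 0)))"
      by (rule sum.reindex_bij_witness[of _ "\<lambda>\<mu>. (\<mu> q, \<mu>(q := 0))" "\<lambda>(k, \<mu>). \<mu>(q := k)"])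
         (auto simp: S_def M fun_upd_idem)
    finally show ?thesis ..
  qed
  have "(\<Sum>\<mu>\<in>\<Lambda>. \<Prod>j<Suc q. c j (\<mu> j)) = (\<Sum>\<mu>\<in>\<Lambda>. c q (\<mu> q) * (\<Prod>j<q. c j ((\<mu>(q := 0)) j)))"
    by (intro sum.cong refl) (simp add: mult.commute)
  also have "\<dots> = (\<Sum>k<M. \<Sum>\<mu>\<in>S k. c q k * (\<Prod>j<q. c j (\<mu> j)))"
    by (rule split)
  also have "\<dots> = (\<Sum>k<M. c q k * (\<Sum>\<mu>\<in>S k. \<Prod>j<q. c j (\<mu> j)))"
    by (simp add: sum_distrib_left)
  also have "\<dots> \<le> (\<Sum>k<M. c q k * real (card (S k)) powr s)"
    by (intro sum_mono mult_left_mono Suc.IH fin dc supp nonneg)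
  also have "\<dots> \<le> (\<Sum>k<M. real (card (S k))) powr s"
  proof (rule weighted_sum_powr_le[OF s partial_sums])
    fix k
    have "S (Suc k) \<subseteq> S k"
    proof
      fix \<mu> assume "\<mu> \<in> S (Suc k)"
      then show "\<mu> \<in> S k"
        using downward_closedD[OF Suc.prems(2), of "\<mu>(q := Suc k)" "\<mu>(q := k)"] by (auto simp: S_def le_fun_def)
    qed
    then show "real (card (S (Suc k))) \<le> real (card (S k))"
      by (simp add: card_mono fin)
  qed simp
  also have "(\<Sum>k<M. real (card (S k))) = real (card \<Lambda>)"
    using split[of "\<lambda>_ _. 1"] by simp
  finally show ?case .
qed

section \<open>Hyperbolic crosses and the number of lower sets\<close>

lemma coords_enat [simp]: "coords (enat q) = {..<q}"
  by (auto simp: coords_def)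

lemma multi_indices_enat: "\<mu> \<in> multi_indices (enat q) \<longleftrightarrow> (\<forall>j\<ge>q. \<mu> j = 0)"
proof
  assume R: "\<forall>j\<ge>q. \<mu> j = 0"
  have "{j. \<mu> j \<noteq> 0} \<subseteq> {..<q}"
  proof
    fix j assume "j \<in> {j. \<mu> j \<noteq> 0}"
    then show "j \<in> {..<q}" using R by (cases "q \<le> j") auto
  qed
  then show "\<mu> \<in> multi_indices (enat q)"
    unfolding multi_indices_def by (auto intro: finite_subset)
next
  assume "\<mu> \<in> multi_indices (enat q)"
  then have "{j. \<mu> j \<noteq> 0} \<subseteq> {..<q}" by (simp add: multi_indices_def)
  then show "\<forall>j\<ge>q. \<mu> j = 0" by fastforce
qed

text \<open>The product counts the box of all indices below \<mu> in the first q coordinates, and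
  downward closedness puts this box into \<Lambda>. So every lower set with at most n elements lies
  in the hyperbolic cross.\<close>

lemma box_card_le:
  assumes "finite \<Lambda>" and "downward_closed \<Lambda>" and "\<mu> \<in> \<Lambda>"
  shows "(\<Prod>j<q. \<mu> j + 1) \<le> card \<Lambda>"
proof -
  let ?g = "\<lambda>g j. if j < q then g j else 0"
  have "(\<Prod>j<q. \<mu> j + 1) = card (PiE {..<q} (\<lambda>j. {..\<mu> j}))"
    by (simp add: card_PiE)
  also have "\<dots> \<le> card \<Lambda>"
  proof (rule card_inj_on_le[of ?g])
    show "inj_on ?g (PiE {..<q} (\<lambda>j. {..\<mu> j}))"
    proof (rule inj_onI)
      fix f g assume fg: "f \<in> PiE {..<q} (\<lambda>j. {..\<mu> j})" "g \<in> PiE {..<q} (\<lambda>j. {..\<mu> j})" "?g f = ?g g"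
      show "f = g"
        by (rule PiE_ext[OF fg(1,2)]) (use fun_cong[OF fg(3)] in \<open>metis lessThan_iff\<close>)
    qed
    show "?g ` PiE {..<q} (\<lambda>j. {..\<mu> j}) \<subseteq> \<Lambda>"
      using downward_closedD[OF assms(2,3)] by (force simp: le_fun_def PiE_def Pi_def)
  qed (rule assms)
  finally show ?thesis .
qed

lemma finite_hyperbolic_cross: "finite (hyperbolic_cross n q)"
proof (rule finite_subset)
  show "hyperbolic_cross n q \<subseteq> {f. \<forall>j. (j \<in> {..<q} \<longrightarrow> f j \<in> {..n}) \<and> (j \<notin> {..<q} \<longrightarrow> f j = 0)}"
  proof
    fix \<mu> assume \<mu>: "\<mu> \<in> hyperbolic_cross n q"
    have "\<mu> j \<le> n" if "j < q" for j
    proof -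
      have "\<mu> j + 1 \<le> (\<Prod>j<q. \<mu> j + 1)"
        using that by (intro dvd_imp_le dvd_prodI) (auto intro!: prod_pos)
      then show ?thesis using \<mu> by (simp add: hyperbolic_cross_def)
    qed
    then show "\<mu> \<in> {f. \<forall>j. (j \<in> {..<q} \<longrightarrow> f j \<in> {..n}) \<and> (j \<notin> {..<q} \<longrightarrow> f j = 0)}"
      using \<mu> by (auto simp: hyperbolic_cross_def multi_indices_enat)
  qed
qed (rule finite_set_of_finite_funs, simp_all)

lemma downward_closed_hyperbolic_cross: "downward_closed (hyperbolic_cross n q)"
  unfolding downward_closed_def
proof (intro ballI allI impI)
  fix \<nu> \<mu> assume \<nu>: "\<nu> \<in> hyperbolic_cross n q" and le: "\<mu> \<le> \<nu>"
  have "(\<Prod>j<q. \<mu> j + 1) \<le> (\<Prod>j<q. \<nu> j + 1)"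
    using le by (intro prod_mono) (auto simp: le_fun_def)
  moreover have "\<mu> j = 0" if "q \<le> j" for j
    using \<nu> le that by (auto simp: hyperbolic_cross_def multi_indices_enat le_fun_def) (metis le_zero_eq)
  ultimately show "\<mu> \<in> hyperbolic_cross n q"
    using \<nu> by (auto simp: hyperbolic_cross_def multi_indices_enat)
qed

lemma zero_in_hyperbolic_cross: "1 \<le> n \<Longrightarrow> (\<lambda>_. 0) \<in> hyperbolic_cross n q"
  by (simp add: hyperbolic_cross_def multi_indices_enat)

text \<open>Cardinality at most n, because the union of two competitors may be smaller than 2 n - 1;
  nonempty, so that the zero index is a member.\<close>

definition lower_sets :: "enat \<Rightarrow> nat \<Rightarrow> (nat \<Rightarrow> nat) set set" where
  "lower_sets d n = {\<Lambda>. \<Lambda> \<subseteq> multi_indices d \<and> downward_closed \<Lambda> \<and> finite \<Lambda> \<and> \<Lambda> \<noteq> {} \<and> card \<Lambda> \<le> n}"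

lemma lower_sets_hyperbolic_cross: "\<Lambda> \<in> lower_sets (enat q) n \<Longrightarrow> \<Lambda> \<subseteq> hyperbolic_cross n q"
  using box_card_le[of \<Lambda> _ q] unfolding lower_sets_def hyperbolic_cross_def by fastforce

lemma finite_lower_sets: "finite (lower_sets (enat q) n)"
  by (rule finite_subset[of _ "Pow (hyperbolic_cross n q)"])
     (use lower_sets_hyperbolic_cross in \<open>auto simp: finite_hyperbolic_cross\<close>)

definition increment :: "(nat \<Rightarrow> nat) \<Rightarrow> nat \<Rightarrow> nat \<Rightarrow> nat" where
  "increment \<nu> j = \<nu>(j := Suc (\<nu> j))"

lemma increment_decompose:
  assumes "\<mu> \<in> multi_indices (enat q)" and "\<mu> \<noteq> (\<lambda>_. 0)"
  obtains \<nu> j where "\<mu> = increment \<nu> j" and "j < q" and "\<nu> \<le> \<mu>"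
proof -
  obtain j where j: "\<mu> j \<noteq> 0" using assms(2) by auto
  have "j < q" using assms(1) j by (cases "q \<le> j") (auto simp: multi_indices_enat)
  moreover have "\<mu> = increment (\<mu>(j := \<mu> j - 1)) j"
    using j by (auto simp: increment_def)
  moreover have "\<mu>(j := \<mu> j - 1) \<le> \<mu>" by (auto simp: le_fun_def)
  ultimately show ?thesis using that by blast
qed

text \<open>Every index of \<Lambda> is reached from 0 by unit increments that stay in \<Lambda>;
  induction on the coordinate sum.\<close>

lemma lower_set_connected:
  assumes "\<Lambda> \<subseteq> multi_indices (enat q)" and "downward_closed \<Lambda>" and "(\<lambda>_. 0) \<in> S"
    and step: "\<And>\<nu> j. \<nu> \<in> S \<Longrightarrow> j < q \<Longrightarrow> increment \<nu> j \<in> \<Lambda> \<Longrightarrow> increment \<nu> j \<in> S"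
  shows "\<Lambda> \<subseteq> S"
proof
  fix \<mu> assume "\<mu> \<in> \<Lambda>"
  then show "\<mu> \<in> S"
  proof (induction "\<Sum>j<q. \<mu> j" arbitrary: \<mu> rule: less_induct)
    case less
    show ?case
    proof (cases "\<mu> = (\<lambda>_. 0)")
      case False
      then obtain \<nu> j where \<nu>: "\<mu> = increment \<nu> j" "j < q" "\<nu> \<le> \<mu>"
        using increment_decompose less.prems assms(1) by blast
      have "(\<Sum>j<q. \<nu> j) < (\<Sum>j<q. \<mu> j)"
        using \<nu> by (intro sum_strict_mono_ex1) (auto simp: increment_def le_fun_def)
      moreover have "\<nu> \<in> \<Lambda>" using downward_closedD[OF assms(2) less.prems \<nu>(3)] .
      ultimately have "\<nu> \<in> S" by (rule less.hyps)
      then show ?thesis using step[of \<nu> j] \<nu> less.prems by simp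
    qed (use assms(3) in simp)
  qed
qed

text \<open>A lower set is explored from \<open>0\<close>: when the element \<open>\<nu>\<close> of the explored part \<open>S\<close> is
  processed, at most \<open>2\<^sup>q\<close> choices determine which neighbours \<open>\<nu> + e\<^sub>j\<close> belong to the set.\<close>

definition explored :: "nat \<Rightarrow> nat \<Rightarrow> (nat \<Rightarrow> nat) set \<Rightarrow> (nat \<Rightarrow> nat) set \<Rightarrow> (nat \<Rightarrow> nat) set set" where
  "explored q n S P = {\<Lambda> \<in> lower_sets (enat q) n. S \<subseteq> \<Lambda> \<and>
    (\<forall>\<nu>\<in>P. \<forall>j<q. increment \<nu> j \<in> \<Lambda> \<longrightarrow> increment \<nu> j \<in> S)}"

text \<open>Once all of S is processed, no increment leads from S to a further element of \<Lambda>,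
  so connectedness forces \<Lambda> = S.\<close>

lemma explored_complete:
  assumes "(\<lambda>_. 0) \<in> S"
  shows "card (explored q n S S) \<le> 1"
proof -
  have "explored q n S S \<subseteq> {S}"
  proof
    fix \<Lambda> assume "\<Lambda> \<in> explored q n S S"
    then have *: "\<Lambda> \<in> lower_sets (enat q) n" "S \<subseteq> \<Lambda>"
      and step: "\<forall>\<nu>\<in>S. \<forall>j<q. increment \<nu> j \<in> \<Lambda> \<longrightarrow> increment \<nu> j \<in> S"
      unfolding explored_def by blast+
    have "\<Lambda> \<subseteq> S"
      by (rule lower_set_connected[OF _ _ assms]) (use * step in \<open>auto simp: lower_sets_def\<close>)
    with *(2) show "\<Lambda> \<in> {S}" by simp
  qed
  then show ?thesis using card_mono[of "{S}"] by fastforce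
qed

text \<open>Here r counts the elements that may still be processed. Processing \<nu> branches over
  the set T of directions in which \<Lambda> continues, which costs a factor 2^q. At r = 0 an
  unprocessed element of S would give \<Lambda> more than n elements.\<close>

lemma card_lower_sets_explore:
  assumes "finite P" and "P \<subseteq> S" and "(\<lambda>_. 0) \<in> S" and "card P + r = n"
  shows "card (explored q n S P) \<le> 2 ^ (q * r)"
  using assms
proof (induction r arbitrary: S P)
  case 0
  show ?case
  proof (cases "P = S")
    case False
    then obtain \<nu> where \<nu>: "\<nu> \<in> S" "\<nu> \<notin> P" using 0 by blast
    have False if "\<Lambda> \<in> lower_sets (enat q) n" "S \<subseteq> \<Lambda>" for \<Lambda>
    proof -
      have "card (insert \<nu> P) \<le> card \<Lambda>"
        using that \<nu> 0 by (intro card_mono) (auto simp: lower_sets_def)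
      then show False using that \<nu> 0 by (simp add: lower_sets_def)
    qed
    then have "explored q n S P = {}" unfolding explored_def by blast
    then show ?thesis by simp
  qed (use explored_complete 0 in simp)
next
  case (Suc r)
  show ?case
  proof (cases "P = S")
    case True
    then have "card (explored q n S P) \<le> 1" using explored_complete Suc.prems by simp
    also have "1 \<le> (2::nat) ^ (q * Suc r)" by simp
    finally show ?thesis .
  next
    case False
    then obtain \<nu> where \<nu>: "\<nu> \<in> S" "\<nu> \<notin> P" using Suc.prems by blast
    let ?X = "\<lambda>T. explored q n (S \<union> increment \<nu> ` T) (insert \<nu> P)"
    have "explored q n S P \<subseteq> (\<Union>T\<in>Pow {..<q}. ?X T)"
    proof
      fix \<Lambda> assume \<Lambda>: "\<Lambda> \<in> explored q n S P"
      let ?T = "{j. j < q \<and> increment \<nu> j \<in> \<Lambda>}"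
      have "\<Lambda> \<in> ?X ?T" using \<Lambda> unfolding explored_def by blast
      then show "\<Lambda> \<in> (\<Union>T\<in>Pow {..<q}. ?X T)"
        by (intro UN_I[of ?T]) auto
    qed
    then have "card (explored q n S P) \<le> card (\<Union>T\<in>Pow {..<q}. ?X T)"
      by (rule card_mono[rotated]) (auto simp: finite_lower_sets explored_def)
    also have "\<dots> \<le> (\<Sum>T\<in>Pow {..<q}. card (?X T))"
      by (rule card_UN_le) simp
    also have "\<dots> \<le> (\<Sum>T\<in>Pow {..<q}. 2 ^ (q * r))"
      using Suc.prems \<nu> by (intro sum_mono Suc.IH) auto
    also have "\<dots> = 2 ^ (q * Suc r)"
      by (simp add: card_Pow power_add)
    finally show ?thesis .
  qed
qed

lemma card_lower_sets_le_power2: "card (lower_sets (enat q) n) \<le> 2 ^ (q * n)"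
proof -
  have "lower_sets (enat q) n = explored q n {\<lambda>_. 0} {}"
    by (auto simp: explored_def lower_sets_def intro: zero_in_downward_closed)
  then show ?thesis
    using card_lower_sets_explore[of "{}" "{\<lambda>_. 0}" n n q] by simp
qed

text \<open>An element \<mu> of maximal coordinate sum has nothing of \<Lambda> above it, so
  removing it leaves a lower set, and \<mu> is an increment of one of the remaining elements. The
  extra \<open>insert\<close> covers sets that already have at most n elements.\<close>

lemma lower_sets_Suc:
  assumes "1 \<le> n"
  shows "lower_sets (enat q) (Suc n) \<subseteq> (\<Union>\<Lambda>\<in>lower_sets (enat q) n. insert \<Lambda> ((\<lambda>(\<nu>, j). insert (increment \<nu> j) \<Lambda>) ` (\<Lambda> \<times> {..<q})))"
proof
  fix \<Lambda> assume \<Lambda>: "\<Lambda> \<in> lower_sets (enat q) (Suc n)"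
  show "\<Lambda> \<in> (\<Union>\<Lambda>\<in>lower_sets (enat q) n. insert \<Lambda> ((\<lambda>(\<nu>, j). insert (increment \<nu> j) \<Lambda>) ` (\<Lambda> \<times> {..<q})))"
  proof (cases "card \<Lambda> \<le> n")
    case True
    then show ?thesis using \<Lambda> by (intro UN_I[of \<Lambda>]) (auto simp: lower_sets_def)
  next
    case False
    have fin: "finite \<Lambda>" and ne: "\<Lambda> \<noteq> {}" and dc: "downward_closed \<Lambda>" and card: "card \<Lambda> = Suc n"
      and sub: "\<Lambda> \<subseteq> multi_indices (enat q)"
      using \<Lambda> False by (auto simp: lower_sets_def)
    define h where "h \<mu> = (\<Sum>j<q. \<mu> j)" for \<mu> :: "nat \<Rightarrow> nat"
    have "Max (h ` \<Lambda>) \<in> h ` \<Lambda>" using fin ne by (intro Max_in) auto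
    then obtain \<mu> where \<mu>: "\<mu> \<in> \<Lambda>" "h \<mu> = Max (h ` \<Lambda>)" by force
    have max: "h \<nu> \<le> h \<mu>" if "\<nu> \<in> \<Lambda>" for \<nu>
      using that fin by (simp add: \<mu>(2))
    have top: "\<nu> = \<mu>" if "\<nu> \<in> \<Lambda>" "\<mu> \<le> \<nu>" for \<nu>
    proof (rule ccontr)
      assume "\<nu> \<noteq> \<mu>"
      then obtain j where j: "\<nu> j \<noteq> \<mu> j" by auto
      have "j < q" using j that(1) \<mu>(1) sub by (metis multi_indices_enat not_le subsetD)
      then have "h \<mu> < h \<nu>"
        unfolding h_def using that(2) j
        by (intro sum_strict_mono_ex1) (auto simp: le_fun_def intro!: bexI[of _ j] le_neq_implies_less)
      then show False using max[OF that(1)] by simp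
    qed
    have rest: "\<Lambda> - {\<mu>} \<in> lower_sets (enat q) n"
    proof -
      have "downward_closed (\<Lambda> - {\<mu>})"
        unfolding downward_closed_def using downward_closedD[OF dc] top by blast
      moreover have "card (\<Lambda> - {\<mu>}) = n" using card \<mu>(1) fin by simp
      moreover have "\<Lambda> - {\<mu>} \<noteq> {}" using calculation(2) assms by fastforce
      ultimately show ?thesis using fin sub by (auto simp: lower_sets_def)
    qed
    then have "(\<lambda>_. 0) \<in> \<Lambda> - {\<mu>}"
      using zero_in_downward_closed by (auto simp: lower_sets_def)
    then have "\<mu> \<noteq> (\<lambda>_. 0)" by auto
    then obtain \<nu> j where \<nu>: "\<mu> = increment \<nu> j" "j < q" "\<nu> \<le> \<mu>"
      using increment_decompose \<mu>(1) sub by blast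
    have "\<nu> \<noteq> \<mu>"
    proof
      assume "\<nu> = \<mu>"
      then have "\<mu> j = Suc (\<mu> j)" using fun_cong[OF \<nu>(1), of j] by (simp add: increment_def)
      then show False by simp
    qed
    then have "\<nu> \<in> \<Lambda> - {\<mu>}"
      using downward_closedD[OF dc \<mu>(1) \<nu>(3)] by simp
    moreover have "\<Lambda> = insert (increment \<nu> j) (\<Lambda> - {\<mu>})"
      using \<mu>(1) \<nu>(1) by auto
    ultimately show ?thesis
      using rest \<nu>(2) by (intro UN_I[of "\<Lambda> - {\<mu>}"]) (auto intro!: image_eqI[of _ _ "(\<nu>, j)"])
  qed
qed

text \<open>A set with at most n elements has at most q n extensions; together with the set itself
  these are at most q (n + 1), because q \<ge> 1.\<close>

lemma card_lower_sets_le_factorial: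
  assumes "1 \<le> n" and "1 \<le> q"
  shows "card (lower_sets (enat q) n) \<le> (q * n) ^ (n - 1)"
  using assms(1)
proof (induction n rule: dec_induct)
  case base
  have "\<Lambda> = {\<lambda>_. 0}" if "\<Lambda> \<in> lower_sets (enat q) 1" for \<Lambda>
    using that zero_in_downward_closed[of \<Lambda>] by (auto simp: lower_sets_def card_le_Suc0_iff_eq)
  then have "lower_sets (enat q) 1 \<subseteq> {{\<lambda>_. 0}}" by auto
  then have "card (lower_sets (enat q) 1) \<le> card {\<lambda>_ :: nat. 0 :: nat}"
    using card_mono[of "{{\<lambda>_ :: nat. 0 :: nat}}" "lower_sets (enat q) 1"] by simp
  then show ?case by simp
next
  case (step n)
  let ?I = "\<lambda>\<Lambda>. insert \<Lambda> ((\<lambda>(\<nu>, j). insert (increment \<nu> j) \<Lambda>) ` (\<Lambda> \<times> {..<q}))"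
  have I: "finite (?I \<Lambda>) \<and> card (?I \<Lambda>) \<le> q * Suc n" if "\<Lambda> \<in> lower_sets (enat q) n" for \<Lambda>
  proof -
    have fin: "finite (\<Lambda> \<times> {..<q})" and "card \<Lambda> \<le> n" using that by (auto simp: lower_sets_def)
    have "card (?I \<Lambda>) \<le> Suc (card ((\<lambda>(\<nu>, j). insert (increment \<nu> j) \<Lambda>) ` (\<Lambda> \<times> {..<q})))"
      using fin by (intro card_insert_le_m1) auto
    also have "\<dots> \<le> Suc (card \<Lambda> * q)"
      using card_image_le[OF fin] by (simp add: card_cartesian_product)
    also have "\<dots> \<le> Suc (n * q)"
      using \<open>card \<Lambda> \<le> n\<close> by simp
    also have "\<dots> \<le> q * Suc n" using assms(2) by (simp add: mult.commute)
    finally show ?thesis using fin by simp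
  qed
  have "card (lower_sets (enat q) (Suc n)) \<le> card (\<Union>\<Lambda>\<in>lower_sets (enat q) n. ?I \<Lambda>)"
    using I step.hyps by (intro card_mono lower_sets_Suc) (auto simp: finite_lower_sets)
  also have "\<dots> \<le> (\<Sum>\<Lambda>\<in>lower_sets (enat q) n. card (?I \<Lambda>))"
    by (rule card_UN_le) (rule finite_lower_sets)
  also have "\<dots> \<le> (\<Sum>\<Lambda>\<in>lower_sets (enat q) n. q * Suc n)"
    using I by (intro sum_mono) blast
  also have "\<dots> = card (lower_sets (enat q) n) * (q * Suc n)" by simp
  also have "\<dots> \<le> (q * n) ^ (n - 1) * (q * Suc n)"
    by (intro mult_right_mono step.IH) simp
  also have "\<dots> \<le> (q * Suc n) ^ (n - 1) * (q * Suc n)"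
    by (intro mult_right_mono power_mono) auto
  also have "\<dots> = (q * Suc n) ^ (Suc n - 1)"
    using step.hyps by (cases n) (auto simp del: mult_Suc_right)
  finally show ?case .
qed

text \<open>If coordinate j (counted from 0) is active, \<Lambda> contains 0 and the unit indices 0,
  ..., j, that is j + 2 elements.\<close>

lemma anchored_multi_indices:
  assumes "anchored \<Lambda>" and "finite \<Lambda>" and "card \<Lambda> \<le> n"
  shows "\<Lambda> \<subseteq> multi_indices (enat (n - 1))"
proof
  fix \<mu> assume \<mu>: "\<mu> \<in> \<Lambda>"
  have dc: "downward_closed \<Lambda>" using assms(1) by (simp add: anchored_def)
  have "j < n - 1" if "\<mu> j \<noteq> 0" for j
  proof -
    have "unit_index j \<le> \<mu>" using that by (auto simp: le_fun_def unit_index_def)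
    then have "unit_index j \<in> \<Lambda>" using downward_closedD[OF dc \<mu>] by blast
    then have sub: "insert (\<lambda>_. 0) (unit_index ` {..j}) \<subseteq> \<Lambda>"
      using assms(1) zero_in_downward_closed[OF dc] by (auto simp: anchored_def)
    have "inj_on unit_index {..j}"
      by (rule inj_onI) (metis unit_index_def zero_neq_one)
    moreover have "(\<lambda>_. 0) \<notin> unit_index ` {..j}"
    proof
      assume "(\<lambda>_. 0) \<in> unit_index ` {..j}"
      then obtain i where "(\<lambda>_. 0) = unit_index i" by blast
      from fun_cong[OF this, of i] show False by (simp add: unit_index_def)
    qed
    ultimately have "card (insert (\<lambda>_. 0) (unit_index ` {..j})) = Suc (Suc j)"
      by (simp add: card_image)
    then show ?thesis using card_mono[OF assms(2) sub] assms(3) by simp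
  qed
  then show "\<mu> \<in> multi_indices (enat (n - 1))"
    unfolding multi_indices_enat by (meson not_le)
qed

section \<open>Tensor product polynomials\<close>

text \<open>From here on the two families of Jacobi weights enter only through the exponent s in
  this one-dimensional inequality.\<close>

locale christoffel_measure = prob_space \<beta> for \<beta> :: "real measure" +
  fixes s :: real
  assumes space_interval: "space \<beta> = {-1..1}"
    and poly_measurable: "\<And>p. poly p \<in> borel_measurable \<beta>"
    and one_le_s: "1 \<le> s"
    and christoffel: "\<And>t p n. t \<in> {-1..1} \<Longrightarrow> degree p < n \<Longrightarrow>
      (poly p t)\<^sup>2 \<le> real n powr s * (\<integral>x. (poly p x)\<^sup>2 \<partial>\<beta>)"
begin

lemma poly_integrable_measure: "integrable \<beta> (poly p)"
proof -
  have "compact (poly p ` {-1..1})"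
    by (intro compact_continuous_image continuous_on_poly continuous_on_id) simp
  then have "bounded (poly p ` {-1..1})" by (rule compact_imp_bounded)
  then obtain B where "\<forall>y\<in>poly p ` {-1..1}. norm y \<le> B" unfolding bounded_iff by blast
  then have "AE x in \<beta>. norm (poly p x) \<le> B"
    by (intro AE_I2) (simp add: space_interval)
  then show ?thesis by (rule integrable_const_bound) (rule poly_measurable)
qed

definition integral_poly :: "real poly \<Rightarrow> real" where
  "integral_poly p = (\<integral>x. poly p x \<partial>\<beta>)"

lemma integral_poly_square: "integral_poly (p * p) = (\<integral>x. (poly p x)\<^sup>2 \<partial>\<beta>)"
  by (simp add: integral_poly_def power2_eq_square)

sublocale positive_functional integral_poly
proof
  fix p q :: "real poly" and c :: real
  show "integral_poly (p + q) = integral_poly p + integral_poly q"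
    by (simp add: integral_poly_def poly_integrable_measure)
  show "integral_poly (smult c p) = c * integral_poly p"
    by (simp add: integral_poly_def)
  assume "p \<noteq> 0"
  have "0 \<le> integral_poly (p * p)" by (simp add: integral_poly_square)
  moreover have "integral_poly (p * p) \<noteq> 0"
  proof
    assume "integral_poly (p * p) = 0"
    \<comment> \<open>The Christoffel inequality also yields definiteness: a vanishing integral
      makes p zero on the whole interval.\<close>
    then have "(poly p t)\<^sup>2 \<le> 0" if "t \<in> {-1..1}" for t
      using christoffel[OF that lessI, of p] by (simp add: integral_poly_square)
    then have "poly p t = 0" if "t \<in> {-1..1}" for t
      using that by (metis power2_less_eq_zero_iff)
    then have "p = 0" by (rule poly_eq_0_of_interval[of "-1::real" 1, rotated]) simp_all
    then show False using \<open>p \<noteq> 0\<close> by simp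
  qed
  ultimately show "0 < integral_poly (p * p)" by linarith
qed

abbreviation P :: "nat \<Rightarrow> real poly" where "P \<equiv> ortho_poly"

lemma P_0: "P 0 = 1"
  by (rule ortho_poly_0) (simp add: integral_poly_def prob_space)

lemma sum_P_square_le:
  assumes "t \<in> {-1..1}"
  shows "(\<Sum>k<n. (poly (P k) t)\<^sup>2) \<le> real n powr s"
proof -
  have "(\<Sum>k<n. (poly (P k) t)\<^sup>2) \<le> max (real n powr s) 0"
    using christoffel[OF assms] by (intro christoffel_le) (simp add: integral_poly_square)
  then show ?thesis by simp
qed

text \<open>Since \<open>P 0 = 1\<close>, the product over the support is the product over all
  coordinates, and it is finite also in infinite dimension.\<close>

definition tensor :: "(nat \<Rightarrow> nat) \<Rightarrow> (nat \<Rightarrow> real) \<Rightarrow> real" where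
  "tensor \<mu> y = (\<Prod>j | \<mu> j \<noteq> 0. poly (P (\<mu> j)) (y j))"

lemma tensor_altdef:
  assumes "finite S" and "{j. \<mu> j \<noteq> 0} \<subseteq> S"
  shows "tensor \<mu> y = (\<Prod>j\<in>S. poly (P (\<mu> j)) (y j))"
  unfolding tensor_def using assms by (intro prod.mono_neutral_left) (auto simp: P_0)

end

locale christoffel_product = christoffel_measure +
  fixes d :: enat
begin

definition \<rho> :: "(nat \<Rightarrow> real) measure" where
  "\<rho> = PiM (coords d) (\<lambda>_. \<beta>)"

sublocale product: product_prob_space "\<lambda>_::nat. \<beta>" "coords d"
  by standard

lemma prob_space_\<rho>: "prob_space \<rho>"
  unfolding \<rho>_def by (rule product.P.prob_space_axioms)

lemma \<rho>_component: "y \<in> space \<rho> \<Longrightarrow> j \<in> coords d \<Longrightarrow> y j \<in> {-1..1}"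
  unfolding \<rho>_def space_PiM using space_interval by (auto simp: PiE_def Pi_def)

lemma poly_component_measurable:
  "j \<in> J \<Longrightarrow> (\<lambda>y. poly p (y j)) \<in> borel_measurable (PiM J (\<lambda>_. \<beta>))"
  by (rule measurable_compose[of "\<lambda>y. y j" _ \<beta>]) (auto intro: measurable_component_singleton poly_measurable)

lemma tensor_measurable:
  assumes "\<mu> \<in> multi_indices d"
  shows "tensor \<mu> \<in> borel_measurable \<rho>"
  unfolding tensor_def[abs_def] \<rho>_def
proof (intro borel_measurable_prod)
  fix j assume "j \<in> {j. \<mu> j \<noteq> 0}"
  then have "j \<in> coords d" using assms by (auto simp: multi_indices_def)
  then show "(\<lambda>y. poly (P (\<mu> j)) (y j)) \<in> borel_measurable (PiM (coords d) (\<lambda>_. \<beta>))"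
    by (rule poly_component_measurable)
qed

text \<open>Both factors depend only on the finite set S of active coordinates. The marginal of the
  product measure on S is a finite product, where the integral factorizes.\<close>

lemma tensor_orthonormal:
  assumes "\<mu> \<in> multi_indices d" and "\<nu> \<in> multi_indices d"
  shows "(\<integral>y. tensor \<mu> y * tensor \<nu> y \<partial>\<rho>) = of_bool (\<mu> = \<nu>)"
proof -
  define S where "S = {j. \<mu> j \<noteq> 0} \<union> {j. \<nu> j \<noteq> 0}"
  have S: "finite S" "S \<subseteq> coords d"
    using assms by (auto simp: S_def multi_indices_def)
  let ?f = "\<lambda>j x. poly (P (\<mu> j) * P (\<nu> j)) x"
  have prod: "tensor \<mu> y * tensor \<nu> y = (\<Prod>j\<in>S. ?f j (restrict y S j))" for y
    using S(1) by (subst (1 2) tensor_altdef[of S]) (auto simp: S_def prod.distrib)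
  have meas: "(\<lambda>y. \<Prod>j\<in>S. ?f j (y j)) \<in> borel_measurable (PiM S (\<lambda>_. \<beta>))"
    by (intro borel_measurable_prod poly_component_measurable)
  have "(\<integral>y. tensor \<mu> y * tensor \<nu> y \<partial>\<rho>) = (\<integral>y. (\<Prod>j\<in>S. ?f j (restrict y S j)) \<partial>PiM (coords d) (\<lambda>_. \<beta>))"
    by (simp only: \<rho>_def prod)
  also have "\<dots> = (\<integral>y. (\<Prod>j\<in>S. ?f j (y j)) \<partial>distr (PiM (coords d) (\<lambda>_. \<beta>)) (PiM S (\<lambda>_. \<beta>)) (\<lambda>y. restrict y S))"
    by (rule integral_distr[symmetric, OF measurable_restrict_subset[OF S(2)] meas])
  also have "\<dots> = (\<integral>y. (\<Prod>j\<in>S. ?f j (y j)) \<partial>PiM S (\<lambda>_. \<beta>))"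
    by (simp only: product.distr_PiM_restrict_finite[OF S])
  also have "\<dots> = (\<Prod>j\<in>S. \<integral>x. ?f j x \<partial>\<beta>)"
    by (rule product.product_integral_prod[OF S(1)]) (rule poly_integrable_measure)
  also have "\<dots> = (\<Prod>j\<in>S. of_bool (\<mu> j = \<nu> j))"
    using ortho_poly_orthonormal by (simp only: integral_poly_def)
  also have "\<dots> = of_bool (\<mu> = \<nu>)"
  proof (cases "\<mu> = \<nu>")
    case False
    then obtain j where j: "\<mu> j \<noteq> \<nu> j" by auto
    then have "j \<in> S" by (auto simp: S_def) 
    with j S(1) False show ?thesis by (auto intro!: prod_zero)
  qed simp
  finally show ?thesis .
qed

lemma sum_tensor_square_le:
  assumes "finite \<Lambda>" and "downward_closed \<Lambda>" and "\<Lambda> \<subseteq> multi_indices d" and "y \<in> space \<rho>"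
  shows "(\<Sum>\<mu>\<in>\<Lambda>. (tensor \<mu> y)\<^sup>2) \<le> real (card \<Lambda>) powr s"
proof -
  have "finite (\<Union>\<mu>\<in>\<Lambda>. {j. \<mu> j \<noteq> 0})"
    using assms(1,3) by (intro finite_UN_I) (auto simp: multi_indices_def)
  then obtain q where q: "\<And>j. j \<in> (\<Union>\<mu>\<in>\<Lambda>. {j. \<mu> j \<noteq> 0}) \<Longrightarrow> j < q"
    unfolding finite_nat_set_iff_bounded by blast
  \<comment> \<open>Outside \<open>coords d\<close> the point y has no meaningful value, but all
    indices vanish there; the indicator of k = 0 gives the right factor 1 and keeps the bound on
    partial sums.\<close>
  define c where "c j k = (if j \<in> coords d then (poly (P k) (y j))\<^sup>2 else of_bool (k = 0))" for j k
  have "(\<Sum>\<mu>\<in>\<Lambda>. (tensor \<mu> y)\<^sup>2) = (\<Sum>\<mu>\<in>\<Lambda>. \<Prod>j<q. c j (\<mu> j))"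
  proof (intro sum.cong refl)
    fix \<mu> assume \<mu>: "\<mu> \<in> \<Lambda>"
    have "(tensor \<mu> y)\<^sup>2 = (\<Prod>j<q. (poly (P (\<mu> j)) (y j))\<^sup>2)"
      using q \<mu> by (subst tensor_altdef[of "{..<q}"]) (auto simp: prod_power_distrib)
    also have "\<dots> = (\<Prod>j<q. c j (\<mu> j))"
    proof (intro prod.cong refl)
      fix j
      show "(poly (P (\<mu> j)) (y j))\<^sup>2 = c j (\<mu> j)"
        using \<mu> assms(3) by (cases "\<mu> j = 0") (auto simp: c_def P_0 multi_indices_def)
    qed
    finally show "(tensor \<mu> y)\<^sup>2 = (\<Prod>j<q. c j (\<mu> j))" .
  qed
  also have "\<dots> \<le> real (card \<Lambda>) powr s"
  proof (rule downward_closed_sum_prod_le[OF one_le_s _ _ assms(1,2)])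
    fix j n
    show "(\<Sum>k<n. c j k) \<le> real n powr s"
    proof (cases "j \<in> coords d")
      case True
      then show ?thesis
        using sum_P_square_le[OF \<rho>_component[OF assms(4) True], of n] by (simp add: c_def)
    next
      case False
      have "1 \<le> real n powr s" if "0 < n" using that one_le_s by (intro ge_one_powr_ge_zero) auto
      then show ?thesis using False by (cases "n = 0") (auto simp: c_def)
    qed
  next
    fix \<mu> j assume "\<mu> \<in> \<Lambda>" "q \<le> j"
    then show "\<mu> j = 0" using q[of j] by (meson UN_I mem_Collect_eq not_le)
  qed (simp add: c_def)
  finally show ?thesis .
qed

lemma isotropic_tensor:
  assumes "\<Lambda> \<in> lower_sets d N"
  shows "isotropic \<rho> \<Lambda> tensor (real N powr s)"
proof -
  interpret R: prob_space \<rho> by (rule prob_space_\<rho>)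
  have \<Lambda>: "finite \<Lambda>" "downward_closed \<Lambda>" "\<Lambda> \<subseteq> multi_indices d" "\<Lambda> \<noteq> {}" "card \<Lambda> \<le> N"
    using assms by (auto simp: lower_sets_def)
  show ?thesis
  proof
    fix y assume y: "y \<in> space \<rho>"
    have "real (card \<Lambda>) powr s \<le> real N powr s"
      using \<Lambda>(5) one_le_s by (intro powr_mono2) auto
    then show "(\<Sum>\<mu>\<in>\<Lambda>. (tensor \<mu> y)\<^sup>2) \<le> real N powr s"
      using sum_tensor_square_le[OF \<Lambda>(1-3) y] by simp
  next
    fix \<mu> \<nu> assume "\<mu> \<in> \<Lambda>" "\<nu> \<in> \<Lambda>"
    then show "(\<integral>y. tensor \<mu> y * tensor \<nu> y \<partial>\<rho>) = of_bool (\<mu> = \<nu>)"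
      using \<Lambda>(3) by (intro tensor_orthonormal) auto
  qed (use \<Lambda> tensor_measurable in auto)
qed

text \<open>Each power of degree n is a combination of P 0, ..., P n. Multiplying out produces only
  indices below \<nu>, which lie in \<Lambda> by downward closedness.\<close>

lemma monomial_tensor_span:
  assumes "finite \<Lambda>" and "downward_closed \<Lambda>" and "\<nu> \<in> \<Lambda>" and "finite {j. \<nu> j \<noteq> 0}"
  shows "fin_span \<Lambda> tensor (monomial \<nu>)"
proof -
  let ?S = "{j. \<nu> j \<noteq> 0}"
  have "\<exists>a. monom 1 n = (\<Sum>k<Suc n. smult (a k) (P k))" for n
    by (rule ortho_poly_span) simp
  then obtain a where a: "\<And>n. monom 1 n = (\<Sum>k<Suc n. smult (a n k) (P k))" by metis
  have power: "x ^ n = (\<Sum>k<Suc n. a n k * poly (P k) x)" for x :: real and n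
  proof -
    have "x ^ n = poly (monom 1 n) x" by (simp add: poly_monom)
    also have "\<dots> = (\<Sum>k<Suc n. a n k * poly (P k) x)"
      by (simp only: a poly_sum poly_smult)
    finally show ?thesis .
  qed
  let ?E = "PiE ?S (\<lambda>j. {..<Suc (\<nu> j)})"
  let ?ext = "\<lambda>g j. if j \<in> ?S then g j else 0"
  have "monomial \<nu> y = (\<Sum>g\<in>?E. (\<Prod>j\<in>?S. a (\<nu> j) (g j)) * tensor (?ext g) y)" for y
  proof -
    have "monomial \<nu> y = (\<Prod>j\<in>?S. \<Sum>k<Suc (\<nu> j). a (\<nu> j) k * poly (P k) (y j))"
      unfolding monomial_def by (subst power) (rule refl)
    also have "\<dots> = (\<Sum>g\<in>?E. \<Prod>j\<in>?S. a (\<nu> j) (g j) * poly (P (g j)) (y j))"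
      by (rule prod_sum_PiE) (use assms(4) in auto)
    also have "\<dots> = (\<Sum>g\<in>?E. (\<Prod>j\<in>?S. a (\<nu> j) (g j)) * tensor (?ext g) y)"
    proof (intro sum.cong refl)
      fix g
      have "tensor (?ext g) y = (\<Prod>j\<in>?S. poly (P (g j)) (y j))"
        by (subst tensor_altdef[OF assms(4)]) (auto intro!: prod.cong)
      then show "(\<Prod>j\<in>?S. a (\<nu> j) (g j) * poly (P (g j)) (y j)) = (\<Prod>j\<in>?S. a (\<nu> j) (g j)) * tensor (?ext g) y"
        by (simp add: prod.distrib)
    qed
    finally show ?thesis .
  qed
  moreover have "fin_span \<Lambda> tensor (\<lambda>y. \<Sum>g\<in>?E. (\<Prod>j\<in>?S. a (\<nu> j) (g j)) * tensor (?ext g) y)"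
  proof (intro fin_span_sum fin_span_scale fin_span_base assms(1))
    show "finite ?E" using assms(4) by (intro finite_PiE) auto
    fix g assume "g \<in> ?E"
    then have "?ext g \<le> \<nu>"
      by (fastforce simp: le_fun_def PiE_def Pi_def less_Suc_eq_le)
    then show "?ext g \<in> \<Lambda>" using downward_closedD assms(2,3) by blast
  qed
  ultimately show ?thesis unfolding fin_span_def by simp
qed

lemma poly_space_tensor_span:
  assumes "finite \<Lambda>" and "downward_closed \<Lambda>" and "\<Lambda> \<subseteq> multi_indices d" and "v \<in> poly_space \<Lambda>"
  obtains a where "\<And>y. v y = (\<Sum>\<mu>\<in>\<Lambda>. a \<mu> * tensor \<mu> y)"
proof -
  obtain c where "v = (\<lambda>y. \<Sum>\<nu>\<in>\<Lambda>. c \<nu> * monomial \<nu> y)"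
    using assms(4) by (auto simp: poly_space_def)
  moreover have "fin_span \<Lambda> tensor (\<lambda>y. \<Sum>\<nu>\<in>\<Lambda>. c \<nu> * monomial \<nu> y)"
    using assms(1-3) by (intro fin_span_sum fin_span_scale monomial_tensor_span) (auto simp: multi_indices_def)
  ultimately show ?thesis using that unfolding fin_span_def by blast
qed

text \<open>In the basis \<open>tensor\<close> the squared norm is the sum of squared coefficients,
  so this is \<open>gram_lower_tail\<close> for polynomials.\<close>

lemma poly_space_norm_equivalence:
  assumes "\<Lambda> \<in> lower_sets d N" and m: "0 < m"
  obtains B where "B \<in> sets (PiM {..<m} (\<lambda>_. \<rho>))"
    and "measure (PiM {..<m} (\<lambda>_. \<rho>)) B \<le> real N * exp (- ((1 - ln 2) / 2 * real m / real N powr s))"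
    and "\<And>ys v. ys \<in> space (PiM {..<m} (\<lambda>_. \<rho>)) - B \<Longrightarrow> v \<in> poly_space \<Lambda> \<Longrightarrow>
      (\<integral>y. (v y)\<^sup>2 \<partial>\<rho>) \<le> 2 * (sample_norm m ys v)\<^sup>2"
proof -
  interpret T: isotropic \<rho> \<Lambda> tensor "real N powr s"
    by (rule isotropic_tensor[OF assms(1)])
  have \<Lambda>: "finite \<Lambda>" "downward_closed \<Lambda>" "\<Lambda> \<subseteq> multi_indices d" "card \<Lambda> \<le> N"
    using assms(1) by (auto simp: lower_sets_def)
  obtain B where B: "B \<in> sets (PiM {..<m} (\<lambda>_. \<rho>))"
    "measure (PiM {..<m} (\<lambda>_. \<rho>)) B \<le> real (card \<Lambda>) * exp (- ((1 - ln 2) / 2 * real m / real N powr s))"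
    "\<And>ys a. ys \<in> space (PiM {..<m} (\<lambda>_. \<rho>)) - B \<Longrightarrow>
      (\<Sum>i\<in>\<Lambda>. (a i)\<^sup>2) / 2 \<le> (\<Sum>l<m. (\<Sum>i\<in>\<Lambda>. a i * tensor i (ys l))\<^sup>2) / real m"
    using T.gram_lower_tail[OF m] by blast
  show thesis
  proof (rule that[OF B(1)])
    show "measure (PiM {..<m} (\<lambda>_. \<rho>)) B \<le> real N * exp (- ((1 - ln 2) / 2 * real m / real N powr s))"
      using \<Lambda>(4) by (intro order_trans[OF B(2)] mult_right_mono) auto
    fix ys v assume ys: "ys \<in> space (PiM {..<m} (\<lambda>_. \<rho>)) - B" and v: "v \<in> poly_space \<Lambda>"
    obtain a where a: "\<And>y. v y = (\<Sum>\<mu>\<in>\<Lambda>. a \<mu> * tensor \<mu> y)"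
      using poly_space_tensor_span[OF \<Lambda>(1-3) v] by blast
    have "(\<integral>y. (v y)\<^sup>2 \<partial>\<rho>) = (\<integral>y. (\<Sum>\<mu>\<in>\<Lambda>. \<Sum>\<nu>\<in>\<Lambda>. (a \<mu> * a \<nu>) * (tensor \<mu> y * tensor \<nu> y)) \<partial>\<rho>)"
      by (simp add: a power2_eq_square sum_product mult_ac)
    also have "\<dots> = (\<Sum>\<mu>\<in>\<Lambda>. \<Sum>\<nu>\<in>\<Lambda>. (a \<mu> * a \<nu>) * (\<integral>y. tensor \<mu> y * tensor \<nu> y \<partial>\<rho>))"
      by (simp add: Bochner_Integration.integral_sum T.X_mult_integrable)
    also have "\<dots> = (\<Sum>\<mu>\<in>\<Lambda>. (a \<mu>)\<^sup>2)"
    proof (intro sum.cong refl)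
      fix \<mu> assume \<mu>: "\<mu> \<in> \<Lambda>"
      have "(\<Sum>\<nu>\<in>\<Lambda>. (a \<mu> * a \<nu>) * (\<integral>y. tensor \<mu> y * tensor \<nu> y \<partial>\<rho>)) =
        (\<Sum>\<nu>\<in>\<Lambda>. if \<mu> = \<nu> then a \<mu> * a \<nu> else 0)"
        by (intro sum.cong refl) (simp add: T.X_orthonormal \<mu>)
      then show "(\<Sum>\<nu>\<in>\<Lambda>. (a \<mu> * a \<nu>) * (\<integral>y. tensor \<mu> y * tensor \<nu> y \<partial>\<rho>)) = (a \<mu>)\<^sup>2"
        using \<Lambda>(1) \<mu> by (simp add: power2_eq_square)
    qed
    also have "\<dots> \<le> 2 * ((\<Sum>l<m. (\<Sum>i\<in>\<Lambda>. a i * tensor i (ys l))\<^sup>2) / real m)"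
      using B(3)[OF ys, of a] by (simp add: mult.commute)
    also have "\<dots> = 2 * (sample_norm m ys v)\<^sup>2"
      by (simp add: sample_norm_def a sum_nonneg)
    finally show "(\<integral>y. (v y)\<^sup>2 \<partial>\<rho>) \<le> 2 * (sample_norm m ys v)\<^sup>2" .
  qed
qed

lemma poly_space_bounded_measurable:
  assumes "finite \<Lambda>" and "\<Lambda> \<subseteq> multi_indices d" and "v \<in> poly_space \<Lambda>"
  shows "v \<in> borel_measurable \<rho>" and "\<exists>C. \<forall>y\<in>space \<rho>. \<bar>v y\<bar> \<le> C"
proof -
  obtain c where v: "v = (\<lambda>y. \<Sum>\<nu>\<in>\<Lambda>. c \<nu> * monomial \<nu> y)"
    using assms(3) by (auto simp: poly_space_def)
  have "monomial \<nu> \<in> borel_measurable \<rho>" if "\<nu> \<in> \<Lambda>" for \<nu>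
    unfolding monomial_def[abs_def] \<rho>_def
  proof (intro borel_measurable_prod borel_measurable_power)
    fix j assume "j \<in> {j. \<nu> j \<noteq> 0}"
    then have "j \<in> coords d" using that assms(2) by (auto simp: multi_indices_def)
    then show "(\<lambda>y. y j) \<in> borel_measurable (PiM (coords d) (\<lambda>_. \<beta>))"
      using poly_component_measurable[of j "coords d" "[:0, 1:]"] by simp
  qed
  then show "v \<in> borel_measurable \<rho>"
    unfolding v by (intro borel_measurable_sum borel_measurable_times) auto
  have "\<bar>v y\<bar> \<le> (\<Sum>\<nu>\<in>\<Lambda>. \<bar>c \<nu>\<bar>)" if y: "y \<in> space \<rho>" for y
  proof -
    have mono: "\<bar>monomial \<nu> y\<bar> \<le> 1" if "\<nu> \<in> \<Lambda>" for \<nu>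
      unfolding monomial_def abs_prod
    proof (rule prod_le_1)
      fix j assume "j \<in> {j. \<nu> j \<noteq> 0}"
      then have "j \<in> coords d" using that assms(2) by (auto simp: multi_indices_def)
      then have "\<bar>y j\<bar> \<le> 1" using \<rho>_component[OF y, of j] by auto
      then show "0 \<le> \<bar>y j ^ \<nu> j\<bar> \<and> \<bar>y j ^ \<nu> j\<bar> \<le> 1" by (simp add: power_abs power_le_one)
    qed
    have "\<bar>v y\<bar> \<le> (\<Sum>\<nu>\<in>\<Lambda>. \<bar>c \<nu> * monomial \<nu> y\<bar>)" unfolding v by (rule sum_abs)
    also have "\<dots> \<le> (\<Sum>\<nu>\<in>\<Lambda>. \<bar>c \<nu>\<bar>)"
      using mono by (intro sum_mono) (simp add: abs_mult mult_left_le)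
    finally show ?thesis .
  qed
  then show "\<exists>C. \<forall>y\<in>space \<rho>. \<bar>v y\<bar> \<le> C" by blast
qed

end

lemma poly_space_mono:
  assumes "finite \<Lambda>'" and "\<Lambda> \<subseteq> \<Lambda>'"
  shows "poly_space \<Lambda> \<subseteq> poly_space \<Lambda>'"
proof
  fix v assume "v \<in> poly_space \<Lambda>"
  then obtain c where v: "v = (\<lambda>y. \<Sum>\<nu>\<in>\<Lambda>. c \<nu> * monomial \<nu> y)" by (auto simp: poly_space_def)
  have "v = (\<lambda>y. \<Sum>\<nu>\<in>\<Lambda>'. (if \<nu> \<in> \<Lambda> then c \<nu> else 0) * monomial \<nu> y)"
    unfolding v using assms by (intro ext sum.mono_neutral_cong_left) auto
  then show "v \<in> poly_space \<Lambda>'" by (auto simp: poly_space_def)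
qed

lemma poly_space_diff:
  assumes "v \<in> poly_space \<Lambda>" and "w \<in> poly_space \<Lambda>"
  shows "(\<lambda>y. v y - w y) \<in> poly_space \<Lambda>"
proof -
  obtain a b where "v = (\<lambda>y. \<Sum>\<nu>\<in>\<Lambda>. a \<nu> * monomial \<nu> y)" "w = (\<lambda>y. \<Sum>\<nu>\<in>\<Lambda>. b \<nu> * monomial \<nu> y)"
    using assms by (auto simp: poly_space_def)
  then have "(\<lambda>y. v y - w y) = (\<lambda>y. \<Sum>\<nu>\<in>\<Lambda>. (a \<nu> - b \<nu>) * monomial \<nu> y)"
    by (simp add: left_diff_distrib sum_subtractf)
  then show ?thesis by (simp add: poly_space_def)
qed

section \<open>Optimized least squares\<close>

text \<open>The nonnegative integral covers the non-integrable case as well and is measurable in a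
  parameter, which makes the success event measurable.\<close>

lemma L2_norm_le_iff:
  assumes [measurable]: "f \<in> borel_measurable M" and "0 \<le> c"
  shows "L2_norm M f \<le> ennreal c \<longleftrightarrow> (\<integral>\<^sup>+x. ennreal ((f x)\<^sup>2) \<partial>M) \<le> ennreal (c\<^sup>2)"
proof (cases "integrable M (\<lambda>x. (f x)\<^sup>2)")
  case True
  have "0 \<le> (\<integral>x. (f x)\<^sup>2 \<partial>M)" by simp
  then have "sqrt (\<integral>x. (f x)\<^sup>2 \<partial>M) \<le> c \<longleftrightarrow> (\<integral>x. (f x)\<^sup>2 \<partial>M) \<le> c\<^sup>2"
    using assms(2) by (metis real_le_lsqrt real_sqrt_le_iff real_sqrt_unique sqrt_le_D)
  then show ?thesis
    using True assms(2) by (simp add: L2_norm_def nn_integral_eq_integral)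
next
  case False
  have "(\<integral>\<^sup>+x. ennreal ((f x)\<^sup>2) \<partial>M) = \<infinity>"
  proof (rule ccontr)
    assume "(\<integral>\<^sup>+x. ennreal ((f x)\<^sup>2) \<partial>M) \<noteq> \<infinity>"
    then have "(\<integral>\<^sup>+x. ennreal (norm ((f x)\<^sup>2)) \<partial>M) < \<infinity>" by (simp add: less_top)
    then have "integrable M (\<lambda>x. (f x)\<^sup>2)" by (intro integrableI_bounded) measurable
    then show False using False by simp
  qed
  then show ?thesis using False by (simp add: L2_norm_def top_unique)
qed

text \<open>A triangle inequality in which f is only known to be bounded: pointwise (f + g)^2 \<le>
  (e + |g|)^2, and the mixed term needs the mean of |g| to be at most h.\<close>

lemma (in prob_space) integral_square_add_bounded_le:
  fixes f g :: "'a \<Rightarrow> real"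
  assumes [measurable]: "f \<in> borel_measurable M" "g \<in> borel_measurable M"
    and f: "AE x in M. \<bar>f x\<bar> \<le> e" and g: "\<And>x. x \<in> space M \<Longrightarrow> \<bar>g x\<bar> \<le> C"
    and "0 \<le> e" and h: "(\<integral>x. (g x)\<^sup>2 \<partial>M) \<le> h\<^sup>2" "0 \<le> h"
  shows "L2_norm M (\<lambda>x. f x + g x) \<le> ennreal (e + h)"
proof -
  have g_int: "integrable M (\<lambda>x. \<bar>g x\<bar>)"
    using g by (intro integrable_const_bound[of _ C]) auto
  have gg_int: "integrable M (\<lambda>x. (g x)\<^sup>2)"
  proof (intro integrable_const_bound[of _ "C\<^sup>2"] AE_I2)
    fix x assume "x \<in> space M"
    then have "\<bar>g x\<bar>\<^sup>2 \<le> C\<^sup>2" by (intro power_mono g) auto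
    then show "norm ((g x)\<^sup>2) \<le> C\<^sup>2" by simp
  qed measurable
  define c where "c = (\<integral>x. \<bar>g x\<bar> \<partial>M)"
  \<comment> \<open>The variance of |g| is nonnegative.\<close>
  have "0 \<le> (\<integral>x. (\<bar>g x\<bar> - c)\<^sup>2 \<partial>M)" by simp
  also have "\<dots> = (\<integral>x. (g x)\<^sup>2 - 2 * c * \<bar>g x\<bar> + c\<^sup>2 \<partial>M)"
    by (intro Bochner_Integration.integral_cong) (auto simp: power2_diff)
  also have "\<dots> = (\<integral>x. (g x)\<^sup>2 \<partial>M) - c\<^sup>2"
    using g_int gg_int by (simp add: prob_space power2_eq_square c_def[symmetric])
  finally have "c\<^sup>2 \<le> h\<^sup>2" using h(1) by simp
  then have c: "c \<le> h" using h(2) by (rule power2_le_imp_le)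
  have int: "integrable M (\<lambda>x. e\<^sup>2 + 2 * e * \<bar>g x\<bar> + (g x)\<^sup>2)"
    using g_int gg_int by simp
  have "(\<integral>\<^sup>+x. ennreal ((f x + g x)\<^sup>2) \<partial>M) \<le> (\<integral>\<^sup>+x. ennreal (e\<^sup>2 + 2 * e * \<bar>g x\<bar> + (g x)\<^sup>2) \<partial>M)"
    using f
  proof (intro nn_integral_mono_AE, eventually_elim)
    case (elim x)
    then have "\<bar>f x + g x\<bar>\<^sup>2 \<le> (e + \<bar>g x\<bar>)\<^sup>2" by (intro power_mono) auto
    then show ?case by (intro ennreal_leI) (simp add: power2_sum mult_ac)
  qed
  also have "\<dots> = ennreal (\<integral>x. e\<^sup>2 + 2 * e * \<bar>g x\<bar> + (g x)\<^sup>2 \<partial>M)"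
    using assms(5) by (intro nn_integral_eq_integral[OF int]) simp
  also have "(\<integral>x. e\<^sup>2 + 2 * e * \<bar>g x\<bar> + (g x)\<^sup>2 \<partial>M) = e\<^sup>2 + 2 * e * c + (\<integral>x. (g x)\<^sup>2 \<partial>M)"
    using g_int gg_int by (simp add: prob_space c_def)
  also have "\<dots> \<le> e\<^sup>2 + 2 * e * h + h\<^sup>2"
    using assms(5) c h(1) by (intro add_mono mult_left_mono) auto
  also have "\<dots> = (e + h)\<^sup>2" by (simp add: power2_sum mult_ac)
  finally have "(\<integral>\<^sup>+x. ennreal ((f x + g x)\<^sup>2) \<partial>M) \<le> ennreal ((e + h)\<^sup>2)"
    by (simp add: ennreal_leI)
  then show ?thesis using assms(5) h(2) by (subst L2_norm_le_iff) auto
qed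

lemma sample_norm_altdef: "sample_norm m ys f = L2_set (\<lambda>i. f (ys i)) {..<m} / sqrt (real m)"
  by (simp add: sample_norm_def L2_set_def real_sqrt_divide)

lemma sample_norm_triangle: "sample_norm m ys (\<lambda>y. f y - g y) \<le> sample_norm m ys f + sample_norm m ys g"
proof -
  have "L2_set (\<lambda>i. f (ys i) + - g (ys i)) {..<m} \<le> L2_set (\<lambda>i. f (ys i)) {..<m} + L2_set (\<lambda>i. - g (ys i)) {..<m}"
    by (rule L2_set_triangle_ineq)
  also have "L2_set (\<lambda>i. - g (ys i)) {..<m} = L2_set (\<lambda>i. g (ys i)) {..<m}"
    by (simp add: L2_set_def)
  finally show ?thesis
    unfolding sample_norm_altdef by (simp add: add_divide_distrib[symmetric] divide_right_mono)
qed

lemma sample_norm_le: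
  assumes "0 < m" and "0 \<le> e" and "\<And>i. i < m \<Longrightarrow> \<bar>f (ys i)\<bar> \<le> e"
  shows "sample_norm m ys f \<le> e"
proof -
  have "(f (ys i))\<^sup>2 \<le> e\<^sup>2" if "i < m" for i
    using power_mono[OF assms(3)[OF that], of 2] by simp
  then have "(\<Sum>i<m. (f (ys i))\<^sup>2) \<le> real m * e\<^sup>2"
    using sum_mono[of "{..<m}" "\<lambda>i. (f (ys i))\<^sup>2" "\<lambda>_. e\<^sup>2"] by simp
  then have "1 / real m * (\<Sum>i<m. (f (ys i))\<^sup>2) \<le> e\<^sup>2"
    using assms(1) by (simp add: field_simps)
  then show ?thesis
    unfolding sample_norm_def using assms(2) real_le_lsqrt real_sqrt_le_iff real_sqrt_unique by metis
qed

lemma sample_norm_nonneg: "0 \<le> sample_norm m ys f"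
  by (simp add: sample_norm_def sum_nonneg)

lemma best_sample_error_le:
  "v \<in> poly_space \<Lambda> \<Longrightarrow> best_sample_error m ys u \<Lambda> \<le> sample_norm m ys (\<lambda>y. u y - v y)"
  unfolding best_sample_error_def
  by (rule cINF_lower) (auto intro!: bdd_belowI[of _ 0] sample_norm_nonneg)

text \<open>On its own space w attains the infimum, and this infimum is the smallest over all index
  sets, so w is at least as good as every v of every space.\<close>

lemma optimized_sample_norm_le:
  assumes "is_arg_min (best_sample_error m ys u) (\<lambda>\<Lambda>. \<Lambda> \<in> \<L>) \<Lambda>'"
    and "is_arg_min (\<lambda>v. sample_norm m ys (\<lambda>y. u y - v y)) (\<lambda>v. v \<in> poly_space \<Lambda>') w"
    and "\<Lambda> \<in> \<L>" and "v \<in> poly_space \<Lambda>"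
  shows "sample_norm m ys (\<lambda>y. u y - w y) \<le> sample_norm m ys (\<lambda>y. u y - v y)"
proof -
  have "sample_norm m ys (\<lambda>y. u y - w y) \<le> best_sample_error m ys u \<Lambda>'"
    unfolding best_sample_error_def using assms(2)
    by (intro cINF_greatest) (auto simp: is_arg_min_linorder poly_space_def)
  also have "\<dots> \<le> best_sample_error m ys u \<Lambda>"
    using assms(1,3) by (simp add: is_arg_min_linorder)
  also have "\<dots> \<le> sample_norm m ys (\<lambda>y. u y - v y)"
    by (rule best_sample_error_le[OF assms(4)])
  finally show ?thesis .
qed

lemma Linf_norm_AE:
  assumes "Linf_norm M f \<le> ennreal e" and "0 \<le> e"
  shows "AE x in M. \<bar>f x\<bar> \<le> e"
  using esssup_AE[of "\<lambda>x. ennreal \<bar>f x\<bar>" M]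
proof eventually_elim
  case (elim x)
  then have "ennreal \<bar>f x\<bar> \<le> ennreal e"
    using assms(1) unfolding Linf_norm_def by (rule order_trans)
  then show ?case using assms(2) by simp
qed

lemma iid_distr:
  assumes "prob_space \<Omega>" and "prob_space.indep_vars \<Omega> (\<lambda>_. \<rho>) Y {..<m}" and "0 < m"
    and "\<And>i. i < m \<Longrightarrow> distr \<Omega> \<rho> (Y i) = \<rho>"
  shows "(\<lambda>\<omega>. \<lambda>i\<in>{..<m}. Y i \<omega>) \<in> measurable \<Omega> (PiM {..<m} (\<lambda>_. \<rho>))"
    and "distr \<Omega> (PiM {..<m} (\<lambda>_. \<rho>)) (\<lambda>\<omega>. \<lambda>i\<in>{..<m}. Y i \<omega>) = PiM {..<m} (\<lambda>_. \<rho>)"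
proof -
  interpret prob_space \<Omega> by (rule assms)
  have "{..<m} \<noteq> {}" using assms(3) by (metis empty_iff lessThan_iff)
  have rv: "Y i \<in> measurable \<Omega> \<rho>" if "i \<in> {..<m}" for i
    using assms(2) that by (auto simp: indep_vars_def2)
  show "(\<lambda>\<omega>. \<lambda>i\<in>{..<m}. Y i \<omega>) \<in> measurable \<Omega> (PiM {..<m} (\<lambda>_. \<rho>))"
    by (intro measurable_restrict rv)
  have "distr \<Omega> (PiM {..<m} (\<lambda>_. \<rho>)) (\<lambda>\<omega>. \<lambda>i\<in>{..<m}. Y i \<omega>) = PiM {..<m} (\<lambda>i. distr \<Omega> \<rho> (Y i))"
    using indep_vars_iff_distr_eq_PiM'[of "{..<m}" Y "\<lambda>_. \<rho>"] rv assms(2) \<open>{..<m} \<noteq> {}\<close> by simp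
  also have "\<dots> = PiM {..<m} (\<lambda>_. \<rho>)"
    by (intro PiM_cong refl assms) simp
  finally show "distr \<Omega> (PiM {..<m} (\<lambda>_. \<rho>)) (\<lambda>\<omega>. \<lambda>i\<in>{..<m}. Y i \<omega>) = PiM {..<m} (\<lambda>_. \<rho>)" .
qed

text \<open>The condition makes the exponent at least (1 + r) ln m + ln C. Then ln C cancels the
  number C of spaces, one ln m cancels the dimension N, and m^(-r) remains.\<close>

lemma failure_probability_bound:
  fixes C m N s r :: real
  assumes "1 \<le> N" and "1 \<le> s" and "0 < r" and "2 \<le> m" and "1 \<le> C"
    and cond: "(1 + r + ln C / ln m) * (N powr s / ((1 - ln 2) / 2)) \<le> m / ln m"
  shows "C * (N * exp (- ((1 - ln 2) / 2 * m / N powr s))) \<le> m powr (- r)"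
proof -
  define \<zeta> :: real where "\<zeta> = (1 - ln 2) / 2"
  have ln2: "ln (2::real) < 1" "2 / 3 \<le> ln (2::real)"
    using ln2_le_25_over_36 ln2_ge_two_thirds by auto
  then have \<zeta>: "0 < \<zeta>" "\<zeta> \<le> ln 2" by (auto simp: \<zeta>_def)
  have lnm: "ln 2 \<le> ln m" using assms by simp
  then have lnm0: "0 < ln m" using ln2 by linarith
  have Ns: "N \<le> N powr s" using powr_mono[of 1 s N] assms by simp
  have N0: "0 < N powr s" using Ns assms by linarith
  have "(1 + r) * ln m + ln C = ln m * (1 + r + ln C / ln m)"
    using lnm0 by (simp add: field_simps)
  also have "\<dots> \<le> \<zeta> * m / N powr s"
    using cond[folded \<zeta>_def] lnm0 N0 \<zeta>(1) by (simp add: field_simps)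
  finally have expo: "(1 + r) * ln m + ln C \<le> \<zeta> * m / N powr s" .
  \<comment> \<open>The condition gives ln m \<le> \<zeta> m / N^s, and \<zeta> \<le> ln 2 \<le> ln
    m; hence N^s \<le> m.\<close>
  have "N \<le> m"
  proof -
    have "0 \<le> ln C" using assms by simp
    moreover have "0 \<le> r * ln m" using assms lnm0 by simp
    ultimately have "ln m \<le> \<zeta> * m / N powr s" using expo by (simp add: distrib_right)
    then have "ln m * N powr s \<le> \<zeta> * m" using N0 by (simp add: field_simps)
    moreover have "\<zeta> * N powr s \<le> ln m * N powr s"
      using lnm \<zeta>(2) N0 by (intro mult_right_mono) auto
    ultimately have "\<zeta> * N powr s \<le> \<zeta> * m" by linarith
    then show ?thesis using \<zeta>(1) Ns by simp
  qed
  have "exp (- (\<zeta> * m / N powr s)) \<le> exp (- ((1 + r) * ln m + ln C))"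
    using expo by simp
  also have "\<dots> = m powr (- r) / m / C"
    using assms by (simp add: powr_def exp_diff exp_minus exp_add distrib_right field_simps)
  finally have "C * (N * exp (- (\<zeta> * m / N powr s))) \<le> C * (N * (m powr (- r) / m / C))"
    using assms by (intro mult_left_mono) auto
  also have "\<dots> = N / m * m powr (- r)" using assms by simp
  also have "\<dots> \<le> 1 * m powr (- r)" using \<open>N \<le> m\<close> assms by (intro mult_right_mono) auto
  finally show ?thesis by (simp add: \<zeta>_def)
qed

context christoffel_product
begin

text \<open>Optimality bounds both sample errors by e, so the sample norm of g = v - w is at most 2
  e; passing to the true norm on the space of G costs a factor sqrt 2.\<close>

lemma estimator_error_le:
  assumes \<Lambda>: "\<And>\<Lambda>. \<Lambda> \<in> \<L> \<Longrightarrow> finite \<Lambda> \<and> \<Lambda> \<subseteq> multi_indices d"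
    and cover: "\<And>\<Lambda> \<Lambda>'. \<Lambda> \<in> \<L> \<Longrightarrow> \<Lambda>' \<in> \<L> \<Longrightarrow>
      \<exists>G. finite G \<and> \<Lambda> \<union> \<Lambda>' \<subseteq> G \<and> G \<subseteq> multi_indices d \<and>
        (\<forall>v\<in>poly_space G. (\<integral>y. (v y)\<^sup>2 \<partial>\<rho>) \<le> 2 * (sample_norm m ys v)\<^sup>2)"
    and min: "is_arg_min (best_sample_error m ys u) (\<lambda>\<Lambda>. \<Lambda> \<in> \<L>) \<Lambda>'"
      "is_arg_min (\<lambda>v. sample_norm m ys (\<lambda>y. u y - v y)) (\<lambda>v. v \<in> poly_space \<Lambda>') w"
    and v: "\<Lambda>\<^sub>0 \<in> \<L>" "v \<in> poly_space \<Lambda>\<^sub>0"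
    and u [measurable]: "u \<in> borel_measurable \<rho>"
    and e: "0 \<le> e" "AE y in \<rho>. \<bar>u y - v y\<bar> \<le> e" and m: "0 < m"
    and sample: "\<And>i. i < m \<Longrightarrow> \<bar>u (ys i) - v (ys i)\<bar> \<le> e"
  shows "L2_norm \<rho> (\<lambda>y. u y - w y) \<le> ennreal ((1 + 2 * sqrt 2) * e)"
proof -
  interpret R: prob_space \<rho> by (rule prob_space_\<rho>)
  have \<Lambda>': "\<Lambda>' \<in> \<L>" and w: "w \<in> poly_space \<Lambda>'"
    using min by (auto simp: is_arg_min_linorder)
  obtain G where G: "finite G" "\<Lambda>\<^sub>0 \<union> \<Lambda>' \<subseteq> G" "G \<subseteq> multi_indices d"
    and equiv: "\<And>v. v \<in> poly_space G \<Longrightarrow> (\<integral>y. (v y)\<^sup>2 \<partial>\<rho>) \<le> 2 * (sample_norm m ys v)\<^sup>2"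
    using cover[OF v(1) \<Lambda>'] by blast
  define g where "g = (\<lambda>y. v y - w y)"
  have vG: "v \<in> poly_space G" and wG: "w \<in> poly_space G"
    using poly_space_mono[OF G(1)] G(2) v(2) w by blast+
  then have gG: "g \<in> poly_space G" unfolding g_def by (rule poly_space_diff)
  have [measurable]: "v \<in> borel_measurable \<rho>" "g \<in> borel_measurable \<rho>"
    using poly_space_bounded_measurable(1)[OF G(1,3)] vG gG by auto
  obtain C where C: "\<And>y. y \<in> space \<rho> \<Longrightarrow> \<bar>g y\<bar> \<le> C"
    using poly_space_bounded_measurable(2)[OF G(1,3) gG] by blast
  have uv: "sample_norm m ys (\<lambda>y. u y - v y) \<le> e"
    by (intro sample_norm_le m e(1) sample)
  have uw: "sample_norm m ys (\<lambda>y. u y - w y) \<le> e"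
    using optimized_sample_norm_le[OF min v] uv by linarith
  have "sample_norm m ys g \<le> 2 * e"
    using sample_norm_triangle[of m ys "\<lambda>y. u y - w y" "\<lambda>y. u y - v y"] uv uw by (simp add: g_def)
  then have "(sample_norm m ys g)\<^sup>2 \<le> (2 * e)\<^sup>2"
    by (intro power_mono sample_norm_nonneg)
  then have "(\<integral>y. (g y)\<^sup>2 \<partial>\<rho>) \<le> (2 * sqrt 2 * e)\<^sup>2"
    using equiv[OF gG] by (simp add: power_mult_distrib)
  then have "L2_norm \<rho> (\<lambda>y. (u y - v y) + g y) \<le> ennreal (e + 2 * sqrt 2 * e)"
    using e C by (intro R.integral_square_add_bounded_le) auto
  then show ?thesis by (simp add: g_def distrib_right)
qed

text \<open>The only random exception is the set \<open>Bad\<close>, whose measure is at most the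
  number of spaces times the tail bound. The comparison with the competitors holds almost
  surely.\<close>

theorem optimized_least_squares_error:
  fixes Y :: "nat \<Rightarrow> 'a \<Rightarrow> nat \<Rightarrow> real"
  assumes \<Lambda>: "\<And>\<Lambda>. \<Lambda> \<in> \<L> \<Longrightarrow> finite \<Lambda> \<and> \<Lambda> \<subseteq> multi_indices d"
    and cover: "\<And>\<Lambda> \<Lambda>'. \<Lambda> \<in> \<L> \<Longrightarrow> \<Lambda>' \<in> \<L> \<Longrightarrow> \<exists>G\<in>\<G>. \<Lambda> \<union> \<Lambda>' \<subseteq> G"
    and \<G>: "finite \<G>" "\<G> \<subseteq> lower_sets d N"
    and N: "1 \<le> N" and r: "0 < r" and m2: "2 \<le> m" and c: "real (card \<G>) \<le> c" "1 \<le> c"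
    and cond: "(1 + r + ln c / ln (real m)) * (real N powr s / ((1 - ln 2) / 2)) \<le> real m / ln (real m)"
    and u [measurable]: "u \<in> borel_measurable \<rho>"
    and opt: "optimized_least_squares \<rho> m u \<L> L w"
    and \<Omega>: "prob_space \<Omega>" "prob_space.indep_vars \<Omega> (\<lambda>_. \<rho>) Y {..<m}"
      "\<And>i. i < m \<Longrightarrow> distr \<Omega> \<rho> (Y i) = \<rho>"
  shows "1 - real m powr (- r) \<le> measure \<Omega> {\<omega> \<in> space \<Omega>. L2_norm \<rho> (\<lambda>y. u y - w (\<lambda>i\<in>{..<m}. Y i \<omega>) y)
    \<le> ennreal (1 + 2 * sqrt 2) * best_Linf_error \<rho> u \<L>}"
proof -
  interpret R: prob_space \<rho> by (rule prob_space_\<rho>)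
  interpret O: prob_space \<Omega> by (rule \<Omega>)
  let ?P = "PiM {..<m} (\<lambda>_. \<rho>)" and ?Z = "\<lambda>\<omega>. \<lambda>i\<in>{..<m}. Y i \<omega>"
  interpret PP: prob_space ?P by (intro prob_space_PiM prob_space_\<rho>)
  have m: "0 < m" using m2 by simp
  let ?d = "real m powr (- r)"
  let ?p = "real N * exp (- ((1 - ln 2) / 2 * real m / real N powr s))"
  have "real (card \<G>) * ?p \<le> c * ?p"
    by (intro mult_right_mono c) simp
  also have "\<dots> \<le> ?d"
    using N c m2 one_le_s r cond by (intro failure_probability_bound) auto
  finally have bound: "real (card \<G>) * ?p \<le> ?d" .
  have "0 \<le> ?d" by simp
  show ?thesis
  proof (cases "best_Linf_error \<rho> u \<L> = \<infinity>")
    case True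
    have "ennreal (1 + 2 * sqrt 2) \<noteq> 0" by (simp add: ennreal_eq_0_iff not_le add_pos_pos)
    then have "ennreal (1 + 2 * sqrt 2) * best_Linf_error \<rho> u \<L> = \<infinity>"
      using True by (simp add: ennreal_mult_top)
    then show ?thesis using \<open>0 \<le> ?d\<close> by (simp add: O.prob_space)
  next
    case False
    define e where "e = enn2real (best_Linf_error \<rho> u \<L>)"
    have e: "best_Linf_error \<rho> u \<L> = ennreal e" "0 \<le> e"
      using False by (simp_all add: e_def ennreal_enn2real_if)
    \<comment> \<open>The infimum over index sets and polynomials may not be attained, so a sequence
      of competitors with error at most e + 1/(k+1) is used and k tends to infinity for each
      sample.\<close>
    define \<epsilon> where "\<epsilon> = (\<lambda>k. e + 1 / real (Suc k))"
    have \<epsilon>: "e < \<epsilon> k" "0 \<le> \<epsilon> k" for k using e(2) by (auto simp: \<epsilon>_def)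
    have "\<exists>\<Lambda> v. \<Lambda> \<in> \<L> \<and> v \<in> poly_space \<Lambda> \<and> Linf_norm \<rho> (\<lambda>y. u y - v y) \<le> ennreal (\<epsilon> k)" for k
    proof -
      have "best_Linf_error \<rho> u \<L> < ennreal (\<epsilon> k)"
        using \<epsilon>[of k] e by (simp add: ennreal_less_iff)
      then show ?thesis
        unfolding best_Linf_error_def INF_less_iff by (meson less_imp_le)
    qed
    then obtain \<Lambda>\<^sub>0 v where v: "\<And>k. \<Lambda>\<^sub>0 k \<in> \<L>" "\<And>k. v k \<in> poly_space (\<Lambda>\<^sub>0 k)"
      and Linf: "\<And>k. Linf_norm \<rho> (\<lambda>y. u y - v k y) \<le> ennreal (\<epsilon> k)"
      by metis
    have "\<exists>B. B \<in> sets ?P \<and> measure ?P B \<le> ?p \<and>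
      (\<forall>ys\<in>space ?P - B. \<forall>v\<in>poly_space G. (\<integral>y. (v y)\<^sup>2 \<partial>\<rho>) \<le> 2 * (sample_norm m ys v)\<^sup>2)"
      if "G \<in> \<G>" for G
    proof -
      have "G \<in> lower_sets d N" using \<G>(2) that by blast
      from poly_space_norm_equivalence[OF this m] show ?thesis by metis
    qed
    then obtain B where B: "\<And>G. G \<in> \<G> \<Longrightarrow> B G \<in> sets ?P"
      "\<And>G. G \<in> \<G> \<Longrightarrow> measure ?P (B G) \<le> ?p"
      "\<And>G ys v. G \<in> \<G> \<Longrightarrow> ys \<in> space ?P - B G \<Longrightarrow> v \<in> poly_space G \<Longrightarrow>
        (\<integral>y. (v y)\<^sup>2 \<partial>\<rho>) \<le> 2 * (sample_norm m ys v)\<^sup>2"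
      by metis
    define Bad where "Bad = (\<Union>G\<in>\<G>. B G)"
    have Bad: "Bad \<in> sets ?P" unfolding Bad_def using \<G>(1) B(1) by auto
    have "measure ?P Bad \<le> (\<Sum>G\<in>\<G>. measure ?P (B G))"
      unfolding Bad_def using \<G>(1) B(1) by (intro PP.finite_measure_subadditive_finite) auto
    also have "\<dots> \<le> (\<Sum>G\<in>\<G>. ?p)"
      by (intro sum_mono B(2))
    also have "\<dots> \<le> ?d" using bound by simp
    finally have Bad_le: "measure ?P Bad \<le> ?d" .
    let ?c = "(1 + 2 * sqrt 2) * e"
    have c0: "0 \<le> ?c" using e(2) by (intro mult_nonneg_nonneg) auto
    have w_meas [measurable]: "(\<lambda>(ys, y). w ys y) \<in> borel_measurable (?P \<Otimes>\<^sub>M \<rho>)"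
      using opt by (simp add: optimized_least_squares_def)
    have diff_meas: "(\<lambda>y. u y - w ys y) \<in> borel_measurable \<rho>" if "ys \<in> space ?P" for ys
      using measurable_compose_Pair1[OF that w_meas] by simp
    define T where "T = {ys \<in> space ?P. L2_norm \<rho> (\<lambda>y. u y - w ys y) \<le> ennreal ?c}"
    have T: "T \<in> sets ?P"
    proof -
      have "T = {ys \<in> space ?P. (\<integral>\<^sup>+y. ennreal ((u y - w ys y)\<^sup>2) \<partial>\<rho>) \<le> ennreal (?c\<^sup>2)}"
        unfolding T_def using L2_norm_le_iff[OF diff_meas c0] by auto
      moreover have "(\<lambda>ys. \<integral>\<^sup>+y. ennreal ((u y - w ys y)\<^sup>2) \<partial>\<rho>) \<in> borel_measurable ?P"
      proof (rule R.borel_measurable_nn_integral)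
        have "(\<lambda>x. ennreal ((u (snd x) - (case x of (ys, y) \<Rightarrow> w ys y))\<^sup>2)) \<in> borel_measurable (?P \<Otimes>\<^sub>M \<rho>)"
          by measurable
        then show "(\<lambda>(ys, y). ennreal ((u y - w ys y)\<^sup>2)) \<in> borel_measurable (?P \<Otimes>\<^sub>M \<rho>)"
          by (simp add: split_beta')
      qed
      ultimately show ?thesis by simp
    qed
    have AE_v: "AE y in \<rho>. \<bar>u y - v k y\<bar> \<le> \<epsilon> k" for k
      by (rule Linf_norm_AE[OF Linf \<epsilon>(2)])
    \<comment> \<open>The essential supremum allows a null set for each k. Their countable union is
      null, so it is almost surely avoided by all m sample points.\<close>
    then have "AE y in \<rho>. \<forall>k. \<bar>u y - v k y\<bar> \<le> \<epsilon> k"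
      by (simp add: AE_all_countable)
    then have "AE ys in ?P. \<forall>k. \<bar>u (ys i) - v k (ys i)\<bar> \<le> \<epsilon> k" if "i \<in> {..<m}" for i
      using that by (intro AE_PiM_component[where P = "\<lambda>y. \<forall>k. \<bar>u y - v k y\<bar> \<le> \<epsilon> k"]) (auto intro: prob_space_\<rho>)
    then have "AE ys in ?P. \<forall>i\<in>{..<m}. \<forall>k. \<bar>u (ys i) - v k (ys i)\<bar> \<le> \<epsilon> k"
      by (intro eventually_ball_finite) auto
    then have "AE ys in ?P. ys \<in> space ?P - Bad \<longrightarrow> ys \<in> T"
    proof eventually_elim
      case (elim ys)
      show ?case
      proof
        assume ys: "ys \<in> space ?P - Bad"
        have min: "is_arg_min (best_sample_error m ys u) (\<lambda>\<Lambda>. \<Lambda> \<in> \<L>) (L ys)"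
          "is_arg_min (\<lambda>v. sample_norm m ys (\<lambda>y. u y - v y)) (\<lambda>v. v \<in> poly_space (L ys)) (w ys)"
          using opt ys by (auto simp: optimized_least_squares_def)
        have cov: "\<exists>G. finite G \<and> \<Lambda> \<union> \<Lambda>' \<subseteq> G \<and> G \<subseteq> multi_indices d \<and>
          (\<forall>v\<in>poly_space G. (\<integral>y. (v y)\<^sup>2 \<partial>\<rho>) \<le> 2 * (sample_norm m ys v)\<^sup>2)"
          if *: "\<Lambda> \<in> \<L>" "\<Lambda>' \<in> \<L>" for \<Lambda> \<Lambda>'
        proof -
          obtain G where "G \<in> \<G>" "\<Lambda> \<union> \<Lambda>' \<subseteq> G" using cover[OF *] by blast
          then show ?thesis
            using \<G>(2) B(3)[of G ys] ys by (intro exI[of _ G]) (auto simp: Bad_def lower_sets_def)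
        qed
        have le: "L2_norm \<rho> (\<lambda>y. u y - w ys y) \<le> ennreal ((1 + 2 * sqrt 2) * \<epsilon> k)" for k
          by (rule estimator_error_le[OF \<Lambda> cov min v u \<epsilon>(2) AE_v m]) (use elim in auto)
        have "(\<lambda>k. (1 + 2 * sqrt 2) * \<epsilon> k) \<longlonglongrightarrow> (1 + 2 * sqrt 2) * (e + 0)"
          unfolding \<epsilon>_def by (intro tendsto_intros LIMSEQ_Suc[OF lim_1_over_n])
        then have "(\<lambda>k. ennreal ((1 + 2 * sqrt 2) * \<epsilon> k)) \<longlonglongrightarrow> ennreal ((1 + 2 * sqrt 2) * (e + 0))"
          by (rule tendsto_ennrealI)
        then have "L2_norm \<rho> (\<lambda>y. u y - w ys y) \<le> ennreal ((1 + 2 * sqrt 2) * (e + 0))"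
          by (rule LIMSEQ_le_const) (use le in auto)
        then show "ys \<in> T" using ys by (simp add: T_def)
      qed
    qed
    then have "measure ?P (space ?P - Bad) \<le> measure ?P T"
      by (rule PP.finite_measure_mono_AE) (rule T)
    moreover have "measure ?P (space ?P - Bad) = 1 - measure ?P Bad"
      using Bad by (simp add: PP.prob_compl)
    ultimately have "1 - ?d \<le> measure ?P T" using Bad_le by linarith
    also have "measure ?P T = measure (distr \<Omega> ?P ?Z) T"
      by (simp only: iid_distr(2)[OF \<Omega>(1,2) m \<Omega>(3)])
    also have "\<dots> = measure \<Omega> (?Z -` T \<inter> space \<Omega>)"
      by (rule measure_distr[OF iid_distr(1)[OF \<Omega>(1,2) m \<Omega>(3)] T])
    also have "?Z -` T \<inter> space \<Omega> = {\<omega> \<in> space \<Omega>. L2_norm \<rho> (\<lambda>y. u y - w (?Z \<omega>) y)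
      \<le> ennreal (1 + 2 * sqrt 2) * best_Linf_error \<rho> u \<L>}"
    proof -
      have "ennreal (1 + 2 * sqrt 2) * best_Linf_error \<rho> u \<L> = ennreal ?c"
        unfolding e(1) using e(2) by (intro ennreal_mult[symmetric]) auto
      moreover have "?Z \<omega> \<in> space ?P" if "\<omega> \<in> space \<Omega>" for \<omega>
        using measurable_space[OF iid_distr(1)[OF \<Omega>(1,2) m \<Omega>(3)] that] .
      ultimately show ?thesis by (auto simp: T_def)
    qed
    finally show ?thesis .
  qed
qed

end

text \<open>Both sets contain the zero index; this saves one element and is the origin of N = 2 n -
  1.\<close>

lemma card_union_downward_closed:
  assumes "downward_closed \<Lambda>" "downward_closed \<Lambda>'" "finite \<Lambda>" "finite \<Lambda>'" "card \<Lambda> = n" "card \<Lambda>' = n" "1 \<le> n"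
  shows "card (\<Lambda> \<union> \<Lambda>') \<le> 2 * n - 1" and "downward_closed (\<Lambda> \<union> \<Lambda>')" and "\<Lambda> \<union> \<Lambda>' \<noteq> {}"
proof -
  have "\<Lambda> \<noteq> {}" "\<Lambda>' \<noteq> {}" using assms by auto
  then have "(\<lambda>_. 0) \<in> \<Lambda> \<inter> \<Lambda>'" using zero_in_downward_closed assms by blast
  then have "1 \<le> card (\<Lambda> \<inter> \<Lambda>')" using assms by (metis One_nat_def Suc_leI card_gt_0_iff empty_iff finite_Int)
  then show "card (\<Lambda> \<union> \<Lambda>') \<le> 2 * n - 1" using card_Un_Int[of \<Lambda> \<Lambda>'] assms by linarith
  show "downward_closed (\<Lambda> \<union> \<Lambda>')" using assms unfolding downward_closed_def by blast
  show "\<Lambda> \<union> \<Lambda>' \<noteq> {}" using \<open>\<Lambda> \<noteq> {}\<close> by blast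
qed

lemma downward_closed_multi_indices: "downward_closed (multi_indices d)"
  unfolding downward_closed_def
proof (intro ballI allI impI)
  fix \<nu> \<mu> assume \<nu>: "\<nu> \<in> multi_indices d" and "\<mu> \<le> \<nu>"
  then have "{j. \<mu> j \<noteq> 0} \<subseteq> {j. \<nu> j \<noteq> 0}"
    by (auto simp: le_fun_def) (metis less_le_trans)
  then show "\<mu> \<in> multi_indices d"
    using \<nu> unfolding multi_indices_def by (auto intro: finite_subset)
qed

lemma lower_sets_mono: "q \<le> q' \<Longrightarrow> lower_sets (enat q) n \<subseteq> lower_sets (enat q') n"
  by (fastforce simp: lower_sets_def multi_indices_enat)

theorem theorem2:
  fixes d :: enat
    and \<theta>1 \<theta>2 s r \<zeta> :: real
    and n m N :: nat
    and u :: "(nat \<Rightarrow> real) \<Rightarrow> real"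
    and \<rho> :: "(nat \<Rightarrow> real) measure"
    and \<Omega> :: "'a measure"
    and Y :: "nat \<Rightarrow> 'a \<Rightarrow> nat \<Rightarrow> real"
    and L Lt :: "(nat \<Rightarrow> nat \<Rightarrow> real) \<Rightarrow> (nat \<Rightarrow> nat) set"
    and w wt :: "(nat \<Rightarrow> nat \<Rightarrow> real) \<Rightarrow> (nat \<Rightarrow> real) \<Rightarrow> real"
  assumes d: "d \<ge> 1"
    and r: "r > 0"
    and n: "n \<ge> 1"
    and m: "m \<ge> 2"
    and N: "N = 2 * n - 1"
    and \<theta>s: "\<theta>1 = -1/2 \<and> \<theta>2 = -1/2 \<and> s = ln 3 / ln 2 \<or>
             \<theta>1 \<in> \<nat> \<and> \<theta>2 \<in> \<nat> \<and> s = 2 * max \<theta>1 \<theta>2 + 2"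
    and \<zeta>: "\<zeta> = (1 - ln 2) / 2"
    and \<rho>: "\<rho> = jacobi_product d \<theta>1 \<theta>2"
    and u: "u \<in> borel_measurable \<rho>"
    and \<Omega>: "prob_space \<Omega>"
    and indep: "prob_space.indep_vars \<Omega> (\<lambda>_. \<rho>) Y {..<m}"
    and distr: "\<And>i. i < m \<Longrightarrow> distr \<Omega> \<rho> (Y i) = \<rho>"
  shows
    "(\<forall>k. d = enat k \<longrightarrow>
        optimized_least_squares \<rho> m u (downward_closed_sets d n) L w \<longrightarrow>
        (m / ln m \<ge> (1 + r) / \<zeta> * card (hyperbolic_cross N k) powr s \<or>
         m / ln m \<ge> (1 + r + N * k * ln 2 / ln m) * (N powr s / \<zeta>) \<or>
         m / ln m \<ge> (1 + r + N * ln (k * N) / ln m) * (N powr s / \<zeta>)) \<longrightarrow>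
        measure \<Omega> {\<omega> \<in> space \<Omega>.
            L2_norm \<rho> (\<lambda>y. u y - w (\<lambda>i\<in>{..<m}. Y i \<omega>) y)
              \<le> ennreal (1 + 2 * sqrt 2) * best_Linf_error \<rho> u (downward_closed_sets d n)}
          \<ge> 1 - 2 * m powr (- r))
     \<and>
     (optimized_least_squares \<rho> m u (anchored_sets d n) Lt wt \<longrightarrow>
        (m / ln m \<ge> (1 + r) / \<zeta> * card (hyperbolic_cross N (N - 1)) powr s \<or>
         m / ln m \<ge> (1 + r + N\<^sup>2 * ln 2 / ln m) * (N powr s / \<zeta>) \<or>
         m / ln m \<ge> (1 + r + 2 * N * ln N / ln m) * (N powr s / \<zeta>)) \<longrightarrow>
        measure \<Omega> {\<omega> \<in> space \<Omega>.
            L2_norm \<rho> (\<lambda>y. u y - wt (\<lambda>i\<in>{..<m}. Y i \<omega>) y)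
              \<le> ennreal (1 + 2 * sqrt 2) * best_Linf_error \<rho> u (anchored_sets d n)}
          \<ge> 1 - 2 * m powr (- r))"
proof -
  have s: "1 \<le> s"
  proof -
    have "ln 2 \<le> ln (3::real)" by simp
    then have "1 \<le> ln 3 / ln (2::real)" by simp
    then show ?thesis using \<theta>s by (auto elim!: Nats_cases)
  qed
  interpret J: prob_space "jacobi_measure \<theta>1 \<theta>2"
    by (rule jacobi_measure_christoffel(1)[OF \<theta>s])
  interpret C: christoffel_product "jacobi_measure \<theta>1 \<theta>2" s d
  proof
    show "poly p \<in> borel_measurable (jacobi_measure \<theta>1 \<theta>2)" for p
      unfolding jacobi_measure_def
      using measurable_restrict_space1[of "poly p" lborel borel "{-1..1}"] poly_borel_measurable[of p] by simp
  qed (use s jacobi_measure_christoffel(2)[OF \<theta>s] in \<open>auto simp: jacobi_measure_def space_restrict_space\<close>)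
  have \<rho>_eq: "\<rho> = C.\<rho>"
    by (simp add: \<rho> C.\<rho>_def jacobi_product_def)
  have N1: "1 \<le> N" using n N by simp
  \<comment> \<open>Here c is any upper bound for the number of lower sets, and ln c is the price of
    the union bound.\<close>
  let ?ok = "\<lambda>q c. real (card (lower_sets (enat q) N)) \<le> c \<and> 1 \<le> c \<and>
    (1 + r + ln c / ln (real m)) * (real N powr s / \<zeta>) \<le> real m / ln (real m)"
  \<comment> \<open>The unions live in q coordinates: q = d in the first part, q = N - 1 in the
    anchored one.\<close>
  have estimate: "1 - 2 * real m powr (- r) \<le> measure \<Omega> {\<omega> \<in> space \<Omega>.
      L2_norm \<rho> (\<lambda>y. u y - w (\<lambda>i\<in>{..<m}. Y i \<omega>) y) \<le> ennreal (1 + 2 * sqrt 2) * best_Linf_error \<rho> u \<L>}"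
    if union: "\<And>\<Lambda> \<Lambda>'. \<Lambda> \<in> \<L> \<Longrightarrow> \<Lambda>' \<in> \<L> \<Longrightarrow> \<Lambda> \<union> \<Lambda>' \<in> lower_sets d N \<inter> lower_sets (enat q) N"
      and opt: "optimized_least_squares \<rho> m u \<L> L w"
      and cond: "(1 + r) / \<zeta> * card (hyperbolic_cross N q) powr s \<le> real m / ln (real m) \<or>
        (\<exists>c. ?ok q c)"
    for \<L> L q and w :: "(nat \<Rightarrow> nat \<Rightarrow> real) \<Rightarrow> (nat \<Rightarrow> real) \<Rightarrow> real"
  proof -
    have sets: "finite \<Lambda> \<and> \<Lambda> \<subseteq> multi_indices d" if "\<Lambda> \<in> \<L>" for \<Lambda>
      using union[OF that that] by (simp add: lower_sets_def)
    note bound = C.optimized_least_squares_error[OF sets _ _ _ _ r m _ _ _ u[unfolded \<rho>_eq]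
      opt[unfolded \<rho>_eq] \<Omega> indep[unfolded \<rho>_eq] distr[unfolded \<rho>_eq], folded \<rho>_eq \<zeta>]
    have "1 - real m powr (- r) \<le> measure \<Omega> {\<omega> \<in> space \<Omega>.
      L2_norm \<rho> (\<lambda>y. u y - w (\<lambda>i\<in>{..<m}. Y i \<omega>) y) \<le> ennreal (1 + 2 * sqrt 2) * best_Linf_error \<rho> u \<L>}"
      using cond
    proof (elim disjE exE conjE)
      assume cond: "(1 + r) / \<zeta> * card (hyperbolic_cross N q) powr s \<le> real m / ln (real m)"
      let ?H = "hyperbolic_cross N q"
      \<comment> \<open>The cross may have more coordinates than d, so it is cut down to admissible
        indices. Then \<open>bound\<close> is applied with \<open>card ?H\<close> in place of N and
        one space, so that its logarithmic term is ln 1 = 0.\<close>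
      let ?G = "?H \<inter> multi_indices d"
      show ?thesis
      proof (rule bound)
        show "\<exists>G\<in>{?G}. \<Lambda> \<union> \<Lambda>' \<subseteq> G" if "\<Lambda> \<in> \<L>" "\<Lambda>' \<in> \<L>" for \<Lambda> \<Lambda>'
          using lower_sets_hyperbolic_cross[of "\<Lambda> \<union> \<Lambda>'" q N] union[OF that] by (simp add: lower_sets_def)
        have "(\<lambda>_. 0) \<in> ?G"
          using zero_in_hyperbolic_cross[OF N1] by (simp add: multi_indices_def)
        then have "?G \<noteq> {}" by blast
        moreover have "downward_closed ?G"
          using downward_closed_hyperbolic_cross[of N q] downward_closed_multi_indices[of d]
          unfolding downward_closed_def by blast
        ultimately show "{?G} \<subseteq> lower_sets d (card ?H)"
          using finite_hyperbolic_cross[of N q] by (auto simp: lower_sets_def intro: card_mono)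
        show "1 \<le> card ?H"
          using zero_in_hyperbolic_cross[OF N1, of q] finite_hyperbolic_cross[of N q]
          by (metis One_nat_def Suc_leI card_gt_0_iff empty_iff)
        show "real (card {?G}) \<le> 1" "(1::real) \<le> 1" "finite {?G}" by simp_all
        show "(1 + r + ln 1 / ln (real m)) * (real (card ?H) powr s / \<zeta>) \<le> real m / ln (real m)"
          using cond by simp
      qed
    next
      fix c assume c: "real (card (lower_sets (enat q) N)) \<le> c" "1 \<le> c"
        "(1 + r + ln c / ln (real m)) * (real N powr s / \<zeta>) \<le> real m / ln (real m)"
      let ?\<G> = "lower_sets d N \<inter> lower_sets (enat q) N"
      have "card ?\<G> \<le> card (lower_sets (enat q) N)"
        by (intro card_mono finite_lower_sets) auto
      then have card: "real (card ?\<G>) \<le> c" using c(1) by linarith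
      have cover: "\<exists>G\<in>?\<G>. \<Lambda> \<union> \<Lambda>' \<subseteq> G" if "\<Lambda> \<in> \<L>" "\<Lambda>' \<in> \<L>" for \<Lambda> \<Lambda>'
        using union[OF that] by blast
      show ?thesis
        by (rule bound[OF _ cover _ _ N1 card c(2,3)]) (simp_all add: finite_lower_sets)
    qed
    moreover have "0 \<le> real m powr (- r)" by simp
    ultimately show ?thesis by linarith
  qed
  show ?thesis
  proof (intro conjI allI impI)
    fix k assume k: "d = enat k"
      and opt: "optimized_least_squares \<rho> m u (downward_closed_sets d n) L w"
      and cond: "m / ln m \<ge> (1 + r) / \<zeta> * card (hyperbolic_cross N k) powr s \<or>
         m / ln m \<ge> (1 + r + N * k * ln 2 / ln m) * (N powr s / \<zeta>) \<or>
         m / ln m \<ge> (1 + r + N * ln (k * N) / ln m) * (N powr s / \<zeta>)"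
    have k1: "1 \<le> k" using d k by (simp add: one_enat_def)
    then have kN: "1 \<le> k * N" using N1 by simp
    have union: "\<Lambda> \<union> \<Lambda>' \<in> lower_sets d N \<inter> lower_sets (enat k) N"
      if "\<Lambda> \<in> downward_closed_sets d n" "\<Lambda>' \<in> downward_closed_sets d n" for \<Lambda> \<Lambda>'
      using that card_union_downward_closed[of \<Lambda> \<Lambda>' n] n
      by (auto simp: downward_closed_sets_def lower_sets_def k N)
    have c1: "real (card (lower_sets (enat k) N)) \<le> 2 ^ (k * N)"
      using card_lower_sets_le_power2[of k N] by (metis of_nat_le_iff of_nat_numeral of_nat_power)
    have "card (lower_sets (enat k) N) \<le> (k * N) ^ (N - 1)"
      by (rule card_lower_sets_le_factorial[OF N1 k1])
    \<comment> \<open>Raising the exponent to N gives the logarithm N ln (k N) of the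
      condition.\<close>
    also have "\<dots> \<le> (k * N) ^ N" using kN by (intro power_increasing) auto
    finally have c2: "real (card (lower_sets (enat k) N)) \<le> real (k * N) ^ N"
      by (metis of_nat_le_iff of_nat_power)
    have ln: "ln (2 ^ (k * N) :: real) = N * k * ln 2" "ln (real (k * N) ^ N) = N * ln (k * N)"
      using kN by (simp_all add: ln_realpow mult.commute del: of_nat_mult)
    have one: "1 \<le> (2::real) ^ (k * N)" "1 \<le> real (k * N) ^ N"
      using kN by (auto intro!: one_le_power simp del: of_nat_mult)
    show "measure \<Omega> {\<omega> \<in> space \<Omega>.
            L2_norm \<rho> (\<lambda>y. u y - w (\<lambda>i\<in>{..<m}. Y i \<omega>) y)
              \<le> ennreal (1 + 2 * sqrt 2) * best_Linf_error \<rho> u (downward_closed_sets d n)}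
          \<ge> 1 - 2 * m powr (- r)"
    proof (rule estimate[OF union opt])
      from cond show "(1 + r) / \<zeta> * card (hyperbolic_cross N k) powr s \<le> real m / ln (real m) \<or> (\<exists>c. ?ok k c)"
      proof (elim disjE)
        assume "m / ln m \<ge> (1 + r + N * k * ln 2 / ln m) * (N powr s / \<zeta>)"
        then have "?ok k (2 ^ (k * N))" using c1 one(1) by (intro conjI) (simp_all only: ln)
        then show ?thesis by blast
      next
        assume "m / ln m \<ge> (1 + r + N * ln (k * N) / ln m) * (N powr s / \<zeta>)"
        then have "?ok k (real (k * N) ^ N)" using c2 one(2) by (intro conjI) (simp_all only: ln)
        then show ?thesis by blast
      qed blast
    qed
  next
    assume opt: "optimized_least_squares \<rho> m u (anchored_sets d n) Lt wt"
      and cond: "m / ln m \<ge> (1 + r) / \<zeta> * card (hyperbolic_cross N (N - 1)) powr s \<or>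
         m / ln m \<ge> (1 + r + N\<^sup>2 * ln 2 / ln m) * (N powr s / \<zeta>) \<or>
         m / ln m \<ge> (1 + r + 2 * N * ln N / ln m) * (N powr s / \<zeta>)"
    have union: "\<Lambda> \<union> \<Lambda>' \<in> lower_sets d N \<inter> lower_sets (enat (N - 1)) N"
      if "\<Lambda> \<in> anchored_sets d n" "\<Lambda>' \<in> anchored_sets d n" for \<Lambda> \<Lambda>'
    proof -
      have *: "finite \<Lambda>" "finite \<Lambda>'" "card \<Lambda> = n" "card \<Lambda>' = n" "anchored \<Lambda>" "anchored \<Lambda>'"
        "\<Lambda> \<subseteq> multi_indices d" "\<Lambda>' \<subseteq> multi_indices d"
        using that by (auto simp: anchored_sets_def)
      then have U: "card (\<Lambda> \<union> \<Lambda>') \<le> N" "downward_closed (\<Lambda> \<union> \<Lambda>')" "\<Lambda> \<union> \<Lambda>' \<noteq> {}"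
        using card_union_downward_closed[of \<Lambda> \<Lambda>' n] n by (auto simp: anchored_def N)
      \<comment> \<open>Anchoredness survives unions and confines them to N - 1 coordinates even for
        infinite d.\<close>
      moreover have "anchored (\<Lambda> \<union> \<Lambda>')"
        using U(2) *(5,6) unfolding anchored_def by blast
      ultimately show ?thesis
        using anchored_multi_indices[of "\<Lambda> \<union> \<Lambda>'" N] * by (auto simp: lower_sets_def)
    qed
    have "card (lower_sets (enat (N - 1)) N) \<le> 2 ^ ((N - 1) * N)"
      by (rule card_lower_sets_le_power2)
    also have "\<dots> \<le> (2::nat) ^ N\<^sup>2"
      by (intro power_increasing) (simp_all add: power2_eq_square)
    finally have c1: "real (card (lower_sets (enat (N - 1)) N)) \<le> 2 ^ N\<^sup>2"
      by (metis of_nat_le_iff of_nat_numeral of_nat_power)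
    \<comment> \<open>For n = 1 there are N - 1 = 0 coordinates, while the next count asks for at
      least one; N coordinates also produce the base N * N.\<close>
    have "card (lower_sets (enat (N - 1)) N) \<le> card (lower_sets (enat N) N)"
      by (intro card_mono lower_sets_mono finite_lower_sets) simp
    also have "\<dots> \<le> (N * N) ^ (N - 1)"
      by (rule card_lower_sets_le_factorial[OF N1 N1])
    also have "\<dots> \<le> (N * N) ^ N" using N1 by (intro power_increasing) auto
    also have "\<dots> = N ^ (2 * N)" by (simp add: power_mult power2_eq_square)
    finally have c2: "real (card (lower_sets (enat (N - 1)) N)) \<le> real N ^ (2 * N)"
      by (metis of_nat_le_iff of_nat_power)
    have ln: "ln (2 ^ N\<^sup>2 :: real) = N\<^sup>2 * ln 2" "ln (real N ^ (2 * N)) = 2 * N * ln N"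
      using N1 by (simp_all add: ln_realpow)
    have one: "1 \<le> (2::real) ^ N\<^sup>2" "1 \<le> real N ^ (2 * N)"
      using N1 by (auto intro!: one_le_power)
    show "measure \<Omega> {\<omega> \<in> space \<Omega>.
            L2_norm \<rho> (\<lambda>y. u y - wt (\<lambda>i\<in>{..<m}. Y i \<omega>) y)
              \<le> ennreal (1 + 2 * sqrt 2) * best_Linf_error \<rho> u (anchored_sets d n)}
          \<ge> 1 - 2 * m powr (- r)"
    proof (rule estimate[OF union opt])
      from cond show "(1 + r) / \<zeta> * card (hyperbolic_cross N (N - 1)) powr s \<le> real m / ln (real m) \<or> (\<exists>c. ?ok (N - 1) c)"
      proof (elim disjE)
        assume "m / ln m \<ge> (1 + r + N\<^sup>2 * ln 2 / ln m) * (N powr s / \<zeta>)"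
        then have "?ok (N - 1) (2 ^ N\<^sup>2)" using c1 one(1) by (intro conjI) (simp_all only: ln)
        then show ?thesis by blast
      next
        assume "m / ln m \<ge> (1 + r + 2 * N * ln N / ln m) * (N powr s / \<zeta>)"
        then have "?ok (N - 1) (real N ^ (2 * N))" using c2 one(2) by (intro conjI) (simp_all only: ln)
        then show ?thesis by blast
      qed blast
    qed
  qed
qed

end
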